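(* Let $\mathcal S$ be a finite poset and let $\chi=(\chi_s)_{s\in\mathcal S}$ be a weight with positive integer components. A subspace representation $V=(V_0;V_s)_{s\in\mathcal S}$ of $\mathcal S$ over $\mathbb C$ is $\chi$-unitarizable if and only if $V$ is $\mu_\chi$-polystable.
   Context: A subspace representation of $\mathcal S$ over $\mathbb C$ is a tuple $V=(V_0;V_s)_{s\in\mathcal S}$ with $V_0$ a (nonzero) finite dimensional complex vector space and subspaces $V_s\subseteq V_0$ with $V_s\subseteq V_t$ if $s\prec t$. $V$ is $\chi$-unitarizable if there is a Hermitian inner product on $V_0$ such that $\sum_{s\in\mathcal S}\chi_sP_{V_s}=\chi_0I$ for a scalar $\chi_0$ (necessarily determined by taking traces), where $P_M$ denotes the orthogonal projection of $V_0$ onto the subspace $M$. For a representation $U$ with $U_0\ne0$, $\mu_\chi(U)=\frac1{\dim U_0}\sum_{s\in\mathcal S}\chi_s\dim U_s$. A proper subrepresentation of $V$ is $V_K=(K;V_s\cap K)_{s\in\mathcal S}$ with $0\ne K\subsetneq V_0$. $V$ is $\mu_\chi$-stable (resp. $\mu_\chi$-semistable) if $\mu_\chi(W)<\mu_\chi(V)$ (resp. $\le$) for every proper subrepresentation $W$. $V$ is $\mu_\chi$-polystable if it is $\mu_\chi$-semistable and decomposes as a direct sum (of subspace representations) of finitely many $\mu_\chi$-stable subrepresentations. *)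

theory Defs
  imports "HOL-Analysis.Analysis"
begin

text \<open>
  Vector spaces are linear subspaces \<open>V0\<close> of an arbitrary ambient complex vector space, so that a
  representation and its subrepresentations live in the same type. Only \<open>V0\<close>, not the ambient
  space, is required to be finite dimensional. A tuple \<open>(V0; V s)\<close> indexed by \<open>s \<in> S\<close> is passed as
  the two arguments \<open>V0\<close> and \<open>V\<close>. The weight is written \<open>w\<close>, because \<open>\<chi>\<close> is a binder in
  HOL-Analysis. The values of \<open>V\<close> and \<open>w\<close> outside \<open>S\<close> are irrelevant.
\<close>

locale complex_vector_space = vector_space scale
  for scale :: "complex \<Rightarrow> 'v::ab_group_add \<Rightarrow> 'v" (infixr "*s" 75)
begin

text \<open>The order on \<open>S\<close> is a reflexive relation \<open>r\<close>, so \<open>s \<prec> t\<close> reads \<open>(s, t) \<in> r \<and> s \<noteq> t\<close>.\<close>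

definition subspace_representation ::
  "'s set \<Rightarrow> 's rel \<Rightarrow> 'v set \<Rightarrow> ('s \<Rightarrow> 'v set) \<Rightarrow> bool" where
  "subspace_representation S r V0 V \<longleftrightarrow>
     subspace V0 \<and> V0 \<noteq> {0} \<and> (\<exists>B. finite B \<and> V0 = span B) \<and>
     (\<forall>s\<in>S. subspace (V s) \<and> V s \<subseteq> V0) \<and>
     (\<forall>s\<in>S. \<forall>t\<in>S. (s, t) \<in> r \<and> s \<noteq> t \<longrightarrow> V s \<subseteq> V t)"

text \<open>
  Additivity and homogeneity in the second argument (conjugate linearly) follow from the
  symmetry condition, which also makes \<open>h x x\<close> real.
\<close>

definition hermitian_inner_product :: "'v set \<Rightarrow> ('v \<Rightarrow> 'v \<Rightarrow> complex) \<Rightarrow> bool" where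
  "hermitian_inner_product V0 h \<longleftrightarrow>
     (\<forall>x\<in>V0. \<forall>y\<in>V0. \<forall>z\<in>V0. h (x + y) z = h x z + h y z) \<and>
     (\<forall>c. \<forall>x\<in>V0. \<forall>y\<in>V0. h (c *s x) y = c * h x y) \<and>
     (\<forall>x\<in>V0. \<forall>y\<in>V0. h y x = cnj (h x y)) \<and>
     (\<forall>x\<in>V0. x \<noteq> 0 \<longrightarrow> 0 < Re (h x x))"

definition orthogonal_projection ::
  "('v \<Rightarrow> 'v \<Rightarrow> complex) \<Rightarrow> 'v set \<Rightarrow> 'v \<Rightarrow> 'v" where
  "orthogonal_projection h M x = (THE y. y \<in> M \<and> (\<forall>m\<in>M. h (x - y) m = 0))"

definition unitarizable ::
  "'s set \<Rightarrow> ('s \<Rightarrow> real) \<Rightarrow> 'v set \<Rightarrow> ('s \<Rightarrow> 'v set) \<Rightarrow> bool" where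
  "unitarizable S w V0 V \<longleftrightarrow>
     (\<exists>h. hermitian_inner_product V0 h \<and>
        (\<exists>c0::complex. \<forall>x\<in>V0.
           (\<Sum>s\<in>S. of_real (w s) *s orthogonal_projection h (V s) x) = c0 *s x))"

definition slope ::
  "'s set \<Rightarrow> ('s \<Rightarrow> real) \<Rightarrow> 'v set \<Rightarrow> ('s \<Rightarrow> 'v set) \<Rightarrow> real" where
  "slope S w U0 U = 1 / real (dim U0) * (\<Sum>s\<in>S. w s * real (dim (U s)))"

definition restrict_rep :: "('s \<Rightarrow> 'v set) \<Rightarrow> 'v set \<Rightarrow> 's \<Rightarrow> 'v set" where
  "restrict_rep V K = (\<lambda>s. V s \<inter> K)"

definition slope_stable ::
  "'s set \<Rightarrow> ('s \<Rightarrow> real) \<Rightarrow> 'v set \<Rightarrow> ('s \<Rightarrow> 'v set) \<Rightarrow> bool" where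
  "slope_stable S w V0 V \<longleftrightarrow>
     (\<forall>K. subspace K \<and> K \<noteq> {0} \<and> K \<subset> V0 \<longrightarrow>
        slope S w K (restrict_rep V K) < slope S w V0 V)"

definition slope_semistable ::
  "'s set \<Rightarrow> ('s \<Rightarrow> real) \<Rightarrow> 'v set \<Rightarrow> ('s \<Rightarrow> 'v set) \<Rightarrow> bool" where
  "slope_semistable S w V0 V \<longleftrightarrow>
     (\<forall>K. subspace K \<and> K \<noteq> {0} \<and> K \<subset> V0 \<longrightarrow>
        slope S w K (restrict_rep V K) \<le> slope S w V0 V)"

definition internal_direct_sum :: "'v set \<Rightarrow> nat \<Rightarrow> (nat \<Rightarrow> 'v set) \<Rightarrow> bool" where
  "internal_direct_sum W n A \<longleftrightarrow>
     W = {\<Sum>i<n. a i | a. \<forall>i<n. a i \<in> A i} \<and>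
     (\<forall>a. (\<forall>i<n. a i \<in> A i) \<and> (\<Sum>i<n. a i) = 0 \<longrightarrow> (\<forall>i<n. a i = 0))"

text \<open>
  A direct sum of representations requires not only \<open>V0\<close> but also each \<open>V s\<close> to be the direct sum
  of the corresponding spaces of the summands. The summands have nonzero total space \<open>K i\<close>; the
  case \<open>n = 1\<close>, \<open>K 0 = V0\<close> is allowed.
\<close>

definition slope_polystable ::
  "'s set \<Rightarrow> ('s \<Rightarrow> real) \<Rightarrow> 'v set \<Rightarrow> ('s \<Rightarrow> 'v set) \<Rightarrow> bool" where
  "slope_polystable S w V0 V \<longleftrightarrow>
     slope_semistable S w V0 V \<and>
     (\<exists>n K. (\<forall>i<n. subspace (K i) \<and> K i \<noteq> {0} \<and> K i \<subseteq> V0 \<and>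
                    slope_stable S w (K i) (restrict_rep V (K i))) \<and>
            internal_direct_sum V0 n K \<and>
            (\<forall>s\<in>S. internal_direct_sum (V s) n (\<lambda>i. restrict_rep V (K i) s)))"

end

end

theory Submission
  imports Defs "Jordan_Normal_Form.Determinant"
begin

text \<open>
  Call an inner product on \<open>V0\<close> balanced if \<open>\<Sum>s\<in>S. w s P\<^sub>s\<close> is a scalar \<open>c\<close>, where \<open>P\<^sub>s\<close> projects
  orthogonally onto \<open>V s\<close>. Comparing traces on \<open>V0\<close> shows that \<open>c\<close> can only be the slope \<open>\<mu>\<close>.

  From a balanced inner product to polystability, everything is a computation of traces. For a
  subspace \<open>K\<close>, the trace of \<open>P\<^sub>s\<close> compressed to \<open>K\<close> is at least \<open>dim (V s \<inter> K)\<close>, because \<open>P\<^sub>s\<close>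
  dominates the projection onto \<open>V s \<inter> K\<close>. Summing over \<open>s\<close> gives semistability
  (\<open>balanced_weight_le\<close>). In the case of equality, every \<open>V s\<close> splits along \<open>K\<close> and its orthogonal
  complement. A nonzero subspace of minimal dimension among those of slope \<open>\<mu>\<close> is stable, so it can
  be split off orthogonally, and induction on the dimension yields the decomposition
  (\<open>balanced_decomposition\<close>).

  Conversely, the summands of a polystable representation all have slope \<open>\<mu>\<close> (\<open>summand_slope\<close>), and
  the orthogonal sum of balanced inner products with the same scalar is balanced
  (\<open>balanced_internal_direct_sum\<close>). This reduces the problem to stable representations. There a
  balanced inner product is found by minimizing, over all inner products \<open>h\<close>, the energy
  \<open>(\<Sum>s\<in>S. w s ln det (h restricted to V s)) - \<mu> ln det h\<close>.

  Minimizers are balanced (\<open>energy_minimizer_balanced\<close>): adding \<open>t\<close> times the rank-one form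
  \<open>h(x, u) h(u, y)\<close> to \<open>h\<close> changes \<open>ln det\<close> of the restriction to \<open>W\<close> at the rate \<open>h(P u, u)\<close>, with
  \<open>P\<close> the projection onto \<open>W\<close>. At a minimum, therefore,
  \<open>(\<Sum>s\<in>S. w s h(P\<^sub>s u, u)) = \<mu>\<close> for every unit vector \<open>u\<close>, and a Hermitian operator with
  vanishing quadratic form is zero.

  Minimizers exist (\<open>energy_minimizer_exists\<close>) because stability keeps the energy from staying
  bounded along a degenerating sequence of inner products. Diagonalize the members of a minimizing
  sequence with respect to a fixed inner product, with eigenvalues in increasing order; the energy is
  invariant under scaling, so the smallest eigenvalue may be taken to be \<open>1\<close>. Along a subsequence
  the eigenbases converge, and the limit defines a flag \<open>F 0 \<subseteq> F 1 \<subseteq> \<dots>\<close> with \<open>dim (F j) = j\<close>. Up to a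
  constant factor, the determinant on \<open>V s\<close> is at least the product of the eigenvalues at those
  indices where \<open>V s \<inter> F j\<close> jumps (\<open>gram_det_weighted_lower_bound\<close>). Summation by parts turns this
  into a lower bound for the energy by a constant plus the sum over \<open>j\<close> of
  \<open>(\<mu> j - (\<Sum>s\<in>S. w s dim (V s \<inter> F j))) (t j - t (j - 1))\<close>, where \<open>t j\<close> is the logarithm of the
  eigenvalue with index \<open>j\<close>. By stability, the coefficients with \<open>0 < j < dim V0\<close> are
  positive. So the eigenvalues stay bounded (\<open>eigenvalues_bounded\<close>), and a further subsequence
  converges to an inner product that attains the infimum.
\<close>

section \<open>Determinants of finite arrays\<close>

text \<open>
  The size of the arrays is a number rather than a type, because the determinants below are taken
  on subspaces of varying dimension.
\<close>

definition array_det :: "nat \<Rightarrow> (nat \<Rightarrow> nat \<Rightarrow> complex) \<Rightarrow> complex" where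
  "array_det d f = Determinant.det (Matrix.mat d d (\<lambda>(i, j). f i j))"

lemma array_det_cong:
  assumes "\<And>i j. i < d \<Longrightarrow> j < d \<Longrightarrow> f i j = g i j"
  shows "array_det d f = array_det d g"
  unfolding array_det_def using assms by (intro arg_cong[where f = Determinant.det] eq_matI) auto

lemma array_det_mult:
  "array_det d (\<lambda>i j. \<Sum>k<d. f i k * g k j) = array_det d f * array_det d g"
proof -
  have "Matrix.mat d d (\<lambda>(i, j). \<Sum>k<d. f i k * g k j)
      = Matrix.mat d d (\<lambda>(i, j). f i j) * Matrix.mat d d (\<lambda>(i, j). g i j)"
    by (rule eq_matI) (auto simp: scalar_prod_def lessThan_atLeast0)
  then show ?thesis
    unfolding array_det_def by (simp add: det_mult[where n = d])
qed

lemma array_det_Leibniz: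
  "array_det d f = (\<Sum>p | p permutes {0..<d}. signof p * (\<Prod>i = 0..<d. f i (p i)))"
proof -
  have "array_det d f = (\<Sum>p | p permutes {0..<d}.
      signof p * (\<Prod>i = 0..<d. Matrix.mat d d (\<lambda>(i, j). f i j) $$ (i, p i)))"
    unfolding array_det_def by (rule det_def') simp
  also have "\<dots> = (\<Sum>p | p permutes {0..<d}. signof p * (\<Prod>i = 0..<d. f i (p i)))"
  proof (rule sum.cong[OF refl])
    fix p assume "p \<in> {p. p permutes {0..<d}}"
    then have "p i < d" if "i < d" for i
      using permutes_in_image[of p "{0..<d}" i] that by auto
    then show "signof p * (\<Prod>i = 0..<d. Matrix.mat d d (\<lambda>(i, j). f i j) $$ (i, p i))
        = signof p * (\<Prod>i = 0..<d. f i (p i))"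
      by simp
  qed
  finally show ?thesis .
qed

lemma array_det_transpose: "array_det d (\<lambda>i j. f j i) = array_det d f"
proof -
  have "Matrix.mat d d (\<lambda>(i, j). f j i) = transpose_mat (Matrix.mat d d (\<lambda>(i, j). f i j))"
    by (rule eq_matI) auto
  then show ?thesis
    unfolding array_det_def by (simp add: Determinant.det_transpose[where n = d])
qed

lemma array_det_cnj: "array_det d (\<lambda>i j. cnj (f i j)) = cnj (array_det d f)"
proof -
  have sgn: "cnj (signof p) = signof p" for p :: "nat \<Rightarrow> nat"
    by (simp add: sign_def)
  show ?thesis
    unfolding array_det_Leibniz by (simp add: sgn)
qed

lemma array_det_diagonal:
  assumes "\<And>i j. i < d \<Longrightarrow> j < d \<Longrightarrow> i \<noteq> j \<Longrightarrow> f i j = 0"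
  shows "array_det d f = (\<Prod>i<d. f i i)"
proof -
  have "array_det d f = prod_list (diag_mat (Matrix.mat d d (\<lambda>(i, j). f i j)))"
    unfolding array_det_def
    by (rule det_upper_triangular[where n = d]) (auto simp: upper_triangular_def assms)
  then show ?thesis
    by (simp add: prod_list_diag_prod lessThan_atLeast0)
qed

lemma tendsto_array_det:
  assumes "\<And>i j. i < d \<Longrightarrow> j < d \<Longrightarrow> ((\<lambda>k. f k i j) \<longlongrightarrow> g i j) F"
  shows "((\<lambda>k. array_det d (f k)) \<longlongrightarrow> array_det d g) F"
  unfolding array_det_Leibniz
proof (intro tendsto_sum tendsto_mult tendsto_const tendsto_prod)
  fix p i assume "p \<in> {p. p permutes {0..<d}}" "i \<in> {0..<d}"
  then show "((\<lambda>k. f k i (p i)) \<longlongrightarrow> g i (p i)) F"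
    using permutes_in_image[of p "{0..<d}" i] by (intro assms) auto
qed

text \<open>
  The form in which nonsingularity gets proved later: a linear dependence has to be refuted.
\<close>

lemma array_det_eq_0_imp_kernel:
  assumes "array_det d f = 0"
  obtains v where "\<exists>i<d. v i \<noteq> 0" "\<And>i. i < d \<Longrightarrow> (\<Sum>j<d. f i j * v j) = 0"
proof -
  let ?A = "Matrix.mat d d (\<lambda>(i, j). f i j)"
  obtain v where v: "v \<in> carrier_vec d" "v \<noteq> 0\<^sub>v d" "?A *\<^sub>v v = 0\<^sub>v d"
    using assms det_0_iff_vec_prod_zero[of ?A d] unfolding array_det_def by auto
  show ?thesis
  proof
    show "\<exists>i<d. vec_index v i \<noteq> 0"
      using v by (metis carrier_vecD dim_vec eq_vecI index_zero_vec(1) zero_carrier_vec)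
    fix i assume i: "i < d"
    have "(\<Sum>j<d. f i j * vec_index v j) = vec_index (?A *\<^sub>v v) i"
      using i v(1) by (auto simp: scalar_prod_def lessThan_atLeast0 intro!: sum.cong)
    then show "(\<Sum>j<d. f i j * vec_index v j) = 0"
      using v i by simp
  qed
qed

lemma array_det_scale_columns:
  "array_det d (\<lambda>i j. f i j * c j) = array_det d f * (\<Prod>i<d. c i)"
proof -
  have "array_det d (\<lambda>i j. f i j * c j)
      = array_det d (\<lambda>i j. \<Sum>k<d. f i k * (if k = j then c j else 0))"
    by (rule array_det_cong) (simp add: if_distrib cong: if_cong)
  also have "\<dots> = array_det d f * array_det d (\<lambda>k j. if k = j then c j else 0)"
    by (rule array_det_mult)
  also have "array_det d (\<lambda>k j. if k = j then c j else 0) = (\<Prod>i<d. c i)"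
    by (subst array_det_diagonal) auto
  finally show ?thesis .
qed

section \<open>Facts from real analysis\<close>

text \<open>
  All compactness arguments below use this lemma: bounded coordinates of finitely many vectors or
  eigenvalues are made to converge along one common subsequence.
\<close>

lemma convergent_subsequence_finite_family:
  fixes f :: "nat \<Rightarrow> 'i \<Rightarrow> 'a::heine_borel"
  assumes "finite I" "\<And>i. i \<in> I \<Longrightarrow> bounded (range (\<lambda>k. f k i))"
  obtains r l where "strict_mono r" "\<And>i. i \<in> I \<Longrightarrow> (\<lambda>k. f (r k) i) \<longlonglongrightarrow> l i"
proof -
  have "\<exists>r l. strict_mono r \<and> (\<forall>i\<in>I. (\<lambda>k. f (r k) i) \<longlonglongrightarrow> l i)"
    using assms
  proof (induction I rule: finite_induct)
    case empty
    show ?case by (intro exI[of _ id]) (auto simp: strict_mono_def)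
  next
    case (insert j I)
    then obtain r l where r: "strict_mono r" "\<forall>i\<in>I. (\<lambda>k. f (r k) i) \<longlonglongrightarrow> l i"
      by auto
    have "bounded (range (\<lambda>k. f (r k) j))"
      by (rule bounded_subset[OF insert.prems[of j]]) auto
    then obtain m s where s: "strict_mono (s :: nat \<Rightarrow> nat)" "((\<lambda>k. f (r k) j) \<circ> s) \<longlonglongrightarrow> m"
      using bounded_imp_convergent_subsequence by blast
    have "(\<lambda>k. f ((r \<circ> s) k) i) \<longlonglongrightarrow> (l(j := m)) i" if "i \<in> insert j I" for i
    proof (cases "i = j")
      case True
      then show ?thesis using s(2) by (simp add: o_def)
    next
      case False
      then have "(\<lambda>k. f (r k) i) \<longlonglongrightarrow> l i" using that r(2) by auto
      from LIMSEQ_subseq_LIMSEQ[OF this s(1)] show ?thesis using False by (simp add: o_def)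
    qed
    moreover have "strict_mono (r \<circ> s)"
      using r(1) s(1) by (rule strict_mono_o)
    ultimately show ?case by blast
  qed
  then show ?thesis using that by blast
qed

text \<open>
  The approximation property refers to the competitors \<open>a\<close> instead of the infimum, so a function
  that is unbounded below is covered as well. That the limit of a convergent subsequence is a
  minimizer follows without first bounding the function from below.
\<close>

lemma minimizing_sequence:
  fixes F :: "'a \<Rightarrow> real"
  assumes "A \<noteq> {}"
  obtains x :: "nat \<Rightarrow> 'a" where "\<And>k. x k \<in> A"
    "\<And>a \<epsilon>. a \<in> A \<Longrightarrow> 0 < \<epsilon> \<Longrightarrow> \<forall>\<^sub>F k in sequentially. F (x k) < F a + \<epsilon>"
proof (cases "bdd_below (F ` A)")
  case True
  have "\<exists>a\<in>A. F a < Inf (F ` A) + 1 / real (Suc k)" for k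
    using cInf_lessD[of "F ` A" "Inf (F ` A) + 1 / real (Suc k)"] assms by auto
  then obtain x where x: "\<And>k. x k \<in> A" "\<And>k. F (x k) < Inf (F ` A) + 1 / real (Suc k)"
    by metis
  show ?thesis
  proof (rule that[of x])
    fix a and \<epsilon> :: real assume "a \<in> A" "0 < \<epsilon>"
    have "\<forall>\<^sub>F k in sequentially. 1 / real (Suc k) < \<epsilon>"
      using LIMSEQ_inverse_real_of_nat \<open>0 < \<epsilon>\<close>
      by (auto simp: inverse_eq_divide intro: order_tendstoD(2))
    then show "\<forall>\<^sub>F k in sequentially. F (x k) < F a + \<epsilon>"
    proof eventually_elim
      case (elim k)
      have "Inf (F ` A) \<le> F a"
        using \<open>a \<in> A\<close> True by (auto intro: cInf_lower)
      then show ?case using x(2)[of k] elim by linarith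
    qed
  qed (rule x(1))
next
  case False
  have "\<exists>a\<in>A. F a < - real k" for k
    using False unfolding bdd_below_def by (metis image_iff linorder_not_less)
  then obtain x where x: "\<And>k. x k \<in> A" "\<And>k. F (x k) < - real k"
    by metis
  show ?thesis
  proof (rule that[of x])
    fix a and \<epsilon> :: real assume "a \<in> A" "0 < \<epsilon>"
    have "\<forall>\<^sub>F k in sequentially. - F a < real k"
      using filterlim_real_sequentially by (simp add: filterlim_at_top_dense)
    then show "\<forall>\<^sub>F k in sequentially. F (x k) < F a + \<epsilon>"
    proof eventually_elim
      case (elim k)
      then show ?case using x(2)[of k] \<open>0 < \<epsilon>\<close> by linarith
    qed
  qed (rule x(1))
qed

text \<open>
  Summation by parts: the partial sums of \<open>x\<close> are at most \<open>- \<delta>\<close>, so each increment of \<open>t\<close>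
  contributes at least \<open>\<delta>\<close> times itself. The induction keeps the boundary term.
\<close>

lemma abel_summation_lower_bound:
  fixes x t :: "nat \<Rightarrow> real"
  assumes n: "0 < n" and mono: "\<And>i j. i \<le> j \<Longrightarrow> j < n \<Longrightarrow> t i \<le> t j" and t0: "t 0 = 0"
    and total: "(\<Sum>j<n. x j) = 0"
    and partial: "\<And>m. 0 < m \<Longrightarrow> m < n \<Longrightarrow> (\<Sum>j<m. x j) \<le> - \<delta>"
  shows "\<delta> * t (n - 1) \<le> (\<Sum>j<n. x j * t j)"
proof -
  have "((\<Sum>j<Suc m. x j) + \<delta>) * t m \<le> (\<Sum>j<Suc m. x j * t j)" if "m < n" for m
    using that
  proof (induction m)
    case 0
    then show ?case using t0 by simp
  next
    case (Suc m)
    have "((\<Sum>j<Suc m. x j) + \<delta>) * (t (Suc m) - t m) \<le> 0"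
      using partial[of "Suc m"] mono[of m "Suc m"] Suc.prems by (intro mult_nonpos_nonneg) auto
    moreover have "((\<Sum>j<Suc m. x j) + \<delta>) * t m \<le> (\<Sum>j<Suc m. x j * t j)"
      using Suc by simp
    ultimately show ?case by (simp add: algebra_simps)
  qed
  from this[of "n - 1"] show ?thesis using n total by simp
qed

lemma has_real_derivative_prod_affine:
  fixes a :: "nat \<Rightarrow> real"
  shows "((\<lambda>t. \<Prod>i<d. 1 + t * a i) has_real_derivative (\<Sum>i<d. a i)) (at 0)"
proof (induction d)
  case 0
  show ?case by simp
next
  case (Suc d)
  have "((\<lambda>t. 1 + t * a d) has_real_derivative a d) (at 0)"
    by (auto intro!: derivative_eq_intros)
  from DERIV_mult[OF Suc.IH this] show ?case by simp
qed

lemma Re_of_real_mult: "Re (of_real c * z) = c * Re z"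
  by simp

section \<open>Finite-dimensional subspaces and direct sums\<close>

no_notation Finite_Cartesian_Product.vector_scalar_mult (infixl "*s" 70)

context complex_vector_space
begin

text \<open>
  The ambient space may be infinite dimensional, so finiteness is carried along with each
  subspace.
\<close>

definition fin_subspace :: "'v set \<Rightarrow> bool" where
  "fin_subspace W \<longleftrightarrow> subspace W \<and> (\<exists>B. finite B \<and> W = span B)"

lemma fin_subspaceD: "fin_subspace W \<Longrightarrow> subspace W"
  by (simp add: fin_subspace_def)

lemma fin_subspace_basis:
  assumes "fin_subspace W" "subspace U" "U \<subseteq> W"
  obtains B where "finite B" "independent B" "span B = U" "card B = dim U"
proof -
  obtain B where B: "B \<subseteq> U" "independent B" "U \<subseteq> span B"
    using maximal_independent_subset[of U] by blast
  obtain T where "finite T" "W = span T"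
    using assms(1) by (auto simp: fin_subspace_def)
  then have "finite B"
    using independent_span_bound[of T B] B assms by blast
  moreover have "span B = U"
    using B assms by (intro span_subspace) auto
  ultimately show ?thesis
    using that B dim_eq_card_independent[of B] dim_span[of B] by metis
qed

lemma fin_subspace_subset:
  assumes "fin_subspace W" "subspace U" "U \<subseteq> W"
  shows "fin_subspace U"
  using fin_subspace_basis[OF assms] assms(2) by (metis fin_subspace_def)

lemma dim_zero_subspace [simp]: "dim {0} = 0"
  using dim_eq_card_independent[OF independent_empty] dim_span[of "{}"] by simp

lemma dim_eq_0_imp:
  assumes "fin_subspace W" "dim W = 0"
  shows "W = {0}"
  using fin_subspace_basis[OF assms(1) fin_subspaceD[OF assms(1)] subset_refl] assms(2)
  by (metis card_eq_0_iff span_empty)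

lemma dim_subspace_strict_mono:
  assumes "fin_subspace W" "subspace U" "U \<subset> W"
  shows "dim U < dim W"
proof -
  obtain B where B: "finite B" "independent B" "span B = U" "card B = dim U"
    using fin_subspace_basis[OF assms(1,2)] assms(3) by auto
  obtain C where C: "finite C" "independent C" "span C = W" "card C = dim W"
    using fin_subspace_basis[OF assms(1) fin_subspaceD[OF assms(1)] subset_refl] .
  obtain x where x: "x \<in> W" "x \<notin> U" using assms(3) by auto
  have ind: "independent (insert x B)"
    using independent_insertI[OF _ B(2)] x(2) B(3) by blast
  have "insert x B \<subseteq> span C"
    using x(1) B(3) C(3) assms(3) span_superset[of B] by auto
  then have "card (insert x B) \<le> card C"
    using independent_span_bound[OF C(1) ind] by blast
  moreover have "x \<notin> B" using x(2) B(3) span_superset[of B] by auto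
  ultimately show ?thesis using B C by simp
qed

lemma dim_pos: "fin_subspace K \<Longrightarrow> K \<noteq> {0} \<Longrightarrow> 0 < dim K"
  using dim_eq_0_imp by blast

definition is_direct_sum :: "'v set \<Rightarrow> 'v set \<Rightarrow> 'v set \<Rightarrow> bool" where
  "is_direct_sum K L M \<longleftrightarrow> K = {x + y |x y. x \<in> L \<and> y \<in> M} \<and> L \<inter> M = {0}"

lemma is_direct_sum_subset:
  assumes "is_direct_sum K L M" "subspace L" "subspace M"
  shows "L \<subseteq> K" "M \<subseteq> K"
proof -
  have "x \<in> K" if "x \<in> L" for x
    using that subspace_0[OF assms(3)] assms(1) unfolding is_direct_sum_def
    by (metis (mono_tags, lifting) add.right_neutral mem_Collect_eq)
  moreover have "x \<in> K" if "x \<in> M" for x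
    using that subspace_0[OF assms(2)] assms(1) unfolding is_direct_sum_def
    by (metis (mono_tags, lifting) add.left_neutral mem_Collect_eq)
  ultimately show "L \<subseteq> K" "M \<subseteq> K" by auto
qed

lemma is_direct_sum_unique:
  assumes "is_direct_sum K L M" "subspace L" "subspace M"
    and "x \<in> L" "y \<in> M" "x' \<in> L" "y' \<in> M" "x + y = x' + y'"
  shows "x = x'" "y = y'"
proof -
  have "x - x' = y' - y"
    using assms(8) by (simp add: algebra_simps)
  moreover have "x - x' \<in> L" "y' - y \<in> M"
    using assms by (auto intro: subspace_diff)
  ultimately have "x - x' \<in> L \<inter> M" "y' - y \<in> L \<inter> M" by auto
  moreover have "L \<inter> M = {0}"
    using assms(1) by (simp add: is_direct_sum_def)
  ultimately have "x - x' = 0" "y' - y = 0" by blast+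
  then show "x = x'" "y = y'" by auto
qed

lemma dim_is_direct_sum:
  assumes "fin_subspace L" "fin_subspace M" "is_direct_sum K L M"
  shows "dim K = dim L + dim M"
proof -
  note sub = fin_subspaceD[OF assms(1)] fin_subspaceD[OF assms(2)]
  obtain B where B: "finite B" "independent B" "span B = L" "card B = dim L"
    using fin_subspace_basis[OF assms(1) sub(1)] by auto
  obtain C where C: "finite C" "independent C" "span C = M" "card C = dim M"
    using fin_subspace_basis[OF assms(2) sub(2)] by auto
  have disj: "B \<inter> C = {}"
  proof -
    have "x = 0" if "x \<in> B" "x \<in> C" for x
      using that span_base[of x B] span_base[of x C] B C assms(3) by (auto simp: is_direct_sum_def)
    then show ?thesis
      using dependent_zero[of B] B(2) by auto
  qed
  have fin: "finite (B \<union> C)" using B C by simp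
  have "independent (B \<union> C)"
  proof (rule independent_if_scalars_zero[OF fin])
    fix f x assume *: "(\<Sum>v\<in>B \<union> C. f v *s v) = 0" "x \<in> B \<union> C"
    have "(\<Sum>v\<in>B. f v *s v) + (\<Sum>v\<in>C. f v *s v) = 0"
      using * disj B C by (simp add: sum.union_disjoint)
    moreover have "(\<Sum>v\<in>B. f v *s v) \<in> L" "(\<Sum>v\<in>C. f v *s v) \<in> M"
      using B(3) C(3) by (blast intro: span_sum span_scale span_base)+
    moreover have "0 \<in> L" "0 \<in> M"
      using sub subspace_0 by auto
    ultimately have "(\<Sum>v\<in>B. f v *s v) = 0" "(\<Sum>v\<in>C. f v *s v) = 0"
      using is_direct_sum_unique[OF assms(3) sub, where x' = 0 and y' = 0] by auto
    then show "f x = 0"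
      using independentD[OF B(2) B(1), of f x] independentD[OF C(2) C(1), of f x] * by auto
  qed
  moreover have "span (B \<union> C) = K"
    using assms(3) B C by (simp add: is_direct_sum_def span_Un)
  ultimately have "dim K = card (B \<union> C)"
    by (metis dim_eq_card_independent dim_span)
  then show ?thesis
    using B C disj by (simp add: card_Un_disjoint)
qed

lemma dim_singleton_span: "x \<noteq> 0 \<Longrightarrow> dim (span {x}) = 1"
  using dim_eq_card_independent[of "{x}"] dim_span by auto

text \<open>
  Rank-nullity for a functional that is linear only on \<open>X\<close>: a vector \<open>u\<close> outside the kernel spans
  a complement.
\<close>

lemma dim_kernel:
  fixes \<phi> :: "'v \<Rightarrow> complex"
  assumes X: "fin_subspace X"
    and add: "\<And>x y. x \<in> X \<Longrightarrow> y \<in> X \<Longrightarrow> \<phi> (x + y) = \<phi> x + \<phi> y"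
    and scale: "\<And>c x. x \<in> X \<Longrightarrow> \<phi> (c *s x) = c * \<phi> x"
    and u: "u \<in> X" "\<phi> u \<noteq> 0"
  shows "dim X = Suc (dim {x \<in> X. \<phi> x = 0})"
proof -
  note X' = fin_subspaceD[OF X]
  have zero: "\<phi> 0 = 0"
    using scale[OF subspace_0[OF X'], of 0] by simp
  have sub: "subspace {x \<in> X. \<phi> x = 0}"
    by (rule subspaceI)
      (use X' add scale zero in \<open>auto intro: subspace_0 subspace_add subspace_scale\<close>)
  have u0: "u \<noteq> 0" using u zero by auto
  have su: "subspace (span {u})" "span {u} \<subseteq> X"
    using u X' span_minimal[of "{u}" X] by auto
  have "is_direct_sum X {x \<in> X. \<phi> x = 0} (span {u})"
    unfolding is_direct_sum_def
  proof (intro conjI)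
    show "X = {x + y |x y. x \<in> {x \<in> X. \<phi> x = 0} \<and> y \<in> span {u}}" (is "_ = ?R")
    proof
      show "?R \<subseteq> X" using su X' by (auto intro: subspace_add)
      show "X \<subseteq> ?R"
      proof
        fix x assume x: "x \<in> X"
        define a where "a = - (\<phi> x / \<phi> u)"
        have au: "a *s u \<in> X" "- (a *s u) \<in> span {u}"
          using u X' by (auto intro: subspace_scale span_neg span_scale span_base)
        have "\<phi> (x + a *s u) = 0"
          using add[OF x au(1)] scale[OF u(1)] u by (simp add: a_def del: scale_minus_left)
        moreover have "x + a *s u \<in> X"
          using x au X' by (auto intro: subspace_add)
        moreover have "x = (x + a *s u) + - (a *s u)" by simp
        ultimately show "x \<in> ?R" using au(2) by blast
      qed
    qed
    have "x = 0" if x: "x \<in> X" "\<phi> x = 0" "x \<in> span {u}" for x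
    proof -
      obtain k where k: "x = k *s u" using x(3) by (auto simp: span_singleton)
      then have "k * \<phi> u = 0" using x scale[OF u(1)] by simp
      then show ?thesis using k u by simp
    qed
    then show "{x \<in> X. \<phi> x = 0} \<inter> span {u} = {0}"
      using subspace_0[OF X'] zero by (auto simp: span_zero)
  qed
  then have "dim X = dim {x \<in> X. \<phi> x = 0} + dim (span {u})"
    using dim_is_direct_sum fin_subspace_subset[OF X sub] fin_subspace_subset[OF X su] by auto
  then show ?thesis using dim_singleton_span[OF u0] by simp
qed

lemma internal_direct_sum_0: "internal_direct_sum W 0 A \<longleftrightarrow> W = {0}"
  by (auto simp: internal_direct_sum_def)

lemma internal_direct_sum_cong:
  assumes "\<And>i. i < n \<Longrightarrow> A i = B i"
  shows "internal_direct_sum W n A \<longleftrightarrow> internal_direct_sum W n B"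
proof -
  have "(\<forall>i<n. a i \<in> A i) \<longleftrightarrow> (\<forall>i<n. a i \<in> B i)" for a
    using assms by blast
  then show ?thesis
    unfolding internal_direct_sum_def by simp
qed

text \<open>
  Together with the next lemma, this reduces direct sums with \<open>n\<close> summands to those with two.
\<close>

lemma internal_direct_sum_Suc:
  assumes M: "internal_direct_sum M n A"
    and sum: "is_direct_sum K M L" and sub: "subspace M" "subspace L"
    and L: "A n = L"
  shows "internal_direct_sum K (Suc n) A"
  unfolding internal_direct_sum_def
proof (intro conjI allI impI)
  have Meq: "M = {\<Sum>i<n. a i |a. \<forall>i<n. a i \<in> A i}"
    using M by (simp add: internal_direct_sum_def)
  show "K = {\<Sum>i<Suc n. a i |a. \<forall>i<Suc n. a i \<in> A i}" (is "_ = ?R")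
  proof
    show "K \<subseteq> ?R"
    proof
      fix x assume "x \<in> K"
      then obtain a y where a: "x = (\<Sum>i<n. a i) + y" "\<forall>i<n. a i \<in> A i" "y \<in> L"
        using sum by (auto simp: is_direct_sum_def Meq)
      then have "x = (\<Sum>i<Suc n. (a(n := y)) i)" "\<forall>i<Suc n. (a(n := y)) i \<in> A i"
        using L by (auto simp: less_Suc_eq)
      then show "x \<in> ?R" by blast
    qed
    show "?R \<subseteq> K"
    proof
      fix x assume "x \<in> ?R"
      then obtain a where a: "x = (\<Sum>i<n. a i) + a n" "\<forall>i<Suc n. a i \<in> A i" by auto
      then have "(\<Sum>i<n. a i) \<in> M" "a n \<in> L" using L by (auto simp: Meq)
      then show "x \<in> K" using a sum unfolding is_direct_sum_def by blast
    qed
  qed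
next
  fix a i assume a: "(\<forall>i<Suc n. a i \<in> A i) \<and> (\<Sum>i<Suc n. a i) = 0" and i: "i < Suc n"
  have "(\<Sum>i<n. a i) \<in> M" "a n \<in> L"
    using a M L by (auto simp: internal_direct_sum_def)
  moreover have "(\<Sum>i<n. a i) + a n = 0 + 0" using a by simp
  ultimately have "(\<Sum>i<n. a i) = 0" "a n = 0"
    using is_direct_sum_unique[OF sum sub, where x' = 0 and y' = 0] subspace_0 sub by auto
  then show "a i = 0"
    using M a i by (auto simp: internal_direct_sum_def less_Suc_eq)
qed

lemma internal_direct_sum_SucE:
  assumes K: "internal_direct_sum K (Suc n) A" and A: "\<And>i. i < Suc n \<Longrightarrow> subspace (A i)"
  obtains M where "subspace M" "internal_direct_sum M n A" "is_direct_sum K M (A n)"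
proof -
  define M where "M = {\<Sum>i<n. a i |a. \<forall>i<n. a i \<in> A i}"
  have indep: "a i = 0" if "\<forall>i<Suc n. a i \<in> A i" "(\<Sum>i<Suc n. a i) = 0" "i < Suc n" for a i
    using K[unfolded internal_direct_sum_def, THEN conjunct2, rule_format, OF conjI, OF _ that(2,3)]
      that(1) by auto
  have subM: "subspace M"
  proof (rule subspaceI)
    show "0 \<in> M" unfolding M_def
      using A subspace_0 by (intro CollectI exI[of _ "\<lambda>_. 0"]) auto
    fix x y assume "x \<in> M" "y \<in> M"
    then obtain a b where "x = (\<Sum>i<n. a i)" "\<forall>i<n. a i \<in> A i"
      "y = (\<Sum>i<n. b i)" "\<forall>i<n. b i \<in> A i" by (auto simp: M_def)
    then show "x + y \<in> M" unfolding M_def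
      using A by (intro CollectI exI[of _ "\<lambda>i. a i + b i"])
        (auto simp: sum.distrib intro: subspace_add)
  next
    fix c x assume "x \<in> M"
    then obtain a where "x = (\<Sum>i<n. a i)" "\<forall>i<n. a i \<in> A i" by (auto simp: M_def)
    then show "c *s x \<in> M" unfolding M_def
      using A by (intro CollectI exI[of _ "\<lambda>i. c *s a i"])
        (auto simp: scale_sum_right intro: subspace_scale)
  qed
  have dirM: "internal_direct_sum M n A"
    unfolding internal_direct_sum_def
  proof (intro conjI allI impI)
    fix a i assume "(\<forall>i<n. a i \<in> A i) \<and> (\<Sum>i<n. a i) = 0" "i < n"
    then show "a i = 0"
      using indep[of "a(n := 0)" i] A[of n] subspace_0 by (auto simp: less_Suc_eq)
  qed (simp add: M_def)
  have "is_direct_sum K M (A n)"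
    unfolding is_direct_sum_def
  proof (intro conjI)
    have Keq: "K = {\<Sum>i<Suc n. a i |a. \<forall>i<Suc n. a i \<in> A i}"
      using K by (simp add: internal_direct_sum_def)
    show "K = {x + y |x y. x \<in> M \<and> y \<in> A n}" (is "_ = ?R")
    proof
      show "K \<subseteq> ?R"
      proof
        fix x assume "x \<in> K"
        then obtain a where "x = (\<Sum>i<n. a i) + a n" "\<forall>i<Suc n. a i \<in> A i"
          by (auto simp: Keq)
        then show "x \<in> ?R" unfolding M_def by (auto simp: less_Suc_eq)
      qed
      show "?R \<subseteq> K"
      proof
        fix x assume "x \<in> ?R"
        then obtain a y where a: "x = (\<Sum>i<n. a i) + y" "\<forall>i<n. a i \<in> A i" "y \<in> A n"
          by (auto simp: M_def)
        then have "x = (\<Sum>i<Suc n. (a(n := y)) i)" "\<forall>i<Suc n. (a(n := y)) i \<in> A i"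
          by (auto simp: less_Suc_eq)
        then show "x \<in> K" unfolding Keq by blast
      qed
    qed
    have "x = 0" if x: "x \<in> M" "x \<in> A n" for x
    proof -
      obtain a where a: "x = (\<Sum>i<n. a i)" "\<forall>i<n. a i \<in> A i"
        using x(1) unfolding M_def by blast
      have "(a(n := - x)) n = 0"
        by (rule indep) (use a x A[of n] in \<open>auto simp: less_Suc_eq intro: subspace_neg\<close>)
      then show ?thesis by simp
    qed
    moreover have "0 \<in> M" "0 \<in> A n"
      using subM A[of n] subspace_0 by auto
    ultimately show "M \<inter> A n = {0}" by auto
  qed
  then show ?thesis using that subM dirM by blast
qed

section \<open>Hermitian forms and orthonormal bases\<close>

text \<open>
  Inner products without positivity. Besides inner products, this covers their limits, rank-one
  forms and the quadratic forms of selfadjoint operators.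
\<close>

definition hermitian_form :: "'v set \<Rightarrow> ('v \<Rightarrow> 'v \<Rightarrow> complex) \<Rightarrow> bool" where
  "hermitian_form W g \<longleftrightarrow>
     (\<forall>x\<in>W. \<forall>y\<in>W. \<forall>z\<in>W. g (x + y) z = g x z + g y z) \<and>
     (\<forall>c. \<forall>x\<in>W. \<forall>y\<in>W. g (c *s x) y = c * g x y) \<and>
     (\<forall>x\<in>W. \<forall>y\<in>W. g y x = cnj (g x y))"

lemma inner_product_iff:
  "hermitian_inner_product W h \<longleftrightarrow>
     hermitian_form W h \<and> (\<forall>x\<in>W. x \<noteq> 0 \<longrightarrow> 0 < Re (h x x))"
  unfolding hermitian_inner_product_def hermitian_form_def by (simp only: conj_assoc)

lemma hermitian_form_subset: "hermitian_form W g \<Longrightarrow> U \<subseteq> W \<Longrightarrow> hermitian_form U g"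
  unfolding hermitian_form_def by (meson subsetD)

lemma inner_product_subset:
  "hermitian_inner_product W g \<Longrightarrow> U \<subseteq> W \<Longrightarrow> hermitian_inner_product U g"
  unfolding inner_product_iff by (meson hermitian_form_subset subsetD)

lemma inner_product_form: "hermitian_inner_product W g \<Longrightarrow> hermitian_form W g"
  by (simp add: inner_product_iff)

lemma hermitian_add_left:
  "hermitian_form W g \<Longrightarrow> x \<in> W \<Longrightarrow> y \<in> W \<Longrightarrow> z \<in> W \<Longrightarrow> g (x + y) z = g x z + g y z"
  and hermitian_scale_left:
  "hermitian_form W g \<Longrightarrow> x \<in> W \<Longrightarrow> z \<in> W \<Longrightarrow> g (c *s x) z = c * g x z"
  and hermitian_sym:
  "hermitian_form W g \<Longrightarrow> x \<in> W \<Longrightarrow> y \<in> W \<Longrightarrow> g y x = cnj (g x y)"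
  unfolding hermitian_form_def by meson+

lemma hermitian_self_real:
  assumes "hermitian_form W g" "x \<in> W"
  shows "g x x = of_real (Re (g x x))"
proof -
  have "g x x = cnj (g x x)" using hermitian_sym[OF assms assms(2)] .
  then show ?thesis by (auto simp: complex_eq_iff)
qed

lemma hermitian_form_add_scaled:
  assumes g: "hermitian_form W g" and h: "hermitian_form W h"
  shows "hermitian_form W (\<lambda>x y. g x y + of_real t * h x y)"
  unfolding hermitian_form_def
proof (intro conjI ballI allI)
  fix x y assume xy: "x \<in> W" "y \<in> W"
  show "g y x + of_real t * h y x = cnj (g x y + of_real t * h x y)"
    unfolding hermitian_sym[OF g xy] hermitian_sym[OF h xy] by simp
qed (simp_all add: hermitian_add_left[OF g] hermitian_add_left[OF h]
    hermitian_scale_left[OF g] hermitian_scale_left[OF h] algebra_simps)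

lemma hermitian_form_sum:
  assumes g: "\<And>i. i \<in> I \<Longrightarrow> hermitian_form W (g i)"
  shows "hermitian_form W (\<lambda>x y. \<Sum>i\<in>I. of_real (c i) * g i x y)"
  unfolding hermitian_form_def
proof (intro conjI ballI allI)
  fix x y assume xy: "x \<in> W" "y \<in> W"
  show "(\<Sum>i\<in>I. of_real (c i) * g i y x) = cnj (\<Sum>i\<in>I. of_real (c i) * g i x y)"
    using hermitian_sym[OF g xy] by simp
qed (simp_all add: hermitian_add_left[OF g] hermitian_scale_left[OF g] sum.distrib[symmetric]
    sum_distrib_left algebra_simps)

lemma hermitian_form_rank_one:
  assumes h: "hermitian_form W h" and u: "u \<in> W"
  shows "hermitian_form W (\<lambda>x y. h x u * h u y)"
  unfolding hermitian_form_def
proof (intro conjI ballI allI)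
  fix x y assume xy: "x \<in> W" "y \<in> W"
  show "h y u * h u x = cnj (h x u * h u y)"
    unfolding hermitian_sym[OF h xy(1) u] hermitian_sym[OF h u xy(2)] by simp
qed (simp_all add: u hermitian_add_left[OF h] hermitian_scale_left[OF h] algebra_simps)

context
  fixes W g
  assumes W: "subspace W" and g: "hermitian_form W g"
begin

lemma hermitian_add_right:
  "x \<in> W \<Longrightarrow> y \<in> W \<Longrightarrow> z \<in> W \<Longrightarrow> g x (y + z) = g x y + g x z"
  using hermitian_sym[OF g] hermitian_add_left[OF g, of y z x] W subspace_add[of W y z]
  by (metis complex_cnj_add)

lemma hermitian_scale_right:
  "x \<in> W \<Longrightarrow> y \<in> W \<Longrightarrow> g x (c *s y) = cnj c * g x y"
  using hermitian_sym[OF g] hermitian_scale_left[OF g, of y x c] W subspace_scale[of W y c]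
  by (metis complex_cnj_mult)

lemma hermitian_zero_left: "x \<in> W \<Longrightarrow> g 0 x = 0"
  using hermitian_scale_left[OF g, of x x 0] by simp

lemma hermitian_diff_left:
  "x \<in> W \<Longrightarrow> y \<in> W \<Longrightarrow> z \<in> W \<Longrightarrow> g (x - y) z = g x z - g y z"
  using hermitian_add_left[OF g, of "x - y" y z] W by (simp add: subspace_diff)

lemma hermitian_diff_right:
  "x \<in> W \<Longrightarrow> y \<in> W \<Longrightarrow> z \<in> W \<Longrightarrow> g x (y - z) = g x y - g x z"
  using hermitian_add_right[of x "y - z" z] W by (simp add: subspace_diff)

lemma hermitian_sum_left:
  assumes "finite I" "\<And>i. i \<in> I \<Longrightarrow> f i \<in> W" "y \<in> W"
  shows "g (\<Sum>i\<in>I. c i *s f i) y = (\<Sum>i\<in>I. c i * g (f i) y)"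
  using assms
proof (induction I rule: finite_induct)
  case empty
  then show ?case by (simp add: hermitian_zero_left)
next
  case (insert j I)
  have "c j *s f j \<in> W" "(\<Sum>i\<in>I. c i *s f i) \<in> W"
    using insert.prems W by (auto intro!: subspace_sum subspace_scale)
  then show ?case
    using insert by (simp add: hermitian_add_left[OF g] hermitian_scale_left[OF g])
qed

lemma hermitian_sum_right:
  assumes "finite I" "\<And>i. i \<in> I \<Longrightarrow> f i \<in> W" "x \<in> W"
  shows "g x (\<Sum>i\<in>I. c i *s f i) = (\<Sum>i\<in>I. cnj (c i) * g x (f i))"
proof -
  have "(\<Sum>i\<in>I. c i *s f i) \<in> W"
    using assms W by (auto intro!: subspace_sum subspace_scale)
  then have "g x (\<Sum>i\<in>I. c i *s f i) = cnj (g (\<Sum>i\<in>I. c i *s f i) x)"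
    using hermitian_sym[OF g] assms by blast
  also have "\<dots> = (\<Sum>i\<in>I. cnj (c i) * cnj (g (f i) x))"
    using assms by (simp add: hermitian_sum_left)
  also have "\<dots> = (\<Sum>i\<in>I. cnj (c i) * g x (f i))"
    using assms hermitian_sym[OF g] by (intro sum.cong refl) (metis complex_cnj_cnj)
  finally show ?thesis .
qed

end

text \<open>
  An orthonormal basis as a numbered family. Spanning is stated as the Fourier expansion, which makes
  all coordinates inner products.
\<close>

definition onb :: "('v \<Rightarrow> 'v \<Rightarrow> complex) \<Rightarrow> 'v set \<Rightarrow> nat \<Rightarrow> (nat \<Rightarrow> 'v) \<Rightarrow> bool" where
  "onb h W d e \<longleftrightarrow> (\<forall>i<d. e i \<in> W) \<and> (\<forall>i<d. \<forall>j<d. h (e i) (e j) = of_bool (i = j)) \<and>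
     (\<forall>x\<in>W. x = (\<Sum>i<d. h x (e i) *s e i))"

lemma onb_in: "onb h W d e \<Longrightarrow> i < d \<Longrightarrow> e i \<in> W"
  and onb_orth: "onb h W d e \<Longrightarrow> i < d \<Longrightarrow> j < d \<Longrightarrow> h (e i) (e j) = of_bool (i = j)"
  and onb_expand: "onb h W d e \<Longrightarrow> x \<in> W \<Longrightarrow> x = (\<Sum>i<d. h x (e i) *s e i)"
  unfolding onb_def by meson+

lemma onb_dim:
  assumes "onb h W d e" "subspace W" "hermitian_form W h"
  shows "dim W = d"
proof -
  have inj: "inj_on e {..<d}"
  proof (rule inj_onI)
    fix i j assume "i \<in> {..<d}" "j \<in> {..<d}" "e i = e j"
    then show "i = j"
      using onb_orth[OF assms(1), of i j] onb_orth[OF assms(1), of j j] by (cases "i = j") auto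
  qed
  have "independent (e ` {..<d})"
  proof (rule independent_if_scalars_zero)
    fix f x assume *: "(\<Sum>v\<in>e ` {..<d}. f v *s v) = 0" "x \<in> e ` {..<d}"
    then obtain j where j: "j < d" "x = e j" by auto
    have "(\<Sum>i<d. f (e i) *s e i) = 0"
      using * by (simp add: sum.reindex[OF inj])
    then have "0 = h (\<Sum>i<d. f (e i) *s e i) (e j)"
      using hermitian_zero_left[OF assms(2,3)] onb_in[OF assms(1)] j by simp
    also have "\<dots> = (\<Sum>i<d. f (e i) * h (e i) (e j))"
      using onb_in[OF assms(1)] j by (intro hermitian_sum_left[OF assms(2,3)]) auto
    also have "\<dots> = (\<Sum>i<d. if i = j then f (e j) else 0)"
      using onb_orth[OF assms(1)] j by (intro sum.cong) auto
    finally show "f x = 0" using j by simp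
  qed simp
  moreover have "W \<subseteq> span (e ` {..<d})"
  proof
    fix x assume "x \<in> W"
    have "(\<Sum>i<d. h x (e i) *s e i) \<in> span (e ` {..<d})"
      by (intro span_sum span_scale span_base) auto
    then show "x \<in> span (e ` {..<d})" using onb_expand[OF assms(1) \<open>x \<in> W\<close>] by simp
  qed
  ultimately have "card (e ` {..<d}) = dim W"
    using onb_in[OF assms(1)] by (intro basis_card_eq_dim) auto
  then show ?thesis using card_image[OF inj] by simp
qed

lemma inner_nonneg:
  assumes "hermitian_inner_product W h" "subspace W" "x \<in> W"
  shows "0 \<le> Re (h x x)"
  using assms hermitian_zero_left[OF assms(2) inner_product_form[OF assms(1)]]
  unfolding inner_product_iff by (cases "x = 0") force+

lemma inner_eq_0_imp:
  assumes "hermitian_inner_product W h" "x \<in> W" "h x x = 0"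
  shows "x = 0"
  using assms unfolding inner_product_iff by fastforce

lemma unit_vector_scaling:
  assumes "hermitian_inner_product W h" "subspace W" "x \<in> W" "x \<noteq> 0"
  obtains c where "0 < c" "h (complex_of_real c *s x) (complex_of_real c *s x) = 1"
proof
  note h = inner_product_form[OF assms(1)]
  have pos: "0 < Re (h x x)" using assms by (auto simp: inner_product_iff)
  define c where "c = 1 / sqrt (Re (h x x))"
  show "0 < c" using pos by (simp add: c_def)
  have "of_real c *s x \<in> W" using assms by (auto intro: subspace_scale)
  then have "h (of_real c *s x) (of_real c *s x) = of_real (c * c) * h x x"
    using assms by (simp add: hermitian_scale_left[OF h] hermitian_scale_right[OF assms(2) h])
  also have "\<dots> = of_real (c * c * Re (h x x))"
    using hermitian_self_real[OF h assms(3)] by (metis of_real_mult)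
  also have "c * c * Re (h x x) = 1"
    using pos by (simp add: c_def)
  finally show "h (of_real c *s x) (of_real c *s x) = 1" by simp
qed

text \<open>
  The Gram-Schmidt step.
\<close>

lemma span_insert_perp:
  assumes B: "onb h (span B) d e" and h: "hermitian_form (span (insert b B)) h"
    and bB: "b' = b - (\<Sum>i<d. h b (e i) *s e i)"
  shows "span (insert b' B) = span (insert b B)" "\<And>x. x \<in> span B \<Longrightarrow> h x b' = 0"
proof -
  have s: "(\<Sum>i<d. h b (e i) *s e i) \<in> span B"
    using onb_in[OF B] by (intro span_sum span_scale) auto
  have sub: "span B \<subseteq> span (insert b B)" by (intro span_mono) auto
  have b: "b \<in> span (insert b B)" by (rule span_base) simp
  have "b' \<in> span (insert b B)" 
    unfolding bB using s sub b by (intro span_diff) auto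
  moreover have "b \<in> span (insert b' B)"
  proof -
    have "span B \<subseteq> span (insert b' B)" by (intro span_mono) auto
    then have "b' + (\<Sum>i<d. h b (e i) *s e i) \<in> span (insert b' B)"
      using s by (intro span_add span_base[of b']) auto
    then show ?thesis by (simp add: bB)
  qed
  ultimately show "span (insert b' B) = span (insert b B)"
    unfolding span_eq using span_base by (metis insert_subset span_superset subset_insertI subset_trans)
  fix x assume x: "x \<in> span B"
  note e = onb_in[OF B]
  have "h (e j) b' = 0" if j: "j < d" for j
  proof -
    have "h (e j) b' = h (e j) b - h (e j) (\<Sum>i<d. h b (e i) *s e i)"
      unfolding bB using s sub b e[OF j] by (intro hermitian_diff_right[OF _ h]) auto
    also have "h (e j) (\<Sum>i<d. h b (e i) *s e i) = (\<Sum>i<d. cnj (h b (e i)) * h (e j) (e i))"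
      using e j sub by (intro hermitian_sum_right[OF _ h]) auto
    also have "\<dots> = (\<Sum>i<d. if i = j then cnj (h b (e j)) else 0)"
      using onb_orth[OF B] j by (intro sum.cong) auto
    also have "\<dots> = h (e j) b"
      using j hermitian_sym[OF h b, of "e j"] e[OF j] sub by auto
    finally show ?thesis by simp
  qed
  moreover have "h x b' = (\<Sum>i<d. h x (e i) * h (e i) b')"
    using hermitian_sum_left[OF _ h, of "{..<d}" e b' "\<lambda>i. h x (e i)"] onb_expand[OF B x]
      e sub \<open>b' \<in> span (insert b B)\<close> by auto
  ultimately show "h x b' = 0" by simp
qed

lemma onb_span_exists:
  assumes "finite B" "hermitian_inner_product (span B) h"
  shows "\<exists>d e. onb h (span B) d e"
  using assms
proof (induction B rule: finite_induct)
  case empty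
  have "onb h (span {}) 0 e" for e :: "nat \<Rightarrow> 'v"
    by (simp add: onb_def)
  then show ?case by blast
next
  case (insert b B)
  note h = inner_product_form[OF insert.prems]
  have sub: "span B \<subseteq> span (insert b B)" by (intro span_mono) auto
  then obtain d e where B: "onb h (span B) d e"
    using insert inner_product_subset by blast
  define b' where "b' = b - (\<Sum>i<d. h b (e i) *s e i)"
  note b' = span_insert_perp[OF B h b'_def]
  show ?case
  proof (cases "b' = 0")
    case True
    then have "span (insert b B) = span B" using b'(1) by (simp add: span_insert_0)
    then show ?thesis using B by auto
  next
    case False
    have b'in: "b' \<in> span (insert b B)"
      using b'(1) span_base[of b' "insert b' B"] by auto
    obtain c where c: "0 < c" "h (complex_of_real c *s b') (complex_of_real c *s b') = 1"
      using unit_vector_scaling[OF insert.prems _ b'in False] by auto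
    define u where "u = complex_of_real c *s b'"
    have u: "u \<in> span (insert b B)" "h u u = 1"
      using b'in c by (auto simp: u_def intro: span_scale)
    have perp: "h x u = 0" if "x \<in> span B" for x
      using b'(2)[OF that] sub that b'in hermitian_scale_right[OF _ h, of x b'] by (auto simp: u_def)
    have perp': "h u x = 0" if "x \<in> span B" for x
      using perp[OF that] hermitian_sym[OF h, of x u] that sub u by auto
    define e' where "e' = e(d := u)"
    have "onb h (span (insert b B)) (Suc d) e'"
      unfolding onb_def
    proof (intro conjI allI impI ballI)
      fix i assume "i < Suc d"
      then show "e' i \<in> span (insert b B)"
        using u sub onb_in[OF B] by (auto simp: e'_def less_Suc_eq)
      fix j assume "j < Suc d"
      then show "h (e' i) (e' j) = of_bool (i = j)"
        using \<open>i < Suc d\<close> u perp perp' onb_in[OF B] onb_orth[OF B]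
        by (auto simp: e'_def less_Suc_eq)
    next
      fix x assume "x \<in> span (insert b B)"
      then have "x \<in> span (insert b' B)" using b'(1) by simp
      then obtain k where k: "x - k *s b' \<in> span B"
        by (auto simp: span_breakdown_eq)
      define z where "z = x - k *s b'"
      define a where "a = k / complex_of_real c"
      have x: "x = z + a *s u" using c(1) by (simp add: z_def a_def u_def)
      have z: "z \<in> span B" using k by (simp add: z_def)
      have au: "a *s u \<in> span (insert b B)" "z \<in> span (insert b B)"
        using u z sub by (auto intro: span_scale)
      have "h x u = a"
        using u perp[OF z] au by (simp add: x hermitian_add_left[OF h] hermitian_scale_left[OF h])
      moreover have "h x (e i) = h z (e i)" if "i < d" for i
        using perp'[OF onb_in[OF B that]] u au onb_in[OF B that] sub
        by (auto simp: x hermitian_add_left[OF h] hermitian_scale_left[OF h])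
      ultimately have "(\<Sum>i<Suc d. h x (e' i) *s e' i) = (\<Sum>i<d. h z (e i) *s e i) + a *s u"
        by (simp add: e'_def)
      then show "x = (\<Sum>i<Suc d. h x (e' i) *s e' i)"
        using onb_expand[OF B z] x by simp
    qed
    then show ?thesis by blast
  qed
qed

lemma onb_exists:
  assumes "fin_subspace W" "hermitian_inner_product W h"
  obtains e where "onb h W (dim W) e"
proof -
  obtain B where "finite B" "W = span B" using assms(1) by (auto simp: fin_subspace_def)
  then obtain d e where "onb h W d e" using onb_span_exists[of B h] assms by auto
  then show ?thesis
    using that onb_dim fin_subspaceD[OF assms(1)] inner_product_form[OF assms(2)] by metis
qed

lemma parseval:
  assumes "onb h W d e" "subspace W" "hermitian_form W h" "x \<in> W" "y \<in> W"
  shows "h x y = (\<Sum>i<d. h x (e i) * h (e i) y)"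
  using hermitian_sum_left[OF assms(2,3), of "{..<d}" e y "\<lambda>i. h x (e i)"]
    onb_expand[OF assms(1,4)] onb_in[OF assms(1)] assms(5) by auto

lemma parseval_norm:
  assumes "onb h W d e" "subspace W" "hermitian_form W h" "x \<in> W"
  shows "Re (h x x) = (\<Sum>i<d. (cmod (h x (e i)))\<^sup>2)"
proof -
  have "h x (e i) * h (e i) x = of_real ((cmod (h x (e i)))\<^sup>2)" if "i < d" for i
  proof -
    have "h (e i) x = cnj (h x (e i))"
      using hermitian_sym[OF assms(3,4)] onb_in[OF assms(1) that] by blast
    then show ?thesis by (simp only: complex_norm_square)
  qed
  then have "h x x = (\<Sum>i<d. of_real ((cmod (h x (e i)))\<^sup>2))"
    using parseval[OF assms assms(4)] by simp
  then have "h x x = of_real (\<Sum>i<d. (cmod (h x (e i)))\<^sup>2)" by (simp only: of_real_sum)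
  then show ?thesis by simp
qed

lemma fourier_coefficient_le_1:
  assumes "onb h W d e" "subspace W" "hermitian_form W h" "x \<in> W" "h x x = 1" "i < d"
  shows "cmod (h x (e i)) \<le> 1"
proof -
  have "(cmod (h x (e i)))\<^sup>2 \<le> (\<Sum>i<d. (cmod (h x (e i)))\<^sup>2)"
    using assms(6) by (intro member_le_sum) auto
  also have "\<dots> = 1" using parseval_norm[OF assms(1-4)] assms(5) by simp
  finally show ?thesis using power2_le_imp_le[of "cmod (h x (e i))" 1] by simp
qed

section \<open>Orthogonal projections\<close>

abbreviation "proj \<equiv> orthogonal_projection"

text \<open>
  Uniqueness of the projection; it makes the definite description in the definition computable.
\<close>

lemma orthogonal_projection_eq:
  assumes h: "hermitian_inner_product W h" and W: "subspace W" and M: "subspace M" "M \<subseteq> W"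
    and x: "x \<in> W" and y: "y \<in> M" "\<And>m. m \<in> M \<Longrightarrow> h (x - y) m = 0"
  shows "proj h M x = y"
  unfolding orthogonal_projection_def
proof (rule the_equality)
  show "y \<in> M \<and> (\<forall>m\<in>M. h (x - y) m = 0)" using y by blast
  fix z assume z: "z \<in> M \<and> (\<forall>m\<in>M. h (x - z) m = 0)"
  note hf = inner_product_form[OF h]
  have d: "z - y \<in> M" using z y M by (auto intro: subspace_diff)
  have "h (z - y) (z - y) = h ((x - y) - (x - z)) (z - y)" by simp
  also have "\<dots> = h (x - y) (z - y) - h (x - z) (z - y)"
    using x y z d M W by (intro hermitian_diff_left[OF W hf]) (auto intro: subspace_diff)
  also have "\<dots> = 0" using y z d by simp
  finally have "z - y = 0" using inner_eq_0_imp[OF h] d M by blast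
  then show "z = y" by simp
qed

lemma fourier_sum_perp:
  assumes "subspace W" "hermitian_form W h" "subspace M" "M \<subseteq> W" "onb h M d e"
    and "x \<in> W" "m \<in> M"
  shows "h (x - (\<Sum>i<d. h x (e i) *s e i)) m = 0"
proof -
  note e = onb_in[OF assms(5)]
  have s: "(\<Sum>i<d. h x (e i) *s e i) \<in> M"
    using e assms(3) by (intro subspace_sum subspace_scale) auto
  have m: "m = (\<Sum>j<d. h m (e j) *s e j)" using onb_expand[OF assms(5,7)] .
  have "h (x - (\<Sum>i<d. h x (e i) *s e i)) (e j) = 0" if j: "j < d" for j
  proof -
    have "h (\<Sum>i<d. h x (e i) *s e i) (e j) = (\<Sum>i<d. h x (e i) * h (e i) (e j))"
      using e j assms(4) by (intro hermitian_sum_left[OF assms(1,2)]) auto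
    also have "\<dots> = (\<Sum>i<d. if i = j then h x (e j) else 0)"
      using onb_orth[OF assms(5)] j by (intro sum.cong) auto
    finally have "h (\<Sum>i<d. h x (e i) *s e i) (e j) = h x (e j)" using j by simp
    then show ?thesis
      using hermitian_diff_left[OF assms(1,2,6), of "\<Sum>i<d. h x (e i) *s e i" "e j"] s assms(4) e[OF j]
      by auto
  qed
  moreover have "h (x - (\<Sum>i<d. h x (e i) *s e i)) (\<Sum>j<d. h m (e j) *s e j)
      = (\<Sum>j<d. cnj (h m (e j)) * h (x - (\<Sum>i<d. h x (e i) *s e i)) (e j))"
    using e assms s by (intro hermitian_sum_right[OF assms(1,2)]) (auto intro: subspace_diff)
  ultimately show ?thesis using m by simp
qed

context
  fixes W h M
  assumes W: "fin_subspace W" and h: "hermitian_inner_product W h"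
    and M: "subspace M" "M \<subseteq> W"
begin

text \<open>
  This also shows that projections onto finite dimensional subspaces exist.
\<close>

lemma projection_fourier:
  assumes "onb h M d e" "x \<in> W"
  shows "proj h M x = (\<Sum>i<d. h x (e i) *s e i)"
proof (rule orthogonal_projection_eq[OF h fin_subspaceD[OF W] M assms(2)])
  show "(\<Sum>i<d. h x (e i) *s e i) \<in> M"
    using onb_in[OF assms(1)] M by (intro subspace_sum subspace_scale) auto
  show "h (x - (\<Sum>i<d. h x (e i) *s e i)) m = 0" if "m \<in> M" for m
    using fourier_sum_perp[OF fin_subspaceD[OF W] inner_product_form[OF h] M assms that] .
qed

lemma subspace_onb_exists: obtains e where "onb h M (dim M) e"
  using onb_exists[OF fin_subspace_subset[OF W M] inner_product_subset[OF h M(2)]] .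

lemma projection_in: "x \<in> W \<Longrightarrow> proj h M x \<in> M"
  and projection_perp: "x \<in> W \<Longrightarrow> m \<in> M \<Longrightarrow> h (x - proj h M x) m = 0"
proof -
  obtain e where e: "onb h M (dim M) e" by (rule subspace_onb_exists)
  show "x \<in> W \<Longrightarrow> proj h M x \<in> M"
    unfolding projection_fourier[OF e]
    using onb_in[OF e] M by (intro subspace_sum subspace_scale) auto
  show "x \<in> W \<Longrightarrow> m \<in> M \<Longrightarrow> h (x - proj h M x) m = 0"
    unfolding projection_fourier[OF e]
    using fourier_sum_perp[OF fin_subspaceD[OF W] inner_product_form[OF h] M e] .
qed

lemma projection_inner:
  assumes "x \<in> W" "m \<in> M"
  shows "h (proj h M x) m = h x m" "h m (proj h M x) = h m x"
proof -
  note hf = inner_product_form[OF h]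
  have p: "proj h M x \<in> W" "m \<in> W" using projection_in assms M by auto
  show *: "h (proj h M x) m = h x m"
    using projection_perp[OF assms] hermitian_diff_left[OF fin_subspaceD[OF W] hf assms(1) p] by simp
  show "h m (proj h M x) = h m x"
    using * hermitian_sym[OF hf p] hermitian_sym[OF hf assms(1) p(2)] by simp
qed

lemma projection_add:
  assumes "x \<in> W" "y \<in> W"
  shows "proj h M (x + y) = proj h M x + proj h M y"
proof -
  obtain e where e: "onb h M (dim M) e" by (rule subspace_onb_exists)
  have "x + y \<in> W" using assms fin_subspaceD[OF W] by (auto intro: subspace_add)
  moreover have "e i \<in> W" if "i < dim M" for i using onb_in[OF e that] M by blast
  ultimately show ?thesis
    using assms hermitian_add_left[OF inner_product_form[OF h] assms]
    by (auto simp: projection_fourier[OF e] scale_left_distrib sum.distrib[symmetric] intro!: sum.cong)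
qed

lemma projection_scale:
  assumes "x \<in> W"
  shows "proj h M (c *s x) = c *s proj h M x"
proof -
  obtain e where e: "onb h M (dim M) e" by (rule subspace_onb_exists)
  have "c *s x \<in> W" using assms fin_subspaceD[OF W] by (auto intro: subspace_scale)
  moreover have "e i \<in> W" if "i < dim M" for i using onb_in[OF e that] M by blast
  ultimately show ?thesis
    using assms hermitian_scale_left[OF inner_product_form[OF h] assms]
    by (auto simp: projection_fourier[OF e] scale_sum_right intro!: sum.cong)
qed

lemma hermitian_form_projection: "hermitian_form W (\<lambda>x y. h (proj h M x) y)"
  unfolding hermitian_form_def
proof (intro conjI ballI allI)
  note hf = inner_product_form[OF h]
  have PW: "proj h M x \<in> W" if "x \<in> W" for x
    using projection_in[OF that] M by blast
  fix x y z assume "x \<in> W" "y \<in> W" "z \<in> W"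
  then show "h (proj h M (x + y)) z
      = h (proj h M x) z + h (proj h M y) z"
    using PW by (simp add: projection_add hermitian_add_left[OF hf])
next
  note hf = inner_product_form[OF h]
  fix c x y assume x: "x \<in> W" and y: "y \<in> W"
  have "proj h M x \<in> W" using projection_in[OF x] M by blast
  then show "h (proj h M (c *s x)) y = c * h (proj h M x) y"
    using x y by (simp add: projection_scale hermitian_scale_left[OF hf])
next
  note hf = inner_product_form[OF h]
  fix x y assume x: "x \<in> W" and y: "y \<in> W"
  have PW: "proj h M x \<in> W" using projection_in[OF x] M by blast
  have "h (proj h M y) x = h y (proj h M x)"
    using projection_inner(2)[OF x projection_in[OF y]] projection_inner(1)[OF y projection_in[OF x]]
    by simp
  then show "h (proj h M y) x = cnj (h (proj h M x) y)"
    using hermitian_sym[OF hf PW y] by simp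
qed

lemma projection_norm:
  assumes "onb h M d e" "x \<in> W"
  shows "Re (h (proj h M x) x) = (\<Sum>i<d. (cmod (h x (e i)))\<^sup>2)"
    "h (proj h M x) x
       = h (proj h M x) (proj h M x)"
proof -
  note hf = inner_product_form[OF h]
  have p: "proj h M x \<in> M" using projection_in assms by auto
  show 2: "h (proj h M x) x
       = h (proj h M x) (proj h M x)"
    using projection_inner(2)[OF assms(2) p] by simp
  have "Re (h (proj h M x) (proj h M x))
      = (\<Sum>i<d. (cmod (h (proj h M x) (e i)))\<^sup>2)"
    using parseval_norm[OF assms(1) M(1) hermitian_form_subset[OF hf M(2)] p] .
  also have "\<dots> = (\<Sum>i<d. (cmod (h x (e i)))\<^sup>2)"
    using projection_inner(1)[OF assms(2)] onb_in[OF assms(1)] by (intro sum.cong) auto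
  finally show "Re (h (proj h M x) x) = (\<Sum>i<d. (cmod (h x (e i)))\<^sup>2)"
    using 2 by simp
qed

end

section \<open>Simultaneous diagonalization\<close>

text \<open>
  Otherwise moving from \<open>y\<close> a short way against \<open>z\<close> would make the form negative. The step length
  \<open>\<epsilon>\<close> is chosen so that the quadratic term cannot outweigh the linear one.
\<close>

lemma psd_null_vector:
  assumes W: "subspace W" and q: "hermitian_form W q"
    and psd: "\<And>x. x \<in> W \<Longrightarrow> 0 \<le> Re (q x x)"
    and y: "y \<in> W" "q y y = 0" and z: "z \<in> W"
  shows "q z y = 0"
proof (rule ccontr)
  assume nz: "q z y \<noteq> 0"
  define a where "a = q z y"
  define b where "b = Re (q z z)"
  define \<epsilon> where "\<epsilon> = 1 / (1 + b)"
  have b: "0 \<le> b" using psd[OF z] by (simp add: b_def)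
  have eps: "0 < \<epsilon>" "\<epsilon> * b < 1" using b by (auto simp: \<epsilon>_def field_simps)
  define c where "c = - of_real \<epsilon> * cnj a"
  have cz: "c *s z \<in> W" "y + c *s z \<in> W" using y z W by (auto intro: subspace_add subspace_scale)
  have qyz: "q y z = cnj a" using hermitian_sym[OF q z y(1)] by (simp add: a_def)
  have qzz: "q z z = of_real b" using hermitian_self_real[OF q z] by (simp add: b_def)
  have "q (y + c *s z) (y + c *s z) = cnj c * q y z + c * q z y + c * cnj c * q z z"
    using cz y z by (simp add: hermitian_add_left[OF q] hermitian_add_right[OF W q]
        hermitian_scale_left[OF q] hermitian_scale_right[OF W q] algebra_simps)
  also have "\<dots> = of_real ((\<epsilon> * \<epsilon> * b - 2 * \<epsilon>) * (cmod a)\<^sup>2)"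
    unfolding qyz qzz a_def[symmetric] c_def of_real_mult complex_norm_square
    by (simp add: algebra_simps)
  finally have "0 \<le> (\<epsilon> * \<epsilon> * b - 2 * \<epsilon>) * (cmod a)\<^sup>2"
    using psd[OF cz(2)] by simp
  moreover have "0 < (cmod a)\<^sup>2" using nz by (simp add: a_def)
  moreover have "\<epsilon> * \<epsilon> * b - 2 * \<epsilon> < 0"
  proof -
    have "\<epsilon> * (\<epsilon> * b - 2) < 0" using eps by (intro mult_pos_neg) auto
    then show ?thesis by (simp add: algebra_simps)
  qed
  ultimately show False by (meson mult_neg_pos not_le)
qed

lemma hermitian_expand:
  fixes d :: nat
  assumes W: "subspace W" and g: "hermitian_form W g" and e: "\<And>i. i < d \<Longrightarrow> e i \<in> W"
  shows "g (\<Sum>i<d. a i *s e i) (\<Sum>j<d. b j *s e j)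
    = (\<Sum>i<d. \<Sum>j<d. a i * cnj (b j) * g (e i) (e j))"
proof -
  have s: "(\<Sum>j<d. b j *s e j) \<in> W"
    using e W by (intro subspace_sum subspace_scale) auto
  have "g (\<Sum>i<d. a i *s e i) (\<Sum>j<d. b j *s e j) = (\<Sum>i<d. a i * g (e i) (\<Sum>j<d. b j *s e j))"
    using e s by (intro hermitian_sum_left[OF W g]) auto
  also have "\<dots> = (\<Sum>i<d. a i * (\<Sum>j<d. cnj (b j) * g (e i) (e j)))"
    using e by (intro sum.cong refl arg_cong2[where f = "(*)"] hermitian_sum_right[OF W g]) auto
  finally show ?thesis by (simp add: sum_distrib_left mult.assoc)
qed

text \<open>
  The unit sphere is compact: the Fourier coefficients of unit vectors are bounded by \<open>1\<close>.
\<close>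

lemma unit_sphere_minimum:
  assumes W: "fin_subspace W" and h: "hermitian_inner_product W h" and g: "hermitian_form W g"
    and nz: "W \<noteq> {0}"
  obtains y where "y \<in> W" "h y y = 1" "\<And>x. x \<in> W \<Longrightarrow> h x x = 1 \<Longrightarrow> Re (g y y) \<le> Re (g x x)"
proof -
  note W' = fin_subspaceD[OF W] and hf = inner_product_form[OF h]
  obtain e where e: "onb h W (dim W) e" using onb_exists[OF W h] .
  let ?d = "dim W" and ?A = "{x \<in> W. h x x = 1}"
  have "\<exists>x\<in>W. x \<noteq> 0" using nz subspace_0[OF W'] by blast
  then have "?A \<noteq> {}"
    using unit_vector_scaling[OF h W'] subspace_scale[OF W'] by (metis (mono_tags, lifting) empty_iff mem_Collect_eq)
  then obtain x where x: "\<And>k. x k \<in> ?A"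
    and min: "\<And>a \<epsilon>. a \<in> ?A \<Longrightarrow> 0 < \<epsilon> \<Longrightarrow> \<forall>\<^sub>F k in sequentially. Re (g (x k) (x k)) < Re (g a a) + \<epsilon>"
    using minimizing_sequence[of ?A "\<lambda>x. Re (g x x)"] by blast
  have "bounded (range (\<lambda>k. h (x k) (e i)))" if "i < ?d" for i
    using fourier_coefficient_le_1[OF e W' hf] x that by (auto simp: bounded_iff)
  then obtain r l where r: "strict_mono r" "\<And>i. i < ?d \<Longrightarrow> (\<lambda>k. h (x (r k)) (e i)) \<longlonglongrightarrow> l i"
    using convergent_subsequence_finite_family[of "{..<?d}" "\<lambda>k i. h (x k) (e i)"] by auto
  define y where "y = (\<Sum>i<?d. l i *s e i)"
  have yW: "y \<in> W" using onb_in[OF e] W' unfolding y_def by (intro subspace_sum subspace_scale) auto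
  have lim: "(\<lambda>k. f (x (r k)) (x (r k))) \<longlonglongrightarrow> f y y" if f: "hermitian_form W f" for f
  proof -
    have eq: "f (x (r k)) (x (r k)) =
        (\<Sum>i<?d. \<Sum>j<?d. h (x (r k)) (e i) * cnj (h (x (r k)) (e j)) * f (e i) (e j))" for k
      using hermitian_expand[OF W' f, of ?d e "\<lambda>i. h (x (r k)) (e i)" "\<lambda>i. h (x (r k)) (e i)"]
        onb_in[OF e] onb_expand[OF e, of "x (r k)"] x by simp
    have "f y y = (\<Sum>i<?d. \<Sum>j<?d. l i * cnj (l j) * f (e i) (e j))"
      unfolding y_def by (rule hermitian_expand[OF W' f]) (rule onb_in[OF e])
    then show ?thesis
      unfolding eq using r(2) by (auto intro!: tendsto_intros)
  qed
  have unit: "h y y = 1"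
    using lim[OF hf] x LIMSEQ_unique[of "\<lambda>_. 1" "h y y" 1] by auto
  have "Re (g y y) \<le> Re (g a a)" if "a \<in> W" "h a a = 1" for a
  proof (rule field_le_epsilon)
    fix \<epsilon> :: real assume "0 < \<epsilon>"
    have "\<forall>\<^sub>F k in sequentially. Re (g (x (r k)) (x (r k))) < Re (g a a) + \<epsilon>"
      using min[of a \<epsilon>] that \<open>0 < \<epsilon>\<close> eventually_subseq[OF r(1)] by auto
    then have "\<forall>\<^sub>F k in sequentially. Re (g (x (r k)) (x (r k))) \<le> Re (g a a) + \<epsilon>"
      by (rule eventually_mono) simp
    then show "Re (g y y) \<le> Re (g a a) + \<epsilon>"
      using tendsto_upperbound[OF tendsto_Re[OF lim[OF g]]] by simp
  qed
  then show ?thesis by (rule that[OF yW unit])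
qed

text \<open>
  If \<open>m\<close> is the minimum of \<open>g\<close> on the unit sphere, then \<open>g - m h\<close> is positive semidefinite and \<open>y\<close>
  is a null vector of it.
\<close>

lemma unit_sphere_minimum_eigenvector:
  assumes W: "subspace W" and h: "hermitian_inner_product W h" and g: "hermitian_form W g"
    and y: "y \<in> W" "h y y = 1" and min: "\<And>x. x \<in> W \<Longrightarrow> h x x = 1 \<Longrightarrow> Re (g y y) \<le> Re (g x x)"
    and z: "z \<in> W" "h z y = 0"
  shows "g z y = 0"
proof -
  note hf = inner_product_form[OF h]
  define m where "m = Re (g y y)"
  define q where "q = (\<lambda>x y. g x y + of_real (- m) * h x y)"
  have q: "hermitian_form W q"
    unfolding q_def by (rule hermitian_form_add_scaled[OF g hf])
  have "0 \<le> Re (q x x)" if x: "x \<in> W" for x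
  proof (cases "x = 0")
    case True
    then show ?thesis using hermitian_zero_left[OF W q] x by simp
  next
    case False
    then obtain c where c: "0 < c" "h (complex_of_real c *s x) (complex_of_real c *s x) = 1"
      using unit_vector_scaling[OF h W x] by auto
    define u where "u = complex_of_real c *s x"
    have u: "u \<in> W" using x W by (auto simp: u_def intro: subspace_scale)
    have "Re (q u u) = c * c * Re (q x x)"
      using x u by (simp add: u_def hermitian_scale_left[OF q] hermitian_scale_right[OF W q] mult.assoc)
    moreover have "0 \<le> Re (q u u)"
      using min[OF u] c by (simp add: q_def m_def u_def)
    moreover have "0 < c * c" using c(1) by simp
    ultimately show ?thesis by (metis zero_le_mult_iff not_less)
  qed
  moreover have "q y y = 0"
    using hermitian_self_real[OF g y(1)] y(2) by (simp add: q_def m_def)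
  ultimately have "q z y = 0" using psd_null_vector[OF W q _ y(1) _ z(1)] by blast
  then show ?thesis using z by (simp add: q_def)
qed

text \<open>
  The spectral theorem. A minimum of \<open>g\<close> on the unit sphere is split off first, so the diagonal
  entries come out in increasing order.
\<close>

lemma simultaneous_diagonalization:
  assumes "fin_subspace W" "hermitian_inner_product W h" "hermitian_form W g"
  obtains e where "onb h W (dim W) e"
    "\<And>i j. i < dim W \<Longrightarrow> j < dim W \<Longrightarrow> i \<noteq> j \<Longrightarrow> g (e i) (e j) = 0"
    "\<And>i j. i \<le> j \<Longrightarrow> j < dim W \<Longrightarrow> Re (g (e i) (e i)) \<le> Re (g (e j) (e j))"
proof -
  have "\<exists>e. onb h W n e \<and> (\<forall>i<n. \<forall>j<n. i \<noteq> j \<longrightarrow> g (e i) (e j) = 0) \<and>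
      (\<forall>j<n. \<forall>i\<le>j. Re (g (e i) (e i)) \<le> Re (g (e j) (e j)))" if "n = dim W" for n
    using that assms
  proof (induction n arbitrary: W)
    case 0
    then have "W = {0}" using dim_eq_0_imp by simp
    then show ?case by (simp add: onb_def)
  next
    case (Suc n)
    note W = fin_subspaceD[OF Suc.prems(2)] and hf = inner_product_form[OF Suc.prems(3)]
    note g = Suc.prems(4)
    have "W \<noteq> {0}" using Suc.prems(1) by auto
    then obtain y where y: "y \<in> W" "h y y = 1"
      and min: "\<And>x. x \<in> W \<Longrightarrow> h x x = 1 \<Longrightarrow> Re (g y y) \<le> Re (g x x)"
      using unit_sphere_minimum[OF Suc.prems(2-4)] by metis
    define U where "U = {x \<in> W. h x y = 0}"
    have U: "subspace U" "U \<subseteq> W"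
      using W y hermitian_zero_left[OF W hf y(1)] hermitian_add_left[OF hf] hermitian_scale_left[OF hf]
      by (auto simp: U_def intro!: subspaceI intro: subspace_0 subspace_add subspace_scale)
    have "dim W = Suc (dim U)"
      unfolding U_def using y hermitian_add_left[OF hf] hermitian_scale_left[OF hf]
      by (intro dim_kernel[OF Suc.prems(2), of "\<lambda>x. h x y" y]) auto
    then obtain e where e: "onb h U n e" and diag: "\<And>i j. i < n \<Longrightarrow> j < n \<Longrightarrow> i \<noteq> j \<Longrightarrow> g (e i) (e j) = 0"
      and sorted: "\<And>i j. j < n \<Longrightarrow> i \<le> j \<Longrightarrow> Re (g (e i) (e i)) \<le> Re (g (e j) (e j))"
      using Suc.IH[of U] Suc.prems fin_subspace_subset[OF Suc.prems(2) U]
        inner_product_subset[OF Suc.prems(3) U(2)] hermitian_form_subset[OF g U(2)] by auto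
    have eU: "e i \<in> W" "h (e i) y = 0" "h y (e i) = 0" "g (e i) y = 0" "g y (e i) = 0" if "i < n" for i
    proof -
      show 1: "e i \<in> W" "h (e i) y = 0" using onb_in[OF e that] by (auto simp: U_def)
      show "h y (e i) = 0" using hermitian_sym[OF hf 1(1) y(1)] 1 by simp
      show 2: "g (e i) y = 0"
        using unit_sphere_minimum_eigenvector[OF W Suc.prems(3) g y min 1] .
      show "g y (e i) = 0" using hermitian_sym[OF g 1(1) y(1)] 2 by simp
    qed
    define e' where "e' = case_nat y e"
    have e'_simps: "e' 0 = y" "\<And>i. e' (Suc i) = e i" by (simp_all add: e'_def)
    have "onb h W (Suc n) e'"
      unfolding onb_def
    proof (intro conjI allI impI ballI)
      fix i assume i: "i < Suc n"
      then show "e' i \<in> W" using y eU by (cases i) (auto simp: e'_simps)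
      fix j assume "j < Suc n"
      then show "h (e' i) (e' j) = of_bool (i = j)"
        using i y eU onb_orth[OF e] by (cases i; cases j) (auto simp: e'_simps)
    next
      fix x assume x: "x \<in> W"
      define z where "z = x - h x y *s y"
      have zW: "z \<in> W" "h x y *s y \<in> W" using x y W by (auto simp: z_def intro: subspace_diff subspace_scale)
      have "h z y = 0"
        using x y zW by (simp add: z_def hermitian_diff_left[OF W hf] hermitian_scale_left[OF hf])
      then have "z \<in> U" using zW by (simp add: U_def)
      moreover have "h z (e i) = h x (e i)" if "i < n" for i
        using x y zW eU[OF that] by (simp add: z_def hermitian_diff_left[OF W hf] hermitian_scale_left[OF hf])
      ultimately have "z = (\<Sum>i<n. h x (e i) *s e i)"
        using onb_expand[OF e, of z] by simp
      then have "x = h x y *s y + (\<Sum>i<n. h x (e i) *s e i)"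
        by (simp add: z_def algebra_simps)
      then show "x = (\<Sum>i<Suc n. h x (e' i) *s e' i)"
        unfolding sum.lessThan_Suc_shift by (simp add: e'_simps)
    qed
    moreover have "g (e' i) (e' j) = 0" if "i < Suc n" "j < Suc n" "i \<noteq> j" for i j
      using that eU diag by (cases i; cases j) (auto simp: e'_simps)
    moreover have "Re (g (e' i) (e' i)) \<le> Re (g (e' j) (e' j))" if "j < Suc n" "i \<le> j" for i j
    proof (cases j)
      case 0
      then show ?thesis using that by simp
    next
      case (Suc k)
      then have k: "k < n" using that by simp
      have "Re (g y y) \<le> Re (g (e k) (e k))"
        using min[OF eU(1)[OF k]] onb_orth[OF e k k] by simp
      then show ?thesis using Suc k that sorted by (cases i) (auto simp: e'_simps)
    qed
    ultimately show ?case by blast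
  qed
  from this[OF refl] obtain e where e: "onb h W (dim W) e"
    "\<forall>i<dim W. \<forall>j<dim W. i \<noteq> j \<longrightarrow> g (e i) (e j) = 0"
    "\<forall>j<dim W. \<forall>i\<le>j. Re (g (e i) (e i)) \<le> Re (g (e j) (e j))"
    by auto
  show ?thesis by (rule that[OF e(1)]) (use e in auto)
qed

section \<open>Traces of projections and semistability\<close>

text \<open>
  \<open>U\<close> is the family of subspaces that are projected onto. For a subrepresentation on \<open>K\<close> it is
  \<open>restrict_rep V K\<close>.
\<close>

definition balanced ::
  "'s set \<Rightarrow> ('s \<Rightarrow> real) \<Rightarrow> 'v set \<Rightarrow> ('s \<Rightarrow> 'v set) \<Rightarrow> complex \<Rightarrow> ('v \<Rightarrow> 'v \<Rightarrow> complex) \<Rightarrow> bool" where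
  "balanced S w K U c h \<longleftrightarrow> hermitian_inner_product K h \<and>
     (\<forall>x\<in>K. (\<Sum>s\<in>S. of_real (w s) *s proj h (U s) x) = c *s x)"

lemma unitarizable_iff_balanced: "unitarizable S w V0 V \<longleftrightarrow> (\<exists>h c. balanced S w V0 V c h)"
  unfolding unitarizable_def balanced_def by auto

text \<open>
  The numerator of the slope, which is also meaningful for the zero space.
\<close>

definition total_weight ::
  "'s set \<Rightarrow> ('s \<Rightarrow> real) \<Rightarrow> ('s \<Rightarrow> 'v set) \<Rightarrow> real" where
  "total_weight S w U = (\<Sum>s\<in>S. w s * real (dim (U s)))"

lemma slope_eq: "slope S w K U = total_weight S w U / real (dim K)"
  by (simp add: slope_def total_weight_def)

text \<open>
  The trace of a projection is the dimension of its range. The proof evaluates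
  \<open>\<Sum>i. \<Sum>j. \<bar>h(b\<^sub>i, a\<^sub>j)\<bar>\<^sup>2\<close>, for an orthonormal basis \<open>a\<close> of \<open>A\<close>, in both orders.
\<close>

lemma trace_projection_subspace:
  assumes K: "fin_subspace K" and h: "hermitian_inner_product K h"
    and A: "subspace A" "A \<subseteq> K" and b: "onb h K k b"
  shows "(\<Sum>i<k. Re (h (proj h A (b i)) (b i))) = real (dim A)"
proof -
  note hf = inner_product_form[OF h] and K' = fin_subspaceD[OF K]
  obtain a where a: "onb h A (dim A) a" by (rule subspace_onb_exists[OF K h A])
  have aK: "a j \<in> K" if "j < dim A" for j using onb_in[OF a that] A by blast
  have "(\<Sum>i<k. Re (h (proj h A (b i)) (b i)))
      = (\<Sum>i<k. \<Sum>j<dim A. (cmod (h (b i) (a j)))\<^sup>2)"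
    using projection_norm(1)[OF K h A a] onb_in[OF b] by (intro sum.cong) auto
  also have "\<dots> = (\<Sum>j<dim A. \<Sum>i<k. (cmod (h (b i) (a j)))\<^sup>2)"
    by (rule sum.swap)
  also have "\<dots> = (\<Sum>j<dim A. \<Sum>i<k. (cmod (h (a j) (b i)))\<^sup>2)"
  proof (intro sum.cong refl)
    fix i j assume "j \<in> {..<dim A}" "i \<in> {..<k}"
    then have "h (b i) (a j) = cnj (h (a j) (b i))"
      using hermitian_sym[OF hf aK onb_in[OF b]] by auto
    then show "(cmod (h (b i) (a j)))\<^sup>2 = (cmod (h (a j) (b i)))\<^sup>2" by simp
  qed
  also have "\<dots> = (\<Sum>j<dim A. Re (h (a j) (a j)))"
    using parseval_norm[OF b K' hf aK] by simp
  also have "\<dots> = real (dim A)"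
    using onb_orth[OF a] by simp
  finally show ?thesis .
qed

text \<open>
  The difference of the two values is the squared norm of the difference of the two projections.
\<close>

lemma projection_mono:
  assumes V0: "fin_subspace V0" and h: "hermitian_inner_product V0 h"
    and W: "subspace W" "W \<subseteq> V0" and A: "subspace A" "A \<subseteq> W" and x: "x \<in> V0"
  shows "Re (h (proj h A x) x) \<le> Re (h (proj h W x) x)"
    and "Re (h (proj h A x) x) = Re (h (proj h W x) x)
      \<Longrightarrow> proj h W x \<in> A"
proof -
  note hf = inner_product_form[OF h] and V0' = fin_subspaceD[OF V0]
  have AV: "A \<subseteq> V0" using A W by blast
  define p where "p = proj h W x"
  define q where "q = proj h A x"
  have p: "p \<in> W" "p \<in> V0" and q: "q \<in> A" "q \<in> W" "q \<in> V0"
    using projection_in[OF V0 h W x] projection_in[OF V0 h A(1) AV x] A W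
    by (auto simp: p_def q_def)
  have pq: "p - q \<in> W" "p - q \<in> V0"
    using p q W subspace_diff by auto
  have "h (p - q) (p - q) = h p (p - q) - h q (p - q)"
    using hermitian_diff_left[OF V0' hf p(2) q(3) pq(2)] .
  also have "h p (p - q) = h x (p - q)"
    using projection_inner(1)[OF V0 h W x pq(1)] by (simp add: p_def)
  also have "h x (p - q) = h x p - h x q"
    using hermitian_diff_right[OF V0' hf x p(2) q(3)] .
  also have "h q (p - q) = h q p - h q q"
    using hermitian_diff_right[OF V0' hf q(3) p(2) q(3)] .
  also have "h q p = h q x"
    using projection_inner(2)[OF V0 h W x q(2)] by (simp add: p_def)
  also have "h q x = h q q"
    using projection_inner(2)[OF V0 h A(1) AV x q(1)] by (simp add: q_def)
  also have "h x p = cnj (h p x)" using hermitian_sym[OF hf p(2) x] .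
  also have "h x q = cnj (h q x)" using hermitian_sym[OF hf q(3) x] .
  finally have eq: "Re (h (p - q) (p - q)) = Re (h p x) - Re (h q x)" by simp
  then show "Re (h (proj h A x) x) \<le> Re (h (proj h W x) x)"
    using inner_nonneg[OF h V0' pq(2)] by (simp add: p_def q_def)
  assume "Re (h (proj h A x) x) = Re (h (proj h W x) x)"
  then have "Re (h (p - q) (p - q)) = 0" using eq by (simp add: p_def q_def)
  then have "h (p - q) (p - q) = 0" using hermitian_self_real[OF hf pq(2)] by simp
  then have "p = q" using inner_eq_0_imp[OF h pq(2)] by simp
  then show "proj h W x \<in> A" using q by (simp add: p_def)
qed

definition perp_in :: "('v \<Rightarrow> 'v \<Rightarrow> complex) \<Rightarrow> 'v set \<Rightarrow> 'v set \<Rightarrow> 'v set" where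
  "perp_in h K L = {x \<in> K. \<forall>m\<in>L. h x m = 0}"

lemma subspace_perp_in:
  assumes "hermitian_form V0 h" "subspace V0" "K \<subseteq> V0" "subspace K" "L \<subseteq> V0"
  shows "subspace (perp_in h K L)"
proof (rule subspaceI)
  show "0 \<in> perp_in h K L"
    using hermitian_zero_left[OF assms(2,1)] subspace_0[OF assms(4)] assms(5)
    by (auto simp: perp_in_def)
next
  fix x y assume xy: "x \<in> perp_in h K L" "y \<in> perp_in h K L"
  have "h (x + y) m = 0" if "m \<in> L" for m
    using xy that hermitian_add_left[OF assms(1), of x y m] assms(3,5) by (auto simp: perp_in_def)
  then show "x + y \<in> perp_in h K L"
    using xy subspace_add[OF assms(4)] by (auto simp: perp_in_def)
next
  fix c x assume x: "x \<in> perp_in h K L"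
  have "h (c *s x) m = 0" if "m \<in> L" for m
    using x that hermitian_scale_left[OF assms(1), of x m] assms(3,5) by (auto simp: perp_in_def)
  then show "c *s x \<in> perp_in h K L"
    using x subspace_scale[OF assms(4)] by (auto simp: perp_in_def)
qed

text \<open>
  The projection onto \<open>W\<close> dominates the one onto \<open>W \<inter> K\<close>, whose trace on \<open>K\<close> is
  \<open>dim (W \<inter> K)\<close>. In the case of equality, the projection onto \<open>W\<close> maps \<open>K\<close> into
  \<open>W \<inter> K\<close>. Hence, after its component in \<open>W \<inter> K\<close> is removed, a vector of \<open>W\<close> is orthogonal to all of \<open>K\<close>.
\<close>

lemma trace_projection_ge:
  assumes V0: "fin_subspace V0" and h: "hermitian_inner_product V0 h"
    and W: "subspace W" "W \<subseteq> V0" and K: "subspace K" "K \<subseteq> V0" and b: "onb h K k b"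
  shows "real (dim (W \<inter> K)) \<le> (\<Sum>i<k. Re (h (proj h W (b i)) (b i)))"
    and "real (dim (W \<inter> K)) = (\<Sum>i<k. Re (h (proj h W (b i)) (b i)))
      \<Longrightarrow> x \<in> W \<Longrightarrow> \<exists>a\<in>W \<inter> K. x - a \<in> W \<and> (\<forall>m\<in>K. h (x - a) m = 0)"
proof -
  let ?A = "W \<inter> K"
  note hf = inner_product_form[OF h] and V0' = fin_subspaceD[OF V0]
  have A: "subspace ?A" "?A \<subseteq> W" "?A \<subseteq> K" using subspace_inter W K by auto
  have bV: "b i \<in> V0" if "i < k" for i using onb_in[OF b that] K by blast
  have tr: "(\<Sum>i<k. Re (h (proj h ?A (b i)) (b i))) = real (dim ?A)"
    using trace_projection_subspace[OF fin_subspace_subset[OF V0 K]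
        inner_product_subset[OF h K(2)] A(1,3) b] .
  have le: "Re (h (proj h ?A (b i)) (b i)) \<le> Re (h (proj h W (b i)) (b i))"
    if "i < k" for i
    using projection_mono(1)[OF V0 h W A(1,2) bV[OF that]] .
  show "real (dim ?A) \<le> (\<Sum>i<k. Re (h (proj h W (b i)) (b i)))"
    unfolding tr[symmetric] using le by (intro sum_mono) simp
  assume eq: "real (dim ?A) = (\<Sum>i<k. Re (h (proj h W (b i)) (b i)))" and x: "x \<in> W"
  have "(\<Sum>i<k. Re (h (proj h W (b i)) (b i))
      - Re (h (proj h ?A (b i)) (b i))) = 0"
    unfolding sum_subtractf tr eq by simp
  then have each: "Re (h (proj h ?A (b i)) (b i)) = Re (h (proj h W (b i)) (b i))"
    if "i < k" for i
    using sum_nonneg_eq_0_iff[of "{..<k}" "\<lambda>i. Re (h (proj h W (b i)) (b i))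
      - Re (h (proj h ?A (b i)) (b i))"] le that by auto
  have PA: "proj h W (b i) \<in> ?A" if "i < k" for i
    using projection_mono(2)[OF V0 h W A(1,2) bV[OF that] each[OF that]] .
  have AV: "?A \<subseteq> V0" using W by blast
  have xV: "x \<in> V0" using x W by blast
  define a where "a = proj h ?A x"
  have a: "a \<in> ?A" using projection_in[OF V0 h A(1) AV xV] by (simp add: a_def)
  have d: "x - a \<in> W" "x - a \<in> V0" using x a W by (auto intro: subspace_diff)
  have "h (x - a) (b i) = 0" if i: "i < k" for i
  proof -
    have "h (x - a) (b i) = h (x - a) (proj h W (b i))"
      using projection_inner(2)[OF V0 h W bV[OF i] d(1)] by simp
    also have "\<dots> = 0"
      using projection_perp[OF V0 h A(1) AV xV PA[OF i]] by (simp add: a_def)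
    finally show ?thesis .
  qed
  moreover have "h (x - a) m = (\<Sum>i<k. cnj (h m (b i)) * h (x - a) (b i))" if "m \<in> K" for m
  proof -
    have "h (x - a) (\<Sum>i<k. h m (b i) *s b i) = (\<Sum>i<k. cnj (h m (b i)) * h (x - a) (b i))"
      using bV d by (intro hermitian_sum_right[OF V0' hf]) auto
    then show ?thesis using onb_expand[OF b that] by simp
  qed
  ultimately have "\<forall>m\<in>K. h (x - a) m = 0" by simp
  then show "\<exists>a\<in>?A. x - a \<in> W \<and> (\<forall>m\<in>K. h (x - a) m = 0)"
    using a d(1) by blast
qed

text \<open>
  Taking the orthogonal complement of \<open>L\<close> inside \<open>K\<close> splits \<open>W \<inter> K\<close> as soon as \<open>L\<close> splits \<open>W\<close>. With
  the whole space for \<open>W\<close> it splits \<open>K\<close> itself.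
\<close>

lemma is_direct_sum_perp:
  assumes V0: "fin_subspace V0" and h: "hermitian_inner_product V0 h"
    and L: "subspace L" "L \<subseteq> K" and K: "subspace K" "K \<subseteq> V0" and W: "subspace W"
    and split: "\<And>x. x \<in> W \<Longrightarrow> \<exists>a\<in>W \<inter> L. x - a \<in> W \<and> (\<forall>m\<in>L. h (x - a) m = 0)"
  shows "is_direct_sum (W \<inter> K) (W \<inter> perp_in h K L) (W \<inter> L)"
  unfolding is_direct_sum_def
proof (intro conjI equalityI subsetI)
  fix x assume x: "x \<in> W \<inter> K"
  then obtain a where a: "a \<in> W \<inter> L" "x - a \<in> W" "\<forall>m\<in>L. h (x - a) m = 0"
    using split by auto
  have "x - a \<in> K" using x a L K by (auto intro: subspace_diff)
  then have "x - a \<in> W \<inter> perp_in h K L" using a by (simp add: perp_in_def)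
  moreover have "x = (x - a) + a" by simp
  ultimately show "x \<in> {x + y |x y. x \<in> W \<inter> perp_in h K L \<and> y \<in> W \<inter> L}" using a(1) by blast
next
  fix x assume "x \<in> {x + y |x y. x \<in> W \<inter> perp_in h K L \<and> y \<in> W \<inter> L}"
  then obtain y z where "x = y + z" "y \<in> W" "y \<in> K" "z \<in> W" "z \<in> L"
    by (auto simp: perp_in_def)
  then show "x \<in> W \<inter> K" using W K L by (auto intro: subspace_add)
next
  fix x assume x: "x \<in> (W \<inter> perp_in h K L) \<inter> (W \<inter> L)"
  then have "h x x = 0" "x \<in> V0" using K by (auto simp: perp_in_def)
  then show "x \<in> {0}" using inner_eq_0_imp[OF h] by simp
next
  fix x assume "x \<in> {0 :: 'v}"
  moreover have "subspace (perp_in h K L)"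
    using subspace_perp_in[OF inner_product_form[OF h] fin_subspaceD[OF V0] K(2,1)] L K by auto
  ultimately show "x \<in> (W \<inter> perp_in h K L) \<inter> (W \<inter> L)"
    using subspace_0 W L by auto
qed

context
  fixes S :: "'s set" and w :: "'s \<Rightarrow> real" and V0 :: "'v set" and V :: "'s \<Rightarrow> 'v set"
  assumes S: "finite S" and w: "\<And>s. s \<in> S \<Longrightarrow> 0 < w s"
    and V0: "fin_subspace V0"
    and V: "\<And>s. s \<in> S \<Longrightarrow> subspace (V s)" "\<And>s. s \<in> S \<Longrightarrow> V s \<subseteq> V0"
begin

text \<open>
  The trace of both sides of the balancing equation, compressed to \<open>K\<close>.
\<close>

lemma balanced_trace:
  assumes "balanced S w V0 V c h" "subspace K" "K \<subseteq> V0" "onb h K (dim K) b"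
  shows "Re c * real (dim K) =
    (\<Sum>s\<in>S. w s * (\<Sum>i<dim K. Re (h (proj h (V s) (b i)) (b i))))"
proof -
  have h: "hermitian_inner_product V0 h" using assms by (simp add: balanced_def)
  note hf = inner_product_form[OF h] and V0' = fin_subspaceD[OF V0]
  have b: "b i \<in> V0" if "i < dim K" for i using onb_in[OF assms(4) that] assms by blast
  have "Re c = (\<Sum>s\<in>S. w s * Re (h (proj h (V s) (b i)) (b i)))" if i: "i < dim K" for i
  proof -
    have "c = h (c *s b i) (b i)"
      using hermitian_scale_left[OF hf b b] onb_orth[OF assms(4)] i by simp
    also have "c *s b i = (\<Sum>s\<in>S. of_real (w s) *s proj h (V s) (b i))"
      using assms(1) b[OF i] by (simp add: balanced_def)
    also have "h \<dots> (b i) = (\<Sum>s\<in>S. of_real (w s) * h (proj h (V s) (b i)) (b i))"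
      using projection_in[OF V0 h V b[OF i]] V(2) b[OF i] S
      by (intro hermitian_sum_left[OF V0' hf]) blast+
    finally have "c = (\<Sum>s\<in>S. of_real (w s) * h (proj h (V s) (b i)) (b i))" .
    then have "Re c = Re (\<Sum>s\<in>S. of_real (w s) * h (proj h (V s) (b i)) (b i))"
      by simp
    then show ?thesis by (simp del: Re_sum add: Re_sum)
  qed
  then have "(\<Sum>i<dim K. Re c)
      = (\<Sum>i<dim K. \<Sum>s\<in>S. w s * Re (h (proj h (V s) (b i)) (b i)))"
    by (intro sum.cong) auto
  also have "\<dots> = (\<Sum>s\<in>S. \<Sum>i<dim K. w s * Re (h (proj h (V s) (b i)) (b i)))"
    by (rule sum.swap)
  finally show ?thesis by (simp add: sum_distrib_left mult.commute)
qed

text \<open>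
  Semistability, and the splitting of every \<open>V s\<close> along a subspace of maximal slope.
\<close>

lemma balanced_weight_le:
  assumes "balanced S w V0 V c h" "subspace K" "K \<subseteq> V0"
  shows "total_weight S w (restrict_rep V K) \<le> Re c * real (dim K)"
    and "total_weight S w (restrict_rep V K) = Re c * real (dim K) \<Longrightarrow> s \<in> S \<Longrightarrow> x \<in> V s
      \<Longrightarrow> \<exists>a\<in>V s \<inter> K. x - a \<in> V s \<and> (\<forall>m\<in>K. h (x - a) m = 0)"
proof -
  have h: "hermitian_inner_product V0 h" using assms by (simp add: balanced_def)
  obtain b where b: "onb h K (dim K) b" by (rule subspace_onb_exists[OF V0 h assms(2,3)])
  define T where "T = (\<lambda>s. \<Sum>i<dim K. Re (h (proj h (V s) (b i)) (b i)))"
  have tr: "Re c * real (dim K) = (\<Sum>s\<in>S. w s * T s)"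
    using balanced_trace[OF assms b] by (simp add: T_def)
  have le: "w s * real (dim (V s \<inter> K)) \<le> w s * T s" if "s \<in> S" for s
    using trace_projection_ge(1)[OF V0 h V[OF that] assms(2,3) b] w[OF that]
    by (intro mult_left_mono) (auto simp: T_def)
  show "total_weight S w (restrict_rep V K) \<le> Re c * real (dim K)"
    unfolding tr total_weight_def restrict_rep_def using le by (intro sum_mono) auto
  assume "total_weight S w (restrict_rep V K) = Re c * real (dim K)" and s: "s \<in> S" and x: "x \<in> V s"
  then have "(\<Sum>s\<in>S. w s * T s - w s * real (dim (V s \<inter> K))) = 0"
    unfolding tr total_weight_def restrict_rep_def by (simp add: sum_subtractf)
  then have "w s * T s - w s * real (dim (V s \<inter> K)) = 0"
    using sum_nonneg_eq_0_iff[OF S, of "\<lambda>s. w s * T s - w s * real (dim (V s \<inter> K))"] le s by simp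
  then have "real (dim (V s \<inter> K)) = T s" using w[OF s] by (simp add: right_diff_distrib[symmetric])
  then show "\<exists>a\<in>V s \<inter> K. x - a \<in> V s \<and> (\<forall>m\<in>K. h (x - a) m = 0)"
    using trace_projection_ge(2)[OF V0 h V[OF s] assms(2,3) b _ x] by (simp add: T_def)
qed

text \<open>
  The equation \<open>wt\<close> says that \<open>K\<close> has maximal slope. Unlike the slope it also makes sense for
  \<open>K = {0}\<close>, which is where the induction ends, with no summands.
\<close>

lemma balanced_decomposition:
  assumes bal: "balanced S w V0 V c h" and K: "subspace K" "K \<subseteq> V0"
    and wt: "total_weight S w (restrict_rep V K) = Re c * real (dim K)"
  shows "\<exists>n A. (\<forall>i<n. subspace (A i) \<and> A i \<noteq> {0} \<and> A i \<subseteq> V0 \<and>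
             slope_stable S w (A i) (restrict_rep V (A i))) \<and>
           internal_direct_sum K n A \<and>
           (\<forall>s\<in>S. internal_direct_sum (V s \<inter> K) n (\<lambda>i. restrict_rep V (A i) s))"
  using K wt
proof (induction "dim K" arbitrary: K rule: less_induct)
  case less
  have h: "hermitian_inner_product V0 h" using bal by (simp add: balanced_def)
  note hf = inner_product_form[OF h] and V0' = fin_subspaceD[OF V0]
  show ?case
  proof (cases "K = {0}")
    case True
    have "V s \<inter> K = {0}" if "s \<in> S" for s
      using True subspace_0[OF V(1)[OF that]] by auto
    then show ?thesis
      using True by (intro exI[of _ 0]) (simp add: internal_direct_sum_0)
  next
    case False
    \<comment> \<open>A nonzero subspace of minimal dimension among those of maximal slope is stable.\<close>
    define P where "P = (\<lambda>L. subspace L \<and> L \<noteq> {0} \<and> L \<subseteq> K \<and>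
      total_weight S w (restrict_rep V L) = Re c * real (dim L))"
    have "P K" using less.prems False by (simp add: P_def)
    then obtain L where PL: "P L" and Lmin: "\<And>L'. P L' \<Longrightarrow> dim L \<le> dim L'"
      using ex_has_least_nat[of P K dim] by blast
    have L: "subspace L" "L \<noteq> {0}" "L \<subseteq> K" "L \<subseteq> V0"
      and wL: "total_weight S w (restrict_rep V L) = Re c * real (dim L)"
      using PL less.prems by (auto simp: P_def)
    have fL: "fin_subspace L" using fin_subspace_subset[OF V0 L(1,4)] .
    have stable: "slope_stable S w L (restrict_rep V L)"
      unfolding slope_stable_def
    proof (intro allI impI)
      fix M assume M: "subspace M \<and> M \<noteq> {0} \<and> M \<subset> L"
      have fM: "fin_subspace M" using fin_subspace_subset[OF fL] M by blast
      have res: "restrict_rep (restrict_rep V L) M = restrict_rep V M"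
        using M by (auto simp: restrict_rep_def)
      have MV: "M \<subseteq> V0" using M L by blast
      have "dim M < dim L" using dim_subspace_strict_mono[OF fL] M by blast
      then have "\<not> P M" using Lmin[of M] by auto
      then have "total_weight S w (restrict_rep V M) \<noteq> Re c * real (dim M)"
        using M L by (auto simp: P_def)
      then have "total_weight S w (restrict_rep V M) < Re c * real (dim M)"
        using balanced_weight_le(1)[OF bal _ MV] M by force
      then show "slope S w M (restrict_rep (restrict_rep V L) M) < slope S w L (restrict_rep V L)"
        unfolding res slope_eq wL using dim_pos[OF fM] dim_pos[OF fL L(2)] M
        by (simp add: divide_less_eq)
    qed
    define M where "M = perp_in h K L"
    have M: "subspace M" "M \<subseteq> K" "M \<subseteq> V0"
      using subspace_perp_in[OF hf V0' less.prems(2,1) L(4)] less.prems by (auto simp: M_def perp_in_def)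
    have sumK: "is_direct_sum K M L"
    proof -
      have "\<exists>a\<in>V0 \<inter> L. x - a \<in> V0 \<and> (\<forall>m\<in>L. h (x - a) m = 0)" if "x \<in> V0" for x
        using projection_in[OF V0 h L(1,4) that] projection_perp[OF V0 h L(1,4) that] L V0' that
        by (intro bexI[of _ "proj h L x"]) (auto intro: subspace_diff)
      then have "is_direct_sum (V0 \<inter> K) (V0 \<inter> M) (V0 \<inter> L)"
        unfolding M_def using is_direct_sum_perp[OF V0 h L(1,3) less.prems(1,2) V0'] by blast
      moreover have "V0 \<inter> K = K" "V0 \<inter> M = M" "V0 \<inter> L = L" using less.prems M L by auto
      ultimately show ?thesis by simp
    qed
    have sumV: "is_direct_sum (V s \<inter> K) (V s \<inter> M) (V s \<inter> L)" if s: "s \<in> S" for s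
      unfolding M_def
      using is_direct_sum_perp[OF V0 h L(1,3) less.prems(1,2) V(1)[OF s]]
        balanced_weight_le(2)[OF bal L(1,4) wL s] by blast
    have fin: "fin_subspace M" "fin_subspace L" using fin_subspace_subset[OF V0] M L by auto
    have dK: "dim K = dim M + dim L" using dim_is_direct_sum[OF fin sumK] .
    have "dim (V s \<inter> K) = dim (V s \<inter> M) + dim (V s \<inter> L)" if s: "s \<in> S" for s
      using M L V[OF s] by (intro dim_is_direct_sum[OF _ _ sumV[OF s]] fin_subspace_subset[OF V0])
        (auto intro: subspace_inter)
    then have "total_weight S w (restrict_rep V K)
        = total_weight S w (restrict_rep V M) + total_weight S w (restrict_rep V L)"
      by (simp add: total_weight_def restrict_rep_def sum.distrib[symmetric] distrib_left)
    then have wM: "total_weight S w (restrict_rep V M) = Re c * real (dim M)"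
      using less.prems(3) wL dK by (simp add: distrib_left)
    have "dim M < dim K" using dK dim_pos[OF fL L(2)] by simp
    from less.hyps[OF this M(1,3) wM] obtain n A where
      A: "\<forall>i<n. subspace (A i) \<and> A i \<noteq> {0} \<and> A i \<subseteq> V0 \<and> slope_stable S w (A i) (restrict_rep V (A i))"
      and dM: "internal_direct_sum M n A"
      and dV: "\<forall>s\<in>S. internal_direct_sum (V s \<inter> M) n (\<lambda>i. restrict_rep V (A i) s)"
      by auto
    define B where "B = A(n := L)"
    have B: "\<And>i. i < n \<Longrightarrow> B i = A i" "B n = L" by (simp_all add: B_def)
    have "internal_direct_sum K (Suc n) B"
    proof (rule internal_direct_sum_Suc[where A = B, OF _ sumK M(1) L(1) B(2)])
      show "internal_direct_sum M n B"
        using dM internal_direct_sum_cong[of n A B M] B(1) by simp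
    qed
    moreover have "internal_direct_sum (V s \<inter> K) (Suc n) (\<lambda>i. restrict_rep V (B i) s)" if s: "s \<in> S" for s
    proof (rule internal_direct_sum_Suc[OF _ sumV[OF s]])
      show "internal_direct_sum (V s \<inter> M) n (\<lambda>i. restrict_rep V (B i) s)"
        using dV s internal_direct_sum_cong[of n "\<lambda>i. restrict_rep V (B i) s"
            "\<lambda>i. restrict_rep V (A i) s" "V s \<inter> M"] B(1) by simp
      show "restrict_rep V (B n) s = V s \<inter> L" by (simp add: B restrict_rep_def)
    qed (use V[OF s] M L in \<open>auto intro: subspace_inter\<close>)
    moreover have "\<forall>i<Suc n. subspace (B i) \<and> B i \<noteq> {0} \<and> B i \<subseteq> V0 \<and>
        slope_stable S w (B i) (restrict_rep V (B i))"
      using A L stable B by (auto simp: less_Suc_eq)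
    ultimately show ?thesis by blast
  qed
qed

end

lemma balanced_imp_polystable:
  assumes S: "finite S" and w: "\<And>s. s \<in> S \<Longrightarrow> 0 < w s"
    and V0: "fin_subspace V0" "V0 \<noteq> {0}"
    and V: "\<And>s. s \<in> S \<Longrightarrow> subspace (V s)" "\<And>s. s \<in> S \<Longrightarrow> V s \<subseteq> V0"
    and bal: "balanced S w V0 V c h"
  shows "slope_polystable S w V0 V"
proof -
  note V0' = fin_subspaceD[OF V0(1)]
  have h: "hermitian_inner_product V0 h" using bal by (simp add: balanced_def)
  obtain b where b: "onb h V0 (dim V0) b" by (rule onb_exists[OF V0(1) h])
  have inter: "V s \<inter> V0 = V s" if "s \<in> S" for s using V(2)[OF that] by blast
  have wV: "total_weight S w V = Re c * real (dim V0)"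
  proof -
    have "Re c * real (dim V0) = (\<Sum>s\<in>S. w s * (\<Sum>i<dim V0. Re (h (proj h (V s) (b i)) (b i))))"
      using balanced_trace[where V = V, OF S w V0(1) V bal V0' subset_refl b] .
    also have "\<dots> = (\<Sum>s\<in>S. w s * real (dim (V s)))"
      using trace_projection_subspace[OF V0(1) h V b] by (intro sum.cong) auto
    finally show ?thesis by (simp add: total_weight_def)
  qed
  have res: "total_weight S w (restrict_rep V V0) = total_weight S w V"
    unfolding total_weight_def restrict_rep_def using inter by (intro sum.cong) auto
  have slope: "slope S w V0 V = Re c"
    unfolding slope_eq wV using dim_pos[OF V0] by simp
  have "slope_semistable S w V0 V"
    unfolding slope_semistable_def slope
  proof (intro allI impI)
    fix K assume K: "subspace K \<and> K \<noteq> {0} \<and> K \<subset> V0"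
    then have "total_weight S w (restrict_rep V K) \<le> Re c * real (dim K)"
      using balanced_weight_le(1)[where V = V, OF S w V0(1) V bal, of K] by auto
    moreover have "0 < dim K"
      using K dim_pos[OF fin_subspace_subset[OF V0(1), of K]] by auto
    ultimately show "slope S w K (restrict_rep V K) \<le> Re c"
      unfolding slope_eq by (simp add: divide_le_eq)
  qed
  moreover have "\<exists>n A. (\<forall>i<n. subspace (A i) \<and> A i \<noteq> {0} \<and> A i \<subseteq> V0 \<and>
        slope_stable S w (A i) (restrict_rep V (A i))) \<and>
      internal_direct_sum V0 n A \<and>
      (\<forall>s\<in>S. internal_direct_sum (V s \<inter> V0) n (\<lambda>i. restrict_rep V (A i) s))"
    by (rule balanced_decomposition[where V = V, OF S _ V0(1) _ _ bal V0' subset_refl])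
      (use w V res wV in auto)
  then obtain n A where
    A: "\<forall>i<n. subspace (A i) \<and> A i \<noteq> {0} \<and> A i \<subseteq> V0 \<and> slope_stable S w (A i) (restrict_rep V (A i))"
      "internal_direct_sum V0 n A"
      "\<forall>s\<in>S. internal_direct_sum (V s \<inter> V0) n (\<lambda>i. restrict_rep V (A i) s)"
    by auto
  moreover have "\<forall>s\<in>S. internal_direct_sum (V s) n (\<lambda>i. restrict_rep V (A i) s)"
    using A(3) inter by simp
  ultimately show ?thesis unfolding slope_polystable_def by blast
qed

lemma dim_internal_direct_sum:
  assumes "internal_direct_sum K n A" "fin_subspace W" "K \<subseteq> W"
    "\<And>i. i < n \<Longrightarrow> subspace (A i)"
  shows "dim K = (\<Sum>i<n. dim (A i))"
  using assms
proof (induction n arbitrary: K)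
  case 0
  then show ?case by (simp add: internal_direct_sum_0)
next
  case (Suc n)
  obtain M where M: "subspace M" "internal_direct_sum M n A" "is_direct_sum K M (A n)"
    using internal_direct_sum_SucE[OF Suc.prems(1,4)] by auto
  have sub: "M \<subseteq> W" "A n \<subseteq> W"
    using is_direct_sum_subset[OF M(3,1)] Suc.prems(3,4) by auto
  then have "dim K = dim M + dim (A n)"
    using Suc.prems M(1) by (intro dim_is_direct_sum[OF _ _ M(3)] fin_subspace_subset[OF Suc.prems(2)]) auto
  also have "dim M = (\<Sum>i<n. dim (A i))"
    using Suc.IH[OF M(2) Suc.prems(2) sub(1)] Suc.prems(4) by simp
  finally show ?case by simp
qed

lemma balanced_zero: 
  assumes "\<And>s. s \<in> S \<Longrightarrow> U s = {0}"
  shows "balanced S w {0} U c (\<lambda>_ _. 0)"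
proof -
  have h: "hermitian_inner_product {0} (\<lambda>_ _. 0)"
    by (simp add: hermitian_inner_product_def)
  have "proj (\<lambda>_ _. 0) {0} 0 = (0 :: 'v)"
    by (rule orthogonal_projection_eq[OF h]) auto
  then show ?thesis using h assms by (simp add: balanced_def)
qed

text \<open>
  \<open>M\<close> and \<open>L\<close> are declared orthogonal to each other. Every \<open>U s\<close> is the sum of its parts in \<open>M\<close> and
  \<open>L\<close>, so its projection acts separately on the two components.
\<close>

lemma balanced_is_direct_sum:
  assumes fin: "fin_subspace M" "fin_subspace L" and K: "is_direct_sum K M L"
    and U: "\<And>s. s \<in> S \<Longrightarrow> subspace (U1 s)" "\<And>s. s \<in> S \<Longrightarrow> U1 s \<subseteq> M"
      "\<And>s. s \<in> S \<Longrightarrow> subspace (U2 s)" "\<And>s. s \<in> S \<Longrightarrow> U2 s \<subseteq> L"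
      "\<And>s. s \<in> S \<Longrightarrow> is_direct_sum (U s) (U1 s) (U2 s)"
    and bal: "balanced S w M U1 c h1" "balanced S w L U2 c h2"
  shows "\<exists>h. balanced S w K U c h"
proof -
  note M = fin_subspaceD[OF fin(1)] and L = fin_subspaceD[OF fin(2)]
  have h1: "hermitian_inner_product M h1" and h2: "hermitian_inner_product L h2"
    using bal by (auto simp: balanced_def)
  note hf1 = inner_product_form[OF h1] and hf2 = inner_product_form[OF h2]
  have "\<exists>a b. a \<in> M \<and> b \<in> L \<and> x = a + b" if "x \<in> K" for x
    using K that by (auto simp: is_direct_sum_def)
  then obtain p q where pq: "\<And>x. x \<in> K \<Longrightarrow> p x \<in> M" "\<And>x. x \<in> K \<Longrightarrow> q x \<in> L"
    "\<And>x. x \<in> K \<Longrightarrow> x = p x + q x" by metis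
  have uniq: "p x = a" "q x = b" if "x \<in> K" "a \<in> M" "b \<in> L" "x = a + b" for x a b
    using is_direct_sum_unique[OF K M L pq(1)[OF that(1)] pq(2)[OF that(1)] that(2,3)] pq(3)[OF that(1)] that(4)
    by auto
  have Ksum: "a + b \<in> K" if "a \<in> M" "b \<in> L" for a b
    using K that by (auto simp: is_direct_sum_def)
  have add: "p (x + y) = p x + p y" "q (x + y) = q x + q y" "x + y \<in> K" if "x \<in> K" "y \<in> K" for x y
  proof -
    have m: "p x + p y \<in> M" "q x + q y \<in> L"
      using pq that M L by (auto intro: subspace_add)
    have eq: "x + y = (p x + p y) + (q x + q y)"
      using pq(3)[OF that(1)] pq(3)[OF that(2)] by (simp add: algebra_simps)
    show xy: "x + y \<in> K" unfolding eq by (rule Ksum[OF m])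
    show "p (x + y) = p x + p y" "q (x + y) = q x + q y" using uniq[OF xy m eq] by auto
  qed
  have scale: "p (a *s x) = a *s p x" "q (a *s x) = a *s q x" "a *s x \<in> K" if "x \<in> K" for a x
  proof -
    have m: "a *s p x \<in> M" "a *s q x \<in> L"
      using pq that M L by (auto intro: subspace_scale)
    have eq: "a *s x = a *s p x + a *s q x"
      using pq(3)[OF that] by (metis scale_right_distrib)
    show xy: "a *s x \<in> K" unfolding eq by (rule Ksum[OF m])
    show "p (a *s x) = a *s p x" "q (a *s x) = a *s q x" using uniq[OF xy m eq] by auto
  qed
  have Ksub: "subspace K"
    by (rule subspaceI) (use Ksum[of 0 0] subspace_0[OF M] subspace_0[OF L] add scale in auto)
  define h where "h = (\<lambda>x y. h1 (p x) (p y) + h2 (q x) (q y))"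
  have h: "hermitian_inner_product K h"
    unfolding hermitian_inner_product_def
  proof (intro conjI ballI allI impI)
    fix x y z assume xyz: "x \<in> K" "y \<in> K" "z \<in> K"
    show "h (x + y) z = h x z + h y z"
      using xyz pq(1,2) by (simp add: h_def add hermitian_add_left[OF hf1] hermitian_add_left[OF hf2])
  next
    fix a x y assume xy: "x \<in> K" "y \<in> K"
    show "h (a *s x) y = a * h x y"
      using xy pq(1,2) by (simp add: h_def scale hermitian_scale_left[OF hf1]
          hermitian_scale_left[OF hf2] distrib_left)
  next
    fix x y assume xy: "x \<in> K" "y \<in> K"
    show "h y x = cnj (h x y)"
      unfolding h_def hermitian_sym[OF hf1 pq(1)[OF xy(1)] pq(1)[OF xy(2)]]
        hermitian_sym[OF hf2 pq(2)[OF xy(1)] pq(2)[OF xy(2)]] by simp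
  next
    fix x assume x: "x \<in> K" "x \<noteq> 0"
    have "p x \<noteq> 0 \<or> q x \<noteq> 0" using pq(3)[OF x(1)] x(2) by auto
    moreover have "0 \<le> Re (h1 (p x) (p x))" "0 \<le> Re (h2 (q x) (q x))"
      using inner_nonneg[OF h1 M pq(1)[OF x(1)]] inner_nonneg[OF h2 L pq(2)[OF x(1)]] .
    moreover have "p x \<noteq> 0 \<Longrightarrow> 0 < Re (h1 (p x) (p x))" "q x \<noteq> 0 \<Longrightarrow> 0 < Re (h2 (q x) (q x))"
      using h1 h2 pq x by (auto simp: inner_product_iff)
    ultimately show "0 < Re (h x x)" unfolding h_def by force
  qed
  have proj: "proj h (U s) x
      = proj h1 (U1 s) (p x) + proj h2 (U2 s) (q x)"
    if s: "s \<in> S" and x: "x \<in> K" for s x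
  proof (rule orthogonal_projection_eq[OF h Ksub _ _ x])
    note U12 = U(1)[OF s] U(3)[OF s]
    have Us: "U s = {a + b |a b. a \<in> U1 s \<and> b \<in> U2 s}"
      using U(5)[OF s] by (simp add: is_direct_sum_def)
    show "subspace (U s)" unfolding Us by (rule subspace_sums[OF U12])
    show "U s \<subseteq> K" unfolding Us using Ksum U(2,4)[OF s] by blast
    define a where "a = proj h1 (U1 s) (p x)"
    define b where "b = proj h2 (U2 s) (q x)"
    have ab: "a \<in> U1 s" "b \<in> U2 s"
      using projection_in[OF fin(1) h1 U(1,2)[OF s] pq(1)[OF x]]
        projection_in[OF fin(2) h2 U(3,4)[OF s] pq(2)[OF x]] by (auto simp: a_def b_def)
    then have abML: "a \<in> M" "b \<in> L" using U(2,4)[OF s] by auto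
    show "proj h1 (U1 s) (p x) + proj h2 (U2 s) (q x) \<in> U s"
      unfolding Us using ab by (auto simp: a_def b_def)
    fix m assume "m \<in> U s"
    then obtain m1 m2 where m: "m = m1 + m2" "m1 \<in> U1 s" "m2 \<in> U2 s" unfolding Us by blast
    then have mML: "m1 \<in> M" "m2 \<in> L" using U(2,4)[OF s] by auto
    have pm: "p m = m1" "q m = m2"
      using uniq[OF Ksum[OF mML] mML refl] m(1) by auto
    have d: "p x - a \<in> M" "q x - b \<in> L"
      using pq(1,2)[OF x] abML M L by (auto intro: subspace_diff)
    have eq: "x - (a + b) = (p x - a) + (q x - b)" using pq(3)[OF x] by (simp add: algebra_simps)
    have px: "p (x - (a + b)) = p x - a" "q (x - (a + b)) = q x - b"
      unfolding eq using uniq[OF Ksum[OF d] d refl] by auto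
    have "h (x - (a + b)) m = h1 (p x - a) m1 + h2 (q x - b) m2"
      by (simp add: h_def px pm)
    also have "h1 (p x - a) m1 = 0"
      using projection_perp[OF fin(1) h1 U(1,2)[OF s] pq(1)[OF x] m(2)] by (simp add: a_def)
    also have "h2 (q x - b) m2 = 0"
      using projection_perp[OF fin(2) h2 U(3,4)[OF s] pq(2)[OF x] m(3)] by (simp add: b_def)
    finally show "h (x - (proj h1 (U1 s) (p x) + proj h2 (U2 s) (q x))) m = 0"
      by (simp add: a_def b_def)
  qed
  have "(\<Sum>s\<in>S. of_real (w s) *s proj h (U s) x) = c *s x" if x: "x \<in> K" for x
  proof -
    have "(\<Sum>s\<in>S. of_real (w s) *s proj h (U s) x)
        = (\<Sum>s\<in>S. of_real (w s) *s proj h1 (U1 s) (p x))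
          + (\<Sum>s\<in>S. of_real (w s) *s proj h2 (U2 s) (q x))"
      unfolding sum.distrib[symmetric] using proj x by (intro sum.cong) (auto simp: scale_right_distrib)
    also have "\<dots> = c *s p x + c *s q x"
      using bal pq(1,2)[OF x] by (simp add: balanced_def)
    also have "\<dots> = c *s x"
      using pq(3)[OF x] by (metis scale_right_distrib)
    finally show ?thesis .
  qed
  then show ?thesis using h unfolding balanced_def by blast
qed

text \<open>
  Induction on the number of summands. The partial direct sum inside \<open>V s\<close> has to be identified
  with the intersection of \<open>V s\<close> and the partial direct sum \<open>M\<close> of the total spaces.
\<close>

lemma balanced_internal_direct_sum:
  assumes V0: "fin_subspace V0" and V: "\<And>s. s \<in> S \<Longrightarrow> subspace (V s)"
    and "\<And>i. i < n \<Longrightarrow> subspace (A i)" "\<And>i. i < n \<Longrightarrow> A i \<subseteq> V0"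
    and "\<And>i. i < n \<Longrightarrow> \<exists>h. balanced S w (A i) (restrict_rep V (A i)) c h"
    and "internal_direct_sum K n A" "K \<subseteq> V0"
    and "\<And>s. s \<in> S \<Longrightarrow> internal_direct_sum (V s \<inter> K) n (\<lambda>i. restrict_rep V (A i) s)"
  shows "\<exists>h. balanced S w K (restrict_rep V K) c h"
  using assms(3-)
proof (induction n arbitrary: K)
  case 0
  then have K: "K = {0}" by (simp add: internal_direct_sum_0)
  have "restrict_rep V K s = {0}" if "s \<in> S" for s
    using K subspace_0[OF V[OF that]] by (auto simp: restrict_rep_def)
  then show ?case unfolding K using balanced_zero by blast
next
  case (Suc n)
  obtain M where M: "subspace M" "internal_direct_sum M n A" "is_direct_sum K M (A n)"
    using internal_direct_sum_SucE[OF Suc.prems(4,1)] by auto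
  have An: "subspace (A n)" "A n \<subseteq> V0" using Suc.prems by auto
  have MK: "M \<subseteq> K" "A n \<subseteq> K" using is_direct_sum_subset[OF M(3,1) An(1)] by auto
  have split: "internal_direct_sum (V s \<inter> M) n (\<lambda>i. restrict_rep V (A i) s)"
    "is_direct_sum (V s \<inter> K) (V s \<inter> M) (V s \<inter> A n)" if s: "s \<in> S" for s
  proof -
    have sub: "subspace (restrict_rep V (A i) s)" if "i < Suc n" for i
      using V[OF s] Suc.prems(1)[OF that] by (auto simp: restrict_rep_def intro: subspace_inter)
    obtain N where N: "subspace N" "internal_direct_sum N n (\<lambda>i. restrict_rep V (A i) s)"
      "is_direct_sum (V s \<inter> K) N (V s \<inter> A n)"
      using internal_direct_sum_SucE[OF Suc.prems(6)[OF s] sub] by (auto simp: restrict_rep_def)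
    \<comment> \<open>\<open>N\<close> turns out to be \<open>V s \<inter> M\<close>.\<close>
    have NM: "N \<subseteq> M"
    proof
      fix x assume "x \<in> N"
      then obtain a where a: "x = (\<Sum>i<n. a i)" "\<forall>i<n. a i \<in> A i"
        using N(2) by (auto simp: internal_direct_sum_def restrict_rep_def)
      have "M = {\<Sum>i<n. a i |a. \<forall>i<n. a i \<in> A i}"
        using M(2) by (simp add: internal_direct_sum_def)
      then show "x \<in> M" using a by auto
    qed
    have NV: "N \<subseteq> V s" using is_direct_sum_subset(1)[OF N(3,1)] V[OF s] An(1) subspace_inter by blast
    have "V s \<inter> M \<subseteq> N"
    proof
      fix x assume x: "x \<in> V s \<inter> M"
      then have "x \<in> V s \<inter> K" using MK by auto
      then obtain a b where ab: "x = a + b" "a \<in> N" "b \<in> V s \<inter> A n"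
        using N(3) unfolding is_direct_sum_def by blast
      have "a + b = x + 0" using ab by simp
      then have "a = x"
        by (rule is_direct_sum_unique(1)[OF M(3,1) An(1), rotated -1])
          (use ab(2,3) NM x subspace_0[OF An(1)] in blast)+
      then show "x \<in> N" using ab by simp
    qed
    then have "N = V s \<inter> M" using NM NV by blast
    then show "internal_direct_sum (V s \<inter> M) n (\<lambda>i. restrict_rep V (A i) s)"
      "is_direct_sum (V s \<inter> K) (V s \<inter> M) (V s \<inter> A n)" using N by auto
  qed
  have MV: "M \<subseteq> V0" using MK Suc.prems(5) by blast
  obtain h1 where h1: "balanced S w M (restrict_rep V M) c h1"
    using Suc.IH[OF _ _ _ M(2) MV split(1)] Suc.prems by (meson less_SucI)
  obtain h2 where h2: "balanced S w (A n) (restrict_rep V (A n)) c h2"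
    using Suc.prems(3) by blast
  show ?case
    by (rule balanced_is_direct_sum[OF _ _ M(3) _ _ _ _ _ h1 h2])
      (use fin_subspace_subset[OF V0] M(1) MV An V split(2) subspace_inter in
        \<open>auto simp: restrict_rep_def\<close>)
qed

text \<open>
  By semistability no summand has larger slope than the whole, and the slope of the whole is a
  weighted average of the slopes of the summands.
\<close>

lemma summand_slope:
  assumes S: "finite S"
    and V0: "fin_subspace V0" "V0 \<noteq> {0}"
    and V: "\<And>s. s \<in> S \<Longrightarrow> subspace (V s)" "\<And>s. s \<in> S \<Longrightarrow> V s \<subseteq> V0"
    and semi: "slope_semistable S w V0 V"
    and A: "\<And>i. i < n \<Longrightarrow> subspace (A i)" "\<And>i. i < n \<Longrightarrow> A i \<noteq> {0}" "\<And>i. i < n \<Longrightarrow> A i \<subseteq> V0"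
    and sum: "internal_direct_sum V0 n A"
      "\<And>s. s \<in> S \<Longrightarrow> internal_direct_sum (V s) n (\<lambda>i. restrict_rep V (A i) s)"
    and i: "i < n"
  shows "slope S w (A i) (restrict_rep V (A i)) = slope S w V0 V"
proof -
  define \<mu> where "\<mu> = slope S w V0 V"
  have dpos: "0 < dim (A i)" if "i < n" for i
    by (rule dim_pos[OF fin_subspace_subset[OF V0(1) A(1)[OF that] A(3)[OF that]] A(2)[OF that]])
  have wV: "total_weight S w V = \<mu> * real (dim V0)"
    using dim_pos[OF V0] by (simp add: \<mu>_def slope_eq)
  have le: "total_weight S w (restrict_rep V (A i)) \<le> \<mu> * real (dim (A i))" if i: "i < n" for i
  proof (cases "A i = V0")
    case True
    have "total_weight S w (restrict_rep V (A i)) = total_weight S w V"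
      unfolding total_weight_def restrict_rep_def True using V(2)
      by (intro sum.cong refl) (simp add: inf.absorb1)
    then show ?thesis using wV True by simp
  next
    case False
    then have "slope S w (A i) (restrict_rep V (A i)) \<le> \<mu>"
      using semi A[OF i] unfolding slope_semistable_def \<mu>_def by blast
    then show ?thesis using dpos[OF i] by (simp add: slope_eq divide_le_eq)
  qed
  have "real (dim V0) = (\<Sum>i<n. real (dim (A i)))"
    using dim_internal_direct_sum[OF sum(1) V0(1) subset_refl A(1)] by simp
  moreover have "real (dim (V s)) = (\<Sum>i<n. real (dim (V s \<inter> A i)))" if s: "s \<in> S" for s
    using dim_internal_direct_sum[OF sum(2)[OF s] V0(1) V(2)[OF s]] V(1)[OF s] A(1)
    by (simp add: restrict_rep_def subspace_inter)
  ultimately have dims: "real (dim V0) = (\<Sum>i<n. real (dim (A i)))"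
    "\<And>s. s \<in> S \<Longrightarrow> real (dim (V s)) = (\<Sum>i<n. real (dim (V s \<inter> A i)))" by auto
  have "total_weight S w V = (\<Sum>s\<in>S. \<Sum>i<n. w s * real (dim (V s \<inter> A i)))"
    unfolding total_weight_def using dims(2) by (intro sum.cong refl) (simp add: sum_distrib_left)
  also have "\<dots> = (\<Sum>i<n. \<Sum>s\<in>S. w s * real (dim (V s \<inter> A i)))" by (rule sum.swap)
  finally have "total_weight S w V = (\<Sum>i<n. total_weight S w (restrict_rep V (A i)))"
    by (simp add: total_weight_def restrict_rep_def)
  then have "(\<Sum>i<n. \<mu> * real (dim (A i)) - total_weight S w (restrict_rep V (A i))) = 0"
    using wV dims(1) by (simp add: sum_subtractf sum_distrib_left)
  then have "\<mu> * real (dim (A i)) - total_weight S w (restrict_rep V (A i)) = 0"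
    using sum_nonneg_eq_0_iff[of "{..<n}" "\<lambda>i. \<mu> * real (dim (A i)) - total_weight S w (restrict_rep V (A i))"]
      le i by auto
  then show ?thesis
    using dpos[OF i] unfolding slope_eq[of S w "A i"] \<mu>_def[symmetric] by (simp add: field_simps)
qed

section \<open>Gram determinants\<close>

text \<open>
  The determinant of the restriction of \<open>g\<close> to the span of \<open>b\<close>, relative to the basis \<open>b\<close>.
\<close>

definition gram_det :: "('v \<Rightarrow> 'v \<Rightarrow> complex) \<Rightarrow> nat \<Rightarrow> (nat \<Rightarrow> 'v) \<Rightarrow> real" where
  "gram_det g d b = Re (array_det d (\<lambda>i j. g (b i) (b j)))"

lemma gram_det_cong:
  assumes "\<And>i j. i < d \<Longrightarrow> j < d \<Longrightarrow> g (b i) (b j) = g' (b i) (b j)"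
  shows "gram_det g d b = gram_det g' d b"
  unfolding gram_det_def
  using array_det_cong[of d "\<lambda>i j. g (b i) (b j)" "\<lambda>i j. g' (b i) (b j)"] assms by simp

lemma tendsto_gram_det:
  assumes "\<And>i j. i < d \<Longrightarrow> j < d \<Longrightarrow> ((\<lambda>k. g k (b i) (b j)) \<longlongrightarrow> g' (b i) (b j)) F"
  shows "((\<lambda>k. gram_det (g k) d b) \<longlongrightarrow> gram_det g' d b) F"
  unfolding gram_det_def by (intro tendsto_Re tendsto_array_det assms)

lemma gram_det_rescale:
  "gram_det (\<lambda>x y. of_real c * g x y) d b = c ^ d * gram_det g d b"
proof -
  have "array_det d (\<lambda>i j. of_real c * g (b i) (b j)) = of_real (c ^ d) * array_det d (\<lambda>i j. g (b i) (b j))"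
    using array_det_scale_columns[of d "\<lambda>i j. g (b i) (b j)" "\<lambda>_. of_real c"] by (simp add: mult.commute)
  then show ?thesis by (simp only: gram_det_def Re_of_real_mult)
qed

lemma gram_det_basis_change:
  assumes W: "subspace W" and g: "hermitian_form W g" and e: "\<And>i. i < d \<Longrightarrow> e i \<in> W"
    and b: "\<And>i. i < d \<Longrightarrow> b i = (\<Sum>j<d. C i j *s e j)"
  shows "gram_det g d b = (cmod (array_det d C))\<^sup>2 * gram_det g d e"
proof -
  \<comment> \<open>The new Gram matrix is \<open>C\<close> times the old one times the adjoint of \<open>C\<close>.\<close>
  have adjoint: "array_det d (\<lambda>l j. cnj (C j l)) = cnj (array_det d C)"
    using array_det_cnj[of d "\<lambda>l j. C j l"] array_det_transpose[of d C] by simp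
  have "array_det d (\<lambda>i j. g (b i) (b j))
      = array_det d (\<lambda>i j. \<Sum>l<d. (\<Sum>k<d. C i k * g (e k) (e l)) * cnj (C j l))"
  proof (rule array_det_cong)
    fix i j assume ij: "i < d" "j < d"
    have "g (b i) (b j) = (\<Sum>k<d. \<Sum>l<d. C i k * cnj (C j l) * g (e k) (e l))"
      unfolding b[OF ij(1)] b[OF ij(2)] by (rule hermitian_expand[OF W g e])
    also have "\<dots> = (\<Sum>l<d. \<Sum>k<d. C i k * cnj (C j l) * g (e k) (e l))"
      by (rule sum.swap)
    finally show "g (b i) (b j) = (\<Sum>l<d. (\<Sum>k<d. C i k * g (e k) (e l)) * cnj (C j l))"
      by (simp add: sum_distrib_left sum_distrib_right mult.commute mult.left_commute)
  qed
  also have "\<dots> = array_det d C * array_det d (\<lambda>k l. g (e k) (e l)) * cnj (array_det d C)"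
    unfolding array_det_mult adjoint ..
  also have "\<dots> = of_real ((cmod (array_det d C))\<^sup>2) * array_det d (\<lambda>k l. g (e k) (e l))"
    unfolding complex_norm_square by (simp add: mult.commute mult.left_commute)
  finally show ?thesis by (simp only: gram_det_def Re_of_real_mult)
qed

lemma gram_det_diagonal:
  assumes "hermitian_form W g" "\<And>i. i < d \<Longrightarrow> e i \<in> W"
    and "\<And>i j. i < d \<Longrightarrow> j < d \<Longrightarrow> i \<noteq> j \<Longrightarrow> g (e i) (e j) = 0"
  shows "gram_det g d e = (\<Prod>i<d. Re (g (e i) (e i)))"
proof -
  have "array_det d (\<lambda>i j. g (e i) (e j)) = (\<Prod>i<d. g (e i) (e i))"
    using assms(3) by (rule array_det_diagonal)
  also have "\<dots> = (\<Prod>i<d. of_real (Re (g (e i) (e i))))"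
    using hermitian_self_real[OF assms(1,2)] by (intro prod.cong) auto
  also have "\<dots> = of_real (\<Prod>i<d. Re (g (e i) (e i)))" by simp
  finally show ?thesis by (simp only: gram_det_def Re_complex_of_real)
qed

lemma gram_det_onb:
  assumes "onb h W d e" "hermitian_form W h"
  shows "gram_det h d e = 1"
  using gram_det_diagonal[OF assms(2) onb_in[OF assms(1)]] onb_orth[OF assms(1)] by simp

lemma gram_det_nonneg:
  assumes "onb h W d e" "subspace W" "hermitian_form W h" "\<And>i. i < d \<Longrightarrow> b i \<in> W"
  shows "0 \<le> gram_det h d b"
  using gram_det_basis_change[where b = b and C = "\<lambda>i j. h (b i) (e j)",
      OF assms(2,3) onb_in[OF assms(1)]]
    onb_expand[OF assms(1) assms(4)] gram_det_onb[OF assms(1,3)] by simp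

text \<open>
  A change of basis multiplies the determinants of \<open>g\<close> and \<open>h\<close> by the same factor.
\<close>

lemma gram_det_relative:
  assumes e: "onb h W d e" and W: "subspace W" and h: "hermitian_form W h" and g: "hermitian_form W g"
    and diag: "\<And>i j. i < d \<Longrightarrow> j < d \<Longrightarrow> i \<noteq> j \<Longrightarrow> g (e i) (e j) = 0"
    and b: "\<And>i. i < d \<Longrightarrow> b i \<in> W"
  shows "gram_det g d b = gram_det h d b * (\<Prod>i<d. Re (g (e i) (e i)))"
  using gram_det_basis_change[where b = b and C = "\<lambda>i j. h (b i) (e j)", OF W h onb_in[OF e]]
    gram_det_basis_change[where b = b and C = "\<lambda>i j. h (b i) (e j)", OF W g onb_in[OF e]]
    onb_expand[OF e b] gram_det_onb[OF e h] gram_det_diagonal[OF g onb_in[OF e] diag] by simp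

lemma gram_det_pos:
  assumes W: "fin_subspace W" and h0: "hermitian_inner_product W h0" and b: "onb h0 W d b"
    and h: "hermitian_inner_product W h"
  shows "0 < gram_det h d b"
proof -
  note W' = fin_subspaceD[OF W] and hf = inner_product_form[OF h]
  have d: "d = dim W" using onb_dim[OF b W' inner_product_form[OF h0]] by simp
  obtain e where e: "onb h W d e" using onb_exists[OF W h] d by auto
  have "1 = (cmod (array_det d (\<lambda>i j. h0 (e i) (b j))))\<^sup>2 * gram_det h d b"
    using gram_det_basis_change[where b = e and C = "\<lambda>i j. h0 (e i) (b j)", OF W' hf onb_in[OF b]]
      onb_expand[OF b onb_in[OF e]] gram_det_onb[OF e hf] by simp
  then have "gram_det h d b \<noteq> 0" by auto
  then show ?thesis using gram_det_nonneg[where b = b, OF e W' hf onb_in[OF b]] by simp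
qed

text \<open>
  The eigenvalues of \<open>g\<close> relative to \<open>h\<close> lie between \<open>0\<close> and \<open>1\<close>.
\<close>

lemma gram_det_mono:
  assumes W: "fin_subspace W" and h: "hermitian_inner_product W h" and g: "hermitian_form W g"
    and le: "\<And>x. x \<in> W \<Longrightarrow> 0 \<le> Re (g x x)" "\<And>x. x \<in> W \<Longrightarrow> Re (g x x) \<le> Re (h x x)"
    and b: "\<And>i. i < dim W \<Longrightarrow> b i \<in> W"
  shows "gram_det g (dim W) b \<le> gram_det h (dim W) b"
proof -
  note W' = fin_subspaceD[OF W] and hf = inner_product_form[OF h]
  obtain e where e: "onb h W (dim W) e"
    and diag: "\<And>i j. i < dim W \<Longrightarrow> j < dim W \<Longrightarrow> i \<noteq> j \<Longrightarrow> g (e i) (e j) = 0"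
    using simultaneous_diagonalization[OF W h g] by metis
  have "Re (g (e i) (e i)) \<le> 1" if "i < dim W" for i
    using le(2)[OF onb_in[OF e that]] onb_orth[OF e that that] by simp
  then have "(\<Prod>i<dim W. Re (g (e i) (e i))) \<le> 1"
    using le(1) onb_in[OF e] by (intro prod_le_1) auto
  moreover have "gram_det g (dim W) b = gram_det h (dim W) b * (\<Prod>i<dim W. Re (g (e i) (e i)))"
    by (rule gram_det_relative[OF e W' hf g diag b])
  moreover have "0 \<le> gram_det h (dim W) b"
    by (rule gram_det_nonneg[OF e W' hf b])
  ultimately show ?thesis by (simp add: mult_left_le)
qed

section \<open>Critical points of the energy\<close>

definition rank_one_update ::
  "('v \<Rightarrow> 'v \<Rightarrow> complex) \<Rightarrow> 'v \<Rightarrow> real \<Rightarrow> 'v \<Rightarrow> 'v \<Rightarrow> complex" where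
  "rank_one_update h u t x y = h x y + of_real t * (h x u * h u y)"

lemma hermitian_form_rank_one_update:
  assumes h: "hermitian_form W h" and u: "u \<in> W"
  shows "hermitian_form W (rank_one_update h u t)"
  using hermitian_form_add_scaled[OF h hermitian_form_rank_one[OF h u]]
  by (simp add: rank_one_update_def[abs_def])

lemma cauchy_schwarz_unit:
  assumes W: "subspace W" and h: "hermitian_inner_product W h" and u: "u \<in> W" "h u u = 1" and x: "x \<in> W"
  shows "(cmod (h x u))\<^sup>2 \<le> Re (h x x)"
proof -
  note hf = inner_product_form[OF h]
  have m: "h x u *s u \<in> W" "x - h x u *s u \<in> W"
    using u x W by (auto intro: subspace_diff subspace_scale)
  have ux: "h u x = cnj (h x u)" using hermitian_sym[OF hf x u(1)] .
  have "h (x - h x u *s u) (x - h x u *s u) = h x x - h x u * cnj (h x u)"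
    using m x u by (simp add: hermitian_diff_left[OF W hf] hermitian_diff_right[OF W hf]
        hermitian_scale_left[OF hf] hermitian_scale_right[OF W hf] ux)
  also have "\<dots> = h x x - of_real ((cmod (h x u))\<^sup>2)"
    by (simp only: complex_norm_square)
  finally show ?thesis using inner_nonneg[OF h W m(2)] by simp
qed

text \<open>
  Negative \<open>t\<close> is needed as well, because the first-order condition at a minimum uses both signs.
\<close>

lemma inner_product_rank_one_update:
  assumes W: "subspace W" and h: "hermitian_inner_product W h" and u: "u \<in> W" "h u u = 1"
    and t: "\<bar>t\<bar> < 1"
  shows "hermitian_inner_product W (rank_one_update h u t)"
  unfolding inner_product_iff
proof (intro conjI ballI impI)
  note hf = inner_product_form[OF h]
  show "hermitian_form W (rank_one_update h u t)"
    by (rule hermitian_form_rank_one_update[OF hf u(1)])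
  fix x assume x: "x \<in> W" "x \<noteq> 0"
  have pos: "0 < Re (h x x)" using h x by (auto simp: inner_product_iff)
  have "h x u * h u x = of_real ((cmod (h x u))\<^sup>2)"
    unfolding hermitian_sym[OF hf x(1) u(1)] complex_norm_square ..
  then have eq: "Re (rank_one_update h u t x x) = Re (h x x) + t * (cmod (h x u))\<^sup>2"
    by (simp add: rank_one_update_def)
  have "- t * (cmod (h x u))\<^sup>2 \<le> \<bar>t\<bar> * Re (h x x)"
    using cauchy_schwarz_unit[OF W h u x(1)] by (intro mult_mono) auto
  also have "\<dots> < 1 * Re (h x x)" using t pos by (intro mult_strict_right_mono) auto
  finally show "0 < Re (rank_one_update h u t x x)" unfolding eq by simp
qed

text \<open>
  In an orthonormal basis of \<open>W\<close> that diagonalizes the rank-one form, the determinant is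
  \<open>\<Prod>i. (1 + t a\<^sub>i)\<close>, and the sum of the \<open>a\<^sub>i\<close> is the squared norm of the projection of \<open>u\<close>.
\<close>

lemma DERIV_ln_gram_det_rank_one_update:
  assumes V0: "fin_subspace V0" and h: "hermitian_inner_product V0 h" and u: "u \<in> V0"
    and W: "subspace W" "W \<subseteq> V0" and b: "\<And>i. i < dim W \<Longrightarrow> b i \<in> W"
    and pos: "0 < gram_det h (dim W) b"
  shows "((\<lambda>t. ln (gram_det (rank_one_update h u t) (dim W) b))
    has_real_derivative Re (h (proj h W u) u)) (at 0)"
proof -
  note hf = inner_product_form[OF h] and V0' = fin_subspaceD[OF V0]
  have fW: "fin_subspace W" using fin_subspace_subset[OF V0 W] .
  have hW: "hermitian_inner_product W h" using inner_product_subset[OF h W(2)] .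
  note hWf = inner_product_form[OF hW]
  have upd: "hermitian_form W (rank_one_update h u t)" for t
    using hermitian_form_subset[OF hermitian_form_rank_one_update[OF hf u] W(2)] .
  obtain e where e: "onb h W (dim W) e"
    and diag: "\<And>i j. i < dim W \<Longrightarrow> j < dim W \<Longrightarrow> i \<noteq> j \<Longrightarrow> rank_one_update h u 1 (e i) (e j) = 0"
    using simultaneous_diagonalization[OF fW hW upd[of 1]] by metis
  have eV: "e i \<in> V0" if "i < dim W" for i using onb_in[OF e that] W by blast
  define a where "a = (\<lambda>i. (cmod (h u (e i)))\<^sup>2)"
  have diag_t: "rank_one_update h u t (e i) (e j) = 0" if "i < dim W" "j < dim W" "i \<noteq> j" for t i j
    using diag[OF that] onb_orth[OF e that(1,2)] that(3) by (simp add: rank_one_update_def)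
  have entry: "Re (rank_one_update h u t (e i) (e i)) = 1 + t * a i" if i: "i < dim W" for t i
  proof -
    have "h (e i) u * h u (e i) = of_real ((cmod (h u (e i)))\<^sup>2)"
      unfolding hermitian_sym[OF hf u eV[OF i]] complex_norm_square by (simp add: mult.commute)
    then show ?thesis
      using onb_orth[OF e i i] by (simp add: rank_one_update_def a_def)
  qed
  have eq: "gram_det (rank_one_update h u t) (dim W) b
      = gram_det h (dim W) b * (\<Prod>i<dim W. 1 + t * a i)" for t
  proof -
    have "gram_det (rank_one_update h u t) (dim W) b
        = gram_det h (dim W) b * (\<Prod>i<dim W. Re (rank_one_update h u t (e i) (e i)))"
      by (rule gram_det_relative[OF e W(1) hWf upd diag_t b])
    then show ?thesis using entry by simp
  qed
  have "Re (h (proj h W u) u) = (\<Sum>i<dim W. a i)"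
    using projection_norm(1)[OF V0 h W e u] by (simp add: a_def)
  moreover have "((\<lambda>t. ln (gram_det h (dim W) b * (\<Prod>i<dim W. 1 + t * a i)))
      has_real_derivative (\<Sum>i<dim W. a i)) (at 0)"
  proof -
    have "((\<lambda>t. gram_det h (dim W) b * (\<Prod>i<dim W. 1 + t * a i))
        has_real_derivative gram_det h (dim W) b * (\<Sum>i<dim W. a i)) (at 0)"
      by (rule DERIV_cmult[OF has_real_derivative_prod_affine])
    then have "((\<lambda>t. ln (gram_det h (dim W) b * (\<Prod>i<dim W. 1 + t * a i))) has_real_derivative
        inverse (gram_det h (dim W) b * (\<Prod>i<dim W. 1 + 0 * a i)) * (gram_det h (dim W) b * (\<Sum>i<dim W. a i))) (at 0)"
      by (rule DERIV_chain2[OF DERIV_ln, rotated]) (use pos in simp)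
    moreover have "inverse (gram_det h (dim W) b * (\<Prod>i<dim W. 1 + 0 * a i))
        * (gram_det h (dim W) b * (\<Sum>i<dim W. a i)) = (\<Sum>i<dim W. a i)"
      using pos by (simp add: field_simps)
    ultimately show ?thesis by (simp only:)
  qed
  ultimately show ?thesis unfolding eq by simp
qed

text \<open>
  The bases \<open>b\<close> and \<open>B\<close> only fix an additive constant.
\<close>

definition energy ::
  "'s set \<Rightarrow> ('s \<Rightarrow> real) \<Rightarrow> 'v set \<Rightarrow> ('s \<Rightarrow> 'v set) \<Rightarrow> (nat \<Rightarrow> 'v) \<Rightarrow> ('s \<Rightarrow> nat \<Rightarrow> 'v)
    \<Rightarrow> ('v \<Rightarrow> 'v \<Rightarrow> complex) \<Rightarrow> real" where
  "energy S w V0 V b B h = (\<Sum>s\<in>S. w s * ln (gram_det h (dim (V s)) (B s)))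
     - slope S w V0 V * ln (gram_det h (dim V0) b)"

text \<open>
  With \<open>T\<close> the defect of the balancing equation, the first-order condition for rank-one updates by
  unit vectors says that the Hermitian form \<open>q(x, y) = h(T x, y)\<close> vanishes on the diagonal.
  Such a form is zero: it is positive semidefinite, and every vector is a null vector of it.
\<close>

lemma energy_minimizer_balanced:
  assumes S: "finite S" and V0: "fin_subspace V0"
    and V: "\<And>s. s \<in> S \<Longrightarrow> subspace (V s)" "\<And>s. s \<in> S \<Longrightarrow> V s \<subseteq> V0"
    and h0: "hermitian_inner_product V0 h0" and b: "onb h0 V0 (dim V0) b"
    and B: "\<And>s. s \<in> S \<Longrightarrow> onb h0 (V s) (dim (V s)) (B s)"
    and h: "hermitian_inner_product V0 h"
    and min: "\<And>h'. hermitian_inner_product V0 h' \<Longrightarrow> energy S w V0 V b B h \<le> energy S w V0 V b B h'"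
  shows "balanced S w V0 V (of_real (slope S w V0 V)) h"
proof -
  note hf = inner_product_form[OF h] and V0' = fin_subspaceD[OF V0]
  define \<mu> where "\<mu> = slope S w V0 V"
  let ?P = "\<lambda>s. proj h (V s)"
  have PV: "?P s x \<in> V0" if "s \<in> S" "x \<in> V0" for s x
    using projection_in[OF V0 h V(1)[OF that(1)] V(2)[OF that(1)] that(2)] V(2)[OF that(1)] by blast
  have fV: "fin_subspace (V s)" "hermitian_inner_product (V s) h0" "hermitian_inner_product (V s) h" if "s \<in> S" for s
    using fin_subspace_subset[OF V0 V(1)[OF that] V(2)[OF that]]
      inner_product_subset[OF h0 V(2)[OF that]]
      inner_product_subset[OF h V(2)[OF that]] by auto
  have unit: "(\<Sum>s\<in>S. w s * Re (h (?P s u) u)) = \<mu>" if u: "u \<in> V0" "h u u = 1" for u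
  proof -
    have Ps: "((\<lambda>t. ln (gram_det (rank_one_update h u t) (dim (V s)) (B s)))
      has_real_derivative Re (h (?P s u) u)) (at 0)" if s: "s \<in> S" for s
      by (rule DERIV_ln_gram_det_rank_one_update[OF V0 h u(1) V(1)[OF s] V(2)[OF s] onb_in[OF B[OF s]]
            gram_det_pos[OF fV(1)[OF s] fV(2)[OF s] B[OF s] fV(3)[OF s]]])
    have "proj h V0 u = u"
      using hermitian_zero_left[OF V0' hf] by (intro orthogonal_projection_eq[OF h V0' V0' subset_refl u(1) u(1)]) simp
    then have P0: "((\<lambda>t. ln (gram_det (rank_one_update h u t) (dim V0) b)) has_real_derivative 1) (at 0)"
      using DERIV_ln_gram_det_rank_one_update[OF V0 h u(1) V0' subset_refl onb_in[OF b]
          gram_det_pos[OF V0 h0 b h]] u(2) by simp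
    have deriv: "((\<lambda>t. energy S w V0 V b B (rank_one_update h u t)) has_real_derivative
        (\<Sum>s\<in>S. w s * Re (h (?P s u) u)) - \<mu> * 1) (at 0)"
      unfolding energy_def \<mu>_def[symmetric]
      by (intro DERIV_diff DERIV_sum DERIV_cmult Ps P0)
    have "\<forall>t. \<bar>0 - t\<bar> < 1 \<longrightarrow>
        energy S w V0 V b B (rank_one_update h u 0) \<le> energy S w V0 V b B (rank_one_update h u t)"
    proof (intro allI impI)
      fix t :: real assume "\<bar>0 - t\<bar> < 1"
      then have "energy S w V0 V b B h \<le> energy S w V0 V b B (rank_one_update h u t)"
        using inner_product_rank_one_update[OF V0' h u] by (intro min) simp
      moreover have "rank_one_update h u 0 = h" by (simp add: rank_one_update_def fun_eq_iff)
      ultimately show "energy S w V0 V b B (rank_one_update h u 0) \<le> energy S w V0 V b B (rank_one_update h u t)"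
        by simp
    qed
    then have "(\<Sum>s\<in>S. w s * Re (h (?P s u) u)) - \<mu> * 1 = 0"
      by (rule DERIV_local_min[where d = 1, OF deriv, rotated]) simp
    then show ?thesis by simp
  qed
  define T where "T = (\<lambda>x. (\<Sum>s\<in>S. of_real (w s) *s ?P s x) - of_real \<mu> *s x)"
  have TV: "T x \<in> V0" "(\<Sum>s\<in>S. of_real (w s) *s ?P s x) \<in> V0" "of_real \<mu> *s x \<in> V0" if "x \<in> V0" for x
  proof -
    show 1: "(\<Sum>s\<in>S. of_real (w s) *s ?P s x) \<in> V0"
      using PV that V0' by (intro subspace_sum subspace_scale) auto
    show 2: "of_real \<mu> *s x \<in> V0" using that V0' by (rule subspace_scale[rotated])
    show "T x \<in> V0" unfolding T_def by (rule subspace_diff[OF V0' 1 2])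
  qed
  define q where "q = (\<lambda>x y. (\<Sum>s\<in>S. of_real (w s) * h (?P s x) y) + of_real (- \<mu>) * h x y)"
  have q: "hermitian_form V0 q"
    unfolding q_def
    by (intro hermitian_form_add_scaled hermitian_form_sum hf hermitian_form_projection[OF V0 h V])
  have q_eq: "q x y = h (T x) y" if "x \<in> V0" "y \<in> V0" for x y
  proof -
    have "h (T x) y = h (\<Sum>s\<in>S. of_real (w s) *s ?P s x) y - h (of_real \<mu> *s x) y"
      unfolding T_def by (rule hermitian_diff_left[OF V0' hf TV(2)[OF that(1)] TV(3)[OF that(1)] that(2)])
    also have "h (\<Sum>s\<in>S. of_real (w s) *s ?P s x) y = (\<Sum>s\<in>S. of_real (w s) * h (?P s x) y)"
      using PV that by (intro hermitian_sum_left[OF V0' hf S]) auto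
    also have "h (of_real \<mu> *s x) y = of_real \<mu> * h x y"
      by (rule hermitian_scale_left[OF hf that])
    finally show ?thesis by (simp add: q_def)
  qed
  have qzero: "q x x = 0" if x: "x \<in> V0" for x
  proof (cases "x = 0")
    case True
    then show ?thesis using hermitian_zero_left[OF V0' q x] by simp
  next
    case False
    then obtain c where c: "0 < c" "h (complex_of_real c *s x) (complex_of_real c *s x) = 1"
      using unit_vector_scaling[OF h V0' x] by auto
    define u where "u = complex_of_real c *s x"
    have u: "u \<in> V0" "h u u = 1" using x V0' c by (auto simp: u_def intro: subspace_scale)
    have "Re (q u u) = (\<Sum>s\<in>S. w s * Re (h (?P s u) u)) - \<mu>"
      unfolding q_def using u(2) by simp
    then have "Re (q u u) = 0" using unit[OF u] by simp
    then have "q u u = 0" using hermitian_self_real[OF q u(1)] by simp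
    moreover have "q u u = of_real c * (of_real c * q x x)"
      using x u by (simp add: u_def hermitian_scale_left[OF q] hermitian_scale_right[OF V0' q])
    ultimately show ?thesis using c(1) by simp
  qed
  have "T x = 0" if x: "x \<in> V0" for x
  proof -
    have "q (T x) x = 0"
      by (rule psd_null_vector[OF V0' q _ x qzero[OF x] TV(1)[OF x]]) (simp add: qzero)
    then have "q x (T x) = 0" using hermitian_sym[OF q TV(1)[OF x] x] by simp
    then show ?thesis using inner_eq_0_imp[OF h TV(1)[OF x]] q_eq[OF x TV(1)[OF x]] by simp
  qed
  then show ?thesis
    using h unfolding balanced_def T_def \<mu>_def by simp
qed

section \<open>Degenerating inner products\<close>

text \<open>
  For an orthonormal basis \<open>e\<close>, the form with eigenvectors \<open>e i\<close> and eigenvalues \<open>\<kappa> i\<close> relative to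
  \<open>h\<close>. Partial index sets give smaller forms, to which determinants are compared.
\<close>

definition weighted_form ::
  "('v \<Rightarrow> 'v \<Rightarrow> complex) \<Rightarrow> nat set \<Rightarrow> (nat \<Rightarrow> 'v) \<Rightarrow> (nat \<Rightarrow> real) \<Rightarrow> 'v \<Rightarrow> 'v \<Rightarrow> complex" where
  "weighted_form h I e \<kappa> x y = (\<Sum>i\<in>I. of_real (\<kappa> i) * (h x (e i) * h (e i) y))"

lemma hermitian_form_weighted:
  assumes h: "hermitian_form W h" and e: "\<And>i. i \<in> I \<Longrightarrow> e i \<in> W"
  shows "hermitian_form W (weighted_form h I e \<kappa>)"
  using hermitian_form_sum[of I W "\<lambda>i x y. h x (e i) * h (e i) y" \<kappa>] hermitian_form_rank_one[OF h e]
  by (simp add: weighted_form_def[abs_def])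

lemma weighted_form_self:
  assumes h: "hermitian_form W h" and e: "\<And>i. i \<in> I \<Longrightarrow> e i \<in> W" and x: "x \<in> W"
  shows "Re (weighted_form h I e \<kappa> x x) = (\<Sum>i\<in>I. \<kappa> i * (cmod (h x (e i)))\<^sup>2)"
proof -
  have "h x (e i) * h (e i) x = of_real ((cmod (h x (e i)))\<^sup>2)" if "i \<in> I" for i
    unfolding hermitian_sym[OF h x e[OF that]] complex_norm_square ..
  then have "weighted_form h I e \<kappa> x x = (\<Sum>i\<in>I. of_real (\<kappa> i) * of_real ((cmod (h x (e i)))\<^sup>2))"
    unfolding weighted_form_def by simp
  also have "\<dots> = of_real (\<Sum>i\<in>I. \<kappa> i * (cmod (h x (e i)))\<^sup>2)"
    by (simp only: of_real_sum of_real_mult)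
  finally show ?thesis by (simp only: Re_complex_of_real)
qed

lemma inner_product_weighted:
  assumes W: "subspace W" and h: "hermitian_inner_product W h" and e: "onb h W n e"
    and pos: "\<And>i. i < n \<Longrightarrow> 0 < \<kappa> i"
  shows "hermitian_inner_product W (weighted_form h {..<n} e \<kappa>)"
  unfolding inner_product_iff
proof (intro conjI ballI impI)
  note hf = inner_product_form[OF h]
  show "hermitian_form W (weighted_form h {..<n} e \<kappa>)"
    using onb_in[OF e] by (intro hermitian_form_weighted[OF hf]) auto
  fix x assume x: "x \<in> W" "x \<noteq> 0"
  have "0 < Re (h x x)" using h x by (auto simp: inner_product_iff)
  then have "(\<Sum>i<n. (cmod (h x (e i)))\<^sup>2) \<noteq> 0"
    using parseval_norm[OF e W hf x(1)] by simp
  then obtain i where i: "i < n" "(cmod (h x (e i)))\<^sup>2 \<noteq> 0"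
    by (meson lessThan_iff sum.neutral)
  then have "0 < \<kappa> i * (cmod (h x (e i)))\<^sup>2"
    using pos by (simp add: zero_less_mult_iff)
  also have "\<dots> \<le> (\<Sum>i<n. \<kappa> i * (cmod (h x (e i)))\<^sup>2)"
    using i(1) pos by (intro member_le_sum) (auto simp: less_imp_le)
  also have "\<dots> = Re (weighted_form h {..<n} e \<kappa> x x)"
    using onb_in[OF e] by (intro weighted_form_self[OF hf _ x(1), symmetric]) auto
  finally show "0 < Re (weighted_form h {..<n} e \<kappa> x x)" .
qed

text \<open>
  If as many terms are kept as \<open>b\<close> has vectors, the Gram matrix is a product of three square
  matrices, the middle one being diagonal.
\<close>

lemma gram_det_weighted_square:
  assumes h: "hermitian_form W h" and b: "\<And>i. i < d \<Longrightarrow> b i \<in> W" and e: "\<And>i. i \<in> J \<Longrightarrow> e i \<in> W"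
    and js: "bij_betw js {..<d} J"
  shows "gram_det (weighted_form h J e \<kappa>) d b
    = (cmod (array_det d (\<lambda>q p. h (b p) (e (js q)))))\<^sup>2 * (\<Prod>j\<in>J. \<kappa> j)"
proof -
  define D where "D = array_det d (\<lambda>q p. h (b p) (e (js q)))"
  have ej: "e (js q) \<in> W" if "q < d" for q using js e that by (auto simp: bij_betw_def)
  have "array_det d (\<lambda>i j. weighted_form h J e \<kappa> (b i) (b j))
      = array_det d (\<lambda>i j. \<Sum>q<d. (h (b i) (e (js q)) * of_real (\<kappa> (js q))) * cnj (h (b j) (e (js q))))"
  proof (rule array_det_cong)
    fix i j assume ij: "i < d" "j < d"
    have "weighted_form h J e \<kappa> (b i) (b j)
        = (\<Sum>q<d. of_real (\<kappa> (js q)) * (h (b i) (e (js q)) * h (e (js q)) (b j)))"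
      unfolding weighted_form_def by (rule sum.reindex_bij_betw[OF js, symmetric])
    also have "\<dots> = (\<Sum>q<d. (h (b i) (e (js q)) * of_real (\<kappa> (js q))) * cnj (h (b j) (e (js q))))"
    proof (intro sum.cong refl)
      fix q assume "q \<in> {..<d}"
      then have "h (e (js q)) (b j) = cnj (h (b j) (e (js q)))"
        using hermitian_sym[OF h b[OF ij(2)] ej] by simp
      then show "of_real (\<kappa> (js q)) * (h (b i) (e (js q)) * h (e (js q)) (b j))
        = (h (b i) (e (js q)) * of_real (\<kappa> (js q))) * cnj (h (b j) (e (js q)))" by simp
    qed
    finally show "weighted_form h J e \<kappa> (b i) (b j)
        = (\<Sum>q<d. (h (b i) (e (js q)) * of_real (\<kappa> (js q))) * cnj (h (b j) (e (js q))))" .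
  qed
  also have "\<dots> = array_det d (\<lambda>i q. h (b i) (e (js q)) * of_real (\<kappa> (js q)))
      * array_det d (\<lambda>q j. cnj (h (b j) (e (js q))))"
    by (rule array_det_mult)
  also have "array_det d (\<lambda>q j. cnj (h (b j) (e (js q)))) = cnj D"
    unfolding D_def by (rule array_det_cnj)
  also have "array_det d (\<lambda>i q. h (b i) (e (js q)) * of_real (\<kappa> (js q)))
      = array_det d (\<lambda>i q. h (b i) (e (js q))) * (\<Prod>q<d. of_real (\<kappa> (js q)))"
    by (rule array_det_scale_columns)
  also have "array_det d (\<lambda>i q. h (b i) (e (js q))) = D"
    unfolding D_def using array_det_transpose[of d "\<lambda>q i. h (b i) (e (js q))"] .
  also have "(\<Prod>q<d. complex_of_real (\<kappa> (js q))) = of_real (\<Prod>j\<in>J. \<kappa> j)"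
    using prod.reindex_bij_betw[OF js, of \<kappa>] by (simp flip: of_real_prod)
  also have "D * of_real (\<Prod>j\<in>J. \<kappa> j) * cnj D = of_real (\<Prod>j\<in>J. \<kappa> j) * (D * cnj D)"
    by (simp add: mult.commute mult.left_commute)
  also have "D * cnj D = of_real ((cmod D)\<^sup>2)" by (simp only: complex_norm_square)
  finally show ?thesis
    unfolding gram_det_def D_def[symmetric] by (simp only: Re_of_real_mult Re_complex_of_real mult.commute)
qed

lemma hermitian_form_weighted_eigenbasis:
  assumes W: "subspace W" and h0: "hermitian_form W h0" and g: "hermitian_form W g" and e: "onb h0 W n e"
    and diag: "\<And>i j. i < n \<Longrightarrow> j < n \<Longrightarrow> i \<noteq> j \<Longrightarrow> g (e i) (e j) = 0"
    and xy: "x \<in> W" "y \<in> W"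
  shows "g x y = weighted_form h0 {..<n} e (\<lambda>i. Re (g (e i) (e i))) x y"
proof -
  have "g x y = (\<Sum>i<n. \<Sum>j<n. h0 x (e i) * cnj (h0 y (e j)) * g (e i) (e j))"
    using hermitian_expand[OF W g onb_in[OF e], of n "\<lambda>i. i" "\<lambda>i. h0 x (e i)" "\<lambda>i. h0 y (e i)"]
      onb_expand[OF e xy(1)] onb_expand[OF e xy(2)] by simp
  also have "\<dots> = (\<Sum>i<n. of_real (Re (g (e i) (e i))) * (h0 x (e i) * h0 (e i) y))"
  proof (intro sum.cong refl)
    fix i assume i: "i \<in> {..<n}"
    have "(\<Sum>j<n. h0 x (e i) * cnj (h0 y (e j)) * g (e i) (e j))
        = (\<Sum>j<n. if j = i then h0 x (e i) * cnj (h0 y (e i)) * g (e i) (e i) else 0)"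
      using diag i by (intro sum.cong) auto
    also have "\<dots> = h0 x (e i) * cnj (h0 y (e i)) * g (e i) (e i)" using i by simp
    also have "cnj (h0 y (e i)) = h0 (e i) y"
      using hermitian_sym[OF h0 xy(2) onb_in[OF e]] i by simp
    also have "g (e i) (e i) = of_real (Re (g (e i) (e i)))"
      using hermitian_self_real[OF g onb_in[OF e]] i by blast
    finally show "(\<Sum>j<n. h0 x (e i) * cnj (h0 y (e j)) * g (e i) (e j))
      = of_real (Re (g (e i) (e i))) * (h0 x (e i) * h0 (e i) y)" by (simp add: mult.commute)
  qed
  finally show ?thesis by (simp add: weighted_form_def)
qed

text \<open>
  For an orthonormal basis \<open>e\<close> this is the span of \<open>e 0, \<dots>, e (j - 1)\<close>. The description by
  annihilation needs only the functionals \<open>\<lambda>x. h x (e i)\<close>, and these pass to limits.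
\<close>

definition tail_annihilator :: "('v \<Rightarrow> 'v \<Rightarrow> complex) \<Rightarrow> 'v set \<Rightarrow> nat \<Rightarrow> (nat \<Rightarrow> 'v) \<Rightarrow> nat \<Rightarrow> 'v set" where
  "tail_annihilator h V0 n e j = {x \<in> V0. \<forall>i<n. j \<le> i \<longrightarrow> h x (e i) = 0}"

text \<open>
  The indices \<open>j\<close> at which the intersection of \<open>W\<close> with the flag grows.
\<close>

definition jumps :: "('v \<Rightarrow> 'v \<Rightarrow> complex) \<Rightarrow> 'v set \<Rightarrow> nat \<Rightarrow> (nat \<Rightarrow> 'v) \<Rightarrow> 'v set \<Rightarrow> nat set" where
  "jumps h V0 n e W =
     {j. j < n \<and> (\<exists>x\<in>W \<inter> tail_annihilator h V0 n e (Suc j). h x (e j) \<noteq> 0)}"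

context
  fixes V0 h and n :: nat and e
  assumes V0: "fin_subspace V0" and h: "hermitian_inner_product V0 h"
    and e: "\<And>i. i < n \<Longrightarrow> e i \<in> V0"
    and separating: "\<And>x. x \<in> V0 \<Longrightarrow> (\<And>i. i < n \<Longrightarrow> h x (e i) = 0) \<Longrightarrow> x = 0"
begin

lemma subspace_tail_annihilator: "subspace (tail_annihilator h V0 n e j)"
proof (rule subspaceI)
  note V0' = fin_subspaceD[OF V0] and hf = inner_product_form[OF h]
  show "0 \<in> tail_annihilator h V0 n e j"
    using hermitian_zero_left[OF V0' hf] e subspace_0[OF V0'] by (auto simp: tail_annihilator_def)
  show "x + y \<in> tail_annihilator h V0 n e j"
    if "x \<in> tail_annihilator h V0 n e j" "y \<in> tail_annihilator h V0 n e j" for x y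
    using that hermitian_add_left[OF hf] e subspace_add[OF V0'] by (auto simp: tail_annihilator_def)
  show "c *s x \<in> tail_annihilator h V0 n e j" if "x \<in> tail_annihilator h V0 n e j" for c x
    using that hermitian_scale_left[OF hf] e subspace_scale[OF V0'] by (auto simp: tail_annihilator_def)
qed

lemma tail_annihilator_subset: "tail_annihilator h V0 n e j \<subseteq> V0"
  by (auto simp: tail_annihilator_def)

lemma tail_annihilator_0: "tail_annihilator h V0 n e 0 = {0}"
  using separating subspace_0[OF subspace_tail_annihilator[of 0]] by (auto simp: tail_annihilator_def)

lemma tail_annihilator_top: "tail_annihilator h V0 n e n = V0"
  by (auto simp: tail_annihilator_def)

lemma card_jumps:
  assumes W: "subspace W" "W \<subseteq> V0" and j: "j \<le> n"
  shows "card (jumps h V0 n e W \<inter> {..<j}) = dim (W \<inter> tail_annihilator h V0 n e j)"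
  using j
proof (induction j)
  case 0
  have "W \<inter> {0} = {0}" using subspace_0[OF W(1)] by auto
  then show ?case by (simp add: tail_annihilator_0)
next
  case (Suc j)
  let ?E = "tail_annihilator h V0 n e" and ?J = "jumps h V0 n e W"
  note hf = inner_product_form[OF h]
  have ker: "{x \<in> W \<inter> ?E (Suc j). h x (e j) = 0} = W \<inter> ?E j"
    using Suc.prems by (auto simp: tail_annihilator_def Suc_le_eq le_eq_less_or_eq)
  show ?case
  proof (cases "j \<in> ?J")
    case True
    then obtain u where u: "u \<in> W \<inter> ?E (Suc j)" "h u (e j) \<noteq> 0" by (auto simp: jumps_def)
    have sub: "W \<inter> ?E (Suc j) \<subseteq> V0" "subspace (W \<inter> ?E (Suc j))"
      using W subspace_inter subspace_tail_annihilator by auto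
    have ej: "e j \<in> V0" using e Suc.prems by simp
    have "dim (W \<inter> ?E (Suc j)) = Suc (dim {x \<in> W \<inter> ?E (Suc j). h x (e j) = 0})"
    proof (rule dim_kernel[where \<phi> = "\<lambda>x. h x (e j)", OF fin_subspace_subset[OF V0 sub(2,1)] _ _ u])
      show "h (x + y) (e j) = h x (e j) + h y (e j)"
        if "x \<in> W \<inter> ?E (Suc j)" "y \<in> W \<inter> ?E (Suc j)" for x y
        using that sub(1) ej by (intro hermitian_add_left[OF hf]) auto
      show "h (c *s x) (e j) = c * h x (e j)" if "x \<in> W \<inter> ?E (Suc j)" for c x
        using that sub(1) ej by (intro hermitian_scale_left[OF hf]) auto
    qed
    moreover have "?J \<inter> {..<Suc j} = insert j (?J \<inter> {..<j})" using True by auto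
    ultimately show ?thesis using Suc ker by simp
  next
    case False
    then have "W \<inter> ?E (Suc j) = W \<inter> ?E j"
      unfolding ker[symmetric] using Suc.prems by (auto simp: jumps_def)
    moreover have "?J \<inter> {..<Suc j} = ?J \<inter> {..<j}" using False by (auto simp: less_Suc_eq)
    ultimately show ?thesis using Suc by simp
  qed
qed

lemma jumps_subset: "jumps h V0 n e W \<subseteq> {..<n}"
  by (auto simp: jumps_def)

lemma card_jumps_total:
  assumes "subspace W" "W \<subseteq> V0"
  shows "card (jumps h V0 n e W) = dim W"
  using card_jumps[OF assms le_refl] assms(2) jumps_subset[of W]
  by (simp add: tail_annihilator_top inf.absorb1)

text \<open>
  A combination \<open>x\<close> of the basis vectors that is annihilated at all jumps of \<open>W\<close> would have to be
  zero: the first member of the flag that contains a nonzero \<open>x\<close> belongs to a jump, and \<open>x\<close> is not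
  annihilated there.
\<close>

lemma jumps_minor_nonzero:
  assumes W: "subspace W" "W \<subseteq> V0" and b: "onb h W d b"
    and js: "bij_betw js {..<d} (jumps h V0 n e W)"
  shows "array_det d (\<lambda>q p. h (b p) (e (js q))) \<noteq> 0"
proof
  note hf = inner_product_form[OF h] and V0' = fin_subspaceD[OF V0]
  assume "array_det d (\<lambda>q p. h (b p) (e (js q))) = 0"
  then obtain v where v: "\<exists>p<d. v p \<noteq> 0" "\<And>q. q < d \<Longrightarrow> (\<Sum>p<d. h (b p) (e (js q)) * v p) = 0"
    by (rule array_det_eq_0_imp_kernel) auto
  have bV: "b p \<in> V0" if "p < d" for p using onb_in[OF b that] W by blast
  define x where "x = (\<Sum>p<d. v p *s b p)"
  have "x \<in> W" using onb_in[OF b] W unfolding x_def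
    by (intro subspace_sum subspace_scale) auto
  then have x: "x \<in> W" "x \<in> V0" using W by auto
  have hx: "h x y = (\<Sum>p<d. v p * h (b p) y)" if "y \<in> V0" for y
    unfolding x_def using bV that by (intro hermitian_sum_left[OF V0' hf]) auto
  have "x \<noteq> 0"
  proof
    assume "x = 0"
    obtain p where p: "p < d" "v p \<noteq> 0" using v(1) by auto
    have "h x (b p) = (\<Sum>i<d. if i = p then v p else 0)"
      unfolding hx[OF bV[OF p(1)]] using onb_orth[OF b _ p(1)] by (intro sum.cong) auto
    then show False
      using p hermitian_zero_left[OF V0' hf bV[OF p(1)]] \<open>x = 0\<close> by simp
  qed
  have zero: "h x (e j) = 0" if j: "j \<in> jumps h V0 n e W" for j
  proof -
    obtain q where "q < d" "j = js q" using js j by (auto simp: bij_betw_def)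
    moreover have "e j \<in> V0" using j jumps_subset e by auto
    ultimately show ?thesis using hx[of "e j"] v(2)[of q] by (simp add: mult.commute)
  qed
  \<comment> \<open>The first step of the flag that contains \<open>x\<close> is a jump of \<open>W\<close>.\<close>
  define m where "m = (LEAST m. x \<in> tail_annihilator h V0 n e m)"
  have top: "x \<in> tail_annihilator h V0 n e n" using x by (simp add: tail_annihilator_top)
  have m: "x \<in> tail_annihilator h V0 n e m" unfolding m_def using top by (rule LeastI)
  have mn: "m \<le> n" unfolding m_def using top by (rule Least_le)
  have "x \<notin> tail_annihilator h V0 n e 0" using \<open>x \<noteq> 0\<close> by (simp add: tail_annihilator_0)
  then have "m \<noteq> 0" using m by metis
  then obtain j where j: "m = Suc j" by (cases m) auto
  have notj: "x \<notin> tail_annihilator h V0 n e j"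
    using not_less_Least[of j "\<lambda>m. x \<in> tail_annihilator h V0 n e m"] j unfolding m_def by simp
  have "h x (e j) \<noteq> 0"
  proof
    assume "h x (e j) = 0"
    then have "x \<in> tail_annihilator h V0 n e j"
      using m unfolding j tail_annihilator_def by (auto simp: le_eq_less_or_eq Suc_le_eq)
    then show False using notj by simp
  qed
  moreover have "j \<in> jumps h V0 n e W"
    using calculation m x mn j by (auto simp: jumps_def)
  ultimately show False using zero by blast
qed

text \<open>
  Drop all eigenvalues except those at the jumps of \<open>W\<close> in the limiting flag. The determinant of the
  smaller form is their product times a squared minor, and this minor converges to a nonzero limit.
  The bound is uniform in the eigenvalues.
\<close>

lemma gram_det_weighted_lower_bound:
  assumes W: "subspace W" "W \<subseteq> V0" and b: "onb h W (dim W) b"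
    and E: "\<And>k. onb h V0 n (E k)"
    and lim: "\<And>i x. i < n \<Longrightarrow> x \<in> V0 \<Longrightarrow> (\<lambda>k. h x (E k i)) \<longlonglongrightarrow> h x (e i)"
  shows "\<exists>c>0. \<forall>\<^sub>F k in sequentially. \<forall>\<kappa>. (\<forall>i<n. 0 < \<kappa> i) \<longrightarrow>
    c * (\<Prod>j\<in>jumps h V0 n e W. \<kappa> j) \<le> gram_det (weighted_form h {..<n} (E k) \<kappa>) (dim W) b"
proof -
  let ?J = "jumps h V0 n e W" and ?d = "dim W"
  note hf = inner_product_form[OF h] and V0' = fin_subspaceD[OF V0]
  note J = jumps_subset[of W]
  have finJ: "finite ?J" using J finite_subset by blast
  obtain js where js: "bij_betw js {..<?d} ?J"
    using ex_bij_betw_nat_finite[OF finJ] card_jumps_total[OF W] by (auto simp: lessThan_atLeast0)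
  have jsn: "js q < n" if "q < ?d" for q using js J that by (auto simp: bij_betw_def)
  have bV: "b p \<in> V0" if "p < ?d" for p using onb_in[OF b that] W by blast
  define D where "D = (\<lambda>f. array_det ?d (\<lambda>q p. h (b p) (f (js q))))"
  define c where "c = (cmod (D e))\<^sup>2 / 2"
  have pos: "0 < (cmod (D e))\<^sup>2" using jumps_minor_nonzero[OF W b js] by (simp add: D_def)
  have "(\<lambda>k. (cmod (D (E k)))\<^sup>2) \<longlonglongrightarrow> (cmod (D e))\<^sup>2"
    unfolding D_def by (intro tendsto_power tendsto_norm tendsto_array_det lim jsn bV)
  moreover have "c < (cmod (D e))\<^sup>2" using pos by (simp add: c_def)
  ultimately have "\<forall>\<^sub>F k in sequentially. c < (cmod (D (E k)))\<^sup>2"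
    by (rule order_tendstoD(1))
  then have "\<forall>\<^sub>F k in sequentially. \<forall>\<kappa>. (\<forall>i<n. 0 < \<kappa> i) \<longrightarrow>
    c * (\<Prod>j\<in>?J. \<kappa> j) \<le> gram_det (weighted_form h {..<n} (E k) \<kappa>) ?d b"
  proof eventually_elim
    case (elim k)
    show ?case
    proof (intro allI impI)
      fix \<kappa> :: "nat \<Rightarrow> real" assume \<kappa>: "\<forall>i<n. 0 < \<kappa> i"
      note Ek = onb_in[OF E[of k]]
      have EJ: "E k i \<in> V0" if "i \<in> ?J" for i using Ek J that by auto
      have full: "hermitian_inner_product V0 (weighted_form h {..<n} (E k) \<kappa>)"
        using \<kappa> by (intro inner_product_weighted[OF V0' h E]) auto
      have part: "hermitian_form V0 (weighted_form h ?J (E k) \<kappa>)"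
        by (rule hermitian_form_weighted[OF hf EJ])
      have "0 \<le> (\<Prod>j\<in>?J. \<kappa> j)" using \<kappa> J by (intro prod_nonneg) (auto simp: less_imp_le)
      then have "c * (\<Prod>j\<in>?J. \<kappa> j) \<le> (cmod (D (E k)))\<^sup>2 * (\<Prod>j\<in>?J. \<kappa> j)"
        using elim by (intro mult_right_mono) auto
      also have "\<dots> = gram_det (weighted_form h ?J (E k) \<kappa>) ?d b"
        unfolding D_def using gram_det_weighted_square[OF hf bV EJ js] by simp
      also have "\<dots> \<le> gram_det (weighted_form h {..<n} (E k) \<kappa>) ?d b"
      proof (rule gram_det_mono[OF fin_subspace_subset[OF V0 W]
            inner_product_subset[OF full W(2)] hermitian_form_subset[OF part W(2)] _ _ onb_in[OF b]])
        fix x assume "x \<in> W"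
        then have x: "x \<in> V0" using W by blast
        have eqJ: "Re (weighted_form h ?J (E k) \<kappa> x x) = (\<Sum>i\<in>?J. \<kappa> i * (cmod (h x (E k i)))\<^sup>2)"
          by (rule weighted_form_self[OF hf EJ x])
        have eqn: "Re (weighted_form h {..<n} (E k) \<kappa> x x) = (\<Sum>i<n. \<kappa> i * (cmod (h x (E k i)))\<^sup>2)"
          using Ek by (intro weighted_form_self[OF hf _ x]) auto
        show "0 \<le> Re (weighted_form h ?J (E k) \<kappa> x x)"
          unfolding eqJ using \<kappa> J by (intro sum_nonneg mult_nonneg_nonneg) (auto simp: less_imp_le)
        show "Re (weighted_form h ?J (E k) \<kappa> x x) \<le> Re (weighted_form h {..<n} (E k) \<kappa> x x)"
          unfolding eqJ eqn using \<kappa> J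
          by (intro sum_mono2) (auto simp: less_imp_le)
      qed
      finally show "c * (\<Prod>j\<in>?J. \<kappa> j) \<le> gram_det (weighted_form h {..<n} (E k) \<kappa>) ?d b" .
    qed
  qed
  moreover have "0 < c" using pos by (simp add: c_def)
  ultimately show ?thesis by blast
qed

end

section \<open>Existence of a minimizer\<close>

lemma energy_cong:
  assumes "\<And>s i j. s \<in> S \<Longrightarrow> i < dim (V s) \<Longrightarrow> j < dim (V s) \<Longrightarrow> g (B s i) (B s j) = g' (B s i) (B s j)"
    and "\<And>i j. i < dim V0 \<Longrightarrow> j < dim V0 \<Longrightarrow> g (b i) (b j) = g' (b i) (b j)"
  shows "energy S w V0 V b B g = energy S w V0 V b B g'"
proof -
  have "gram_det g (dim V0) b = gram_det g' (dim V0) b"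
    by (rule gram_det_cong) (rule assms(2))
  moreover have "gram_det g (dim (V s)) (B s) = gram_det g' (dim (V s)) (B s)" if "s \<in> S" for s
    by (rule gram_det_cong) (rule assms(1)[OF that])
  ultimately show ?thesis unfolding energy_def by simp
qed

text \<open>
  Rescaling \<open>h\<close> adds \<open>ln c\<close> times \<open>(\<Sum>s\<in>S. w s dim (V s)) - \<mu> dim V0\<close>, which is zero by the definition
  of the slope.
\<close>

lemma energy_rescale:
  assumes "0 < c" and V0: "dim V0 \<noteq> 0"
    and pos: "\<And>s. s \<in> S \<Longrightarrow> 0 < gram_det h (dim (V s)) (B s)" "0 < gram_det h (dim V0) b"
  shows "energy S w V0 V b B (\<lambda>x y. of_real c * h x y) = energy S w V0 V b B h"
proof -
  have ln: "ln (gram_det (\<lambda>x y. of_real c * h x y) d f) = real d * ln c + ln (gram_det h d f)"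
    if "0 < gram_det h d f" for d f
    using that \<open>0 < c\<close> by (simp add: gram_det_rescale ln_mult ln_realpow)
  have wt: "(\<Sum>s\<in>S. w s * real (dim (V s))) = slope S w V0 V * real (dim V0)"
    using V0 by (simp add: slope_def)
  have "(\<Sum>s\<in>S. w s * ln (gram_det (\<lambda>x y. of_real c * h x y) (dim (V s)) (B s)))
      = (\<Sum>s\<in>S. w s * real (dim (V s)) * ln c + w s * ln (gram_det h (dim (V s)) (B s)))"
    using ln[OF pos(1)] by (intro sum.cong refl) (simp add: algebra_simps)
  also have "\<dots> = slope S w V0 V * real (dim V0) * ln c + (\<Sum>s\<in>S. w s * ln (gram_det h (dim (V s)) (B s)))"
    unfolding sum.distrib wt[symmetric] by (simp add: sum_distrib_right)
  finally show ?thesis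
    unfolding energy_def using ln[OF pos(2)] by (simp add: algebra_simps)
qed

context
  fixes S :: "'s set" and w :: "'s \<Rightarrow> real" and V0 :: "'v set" and V :: "'s \<Rightarrow> 'v set"
    and h0 :: "'v \<Rightarrow> 'v \<Rightarrow> complex" and b :: "nat \<Rightarrow> 'v" and B :: "'s \<Rightarrow> nat \<Rightarrow> 'v"
  assumes S: "finite S" and w: "\<And>s. s \<in> S \<Longrightarrow> 0 < w s"
    and V0: "fin_subspace V0" "V0 \<noteq> {0}"
    and V: "\<And>s. s \<in> S \<Longrightarrow> subspace (V s)" "\<And>s. s \<in> S \<Longrightarrow> V s \<subseteq> V0"
    and h0: "hermitian_inner_product V0 h0" and b: "onb h0 V0 (dim V0) b"
    and B: "\<And>s. s \<in> S \<Longrightarrow> onb h0 (V s) (dim (V s)) (B s)"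
begin

lemma gram_det_basis_pos:
  assumes "hermitian_inner_product V0 h"
  shows "s \<in> S \<Longrightarrow> 0 < gram_det h (dim (V s)) (B s)" "0 < gram_det h (dim V0) b"
proof -
  show "0 < gram_det h (dim V0) b" by (rule gram_det_pos[OF V0(1) h0 b assms])
  assume s: "s \<in> S"
  show "0 < gram_det h (dim (V s)) (B s)"
    by (rule gram_det_pos[OF fin_subspace_subset[OF V0(1) V(1)[OF s] V(2)[OF s]]
          inner_product_subset[OF h0 V(2)[OF s]] B[OF s]
          inner_product_subset[OF assms V(2)[OF s]]])
qed

text \<open>
  The eigenbasis of \<open>h\<close> relative to \<open>h0\<close>, after \<open>h\<close> has been scaled to have smallest eigenvalue \<open>1\<close>.
\<close>

lemma normal_form_same_energy:
  assumes h: "hermitian_inner_product V0 h"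
  shows "\<exists>e \<kappa>. onb h0 V0 (dim V0) e \<and> \<kappa> 0 = 1 \<and> (\<forall>j<dim V0. \<forall>i\<le>j. \<kappa> i \<le> \<kappa> j) \<and>
    energy S w V0 V b B (weighted_form h0 {..<dim V0} e \<kappa>) = energy S w V0 V b B h"
proof -
  let ?n = "dim V0"
  note V0' = fin_subspaceD[OF V0(1)] and hf = inner_product_form[OF h]
    and hf0 = inner_product_form[OF h0]
  have n: "0 < ?n" using dim_pos[OF V0] .
  obtain e where e: "onb h0 V0 ?n e"
    and diag: "\<And>i j. i < ?n \<Longrightarrow> j < ?n \<Longrightarrow> i \<noteq> j \<Longrightarrow> h (e i) (e j) = 0"
    and sorted: "\<And>i j. i \<le> j \<Longrightarrow> j < ?n \<Longrightarrow> Re (h (e i) (e i)) \<le> Re (h (e j) (e j))"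
    using simultaneous_diagonalization[OF V0(1) h0 hf] by metis
  have ne: "e i \<noteq> 0" if "i < ?n" for i
    using onb_orth[OF e that that] hermitian_zero_left[OF V0' hf0 onb_in[OF e that]] by auto
  have pos: "0 < Re (h (e i) (e i))" if "i < ?n" for i
    using h onb_in[OF e that] ne[OF that] by (auto simp: inner_product_iff)
  define c where "c = 1 / Re (h (e 0) (e 0))"
  have c: "0 < c" using pos[OF n] by (simp add: c_def)
  define \<kappa> where "\<kappa> = (\<lambda>i. c * Re (h (e i) (e i)))"
  have wf: "weighted_form h0 {..<?n} e \<kappa> x y = of_real c * h x y" if "x \<in> V0" "y \<in> V0" for x y
  proof -
    have "h x y = weighted_form h0 {..<?n} e (\<lambda>i. Re (h (e i) (e i))) x y"
      by (rule hermitian_form_weighted_eigenbasis[OF V0' hf0 hf e diag that])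
    then show ?thesis by (simp add: weighted_form_def \<kappa>_def sum_distrib_left mult.assoc)
  qed
  have "energy S w V0 V b B (weighted_form h0 {..<?n} e \<kappa>)
      = energy S w V0 V b B (\<lambda>x y. of_real c * h x y)"
  proof (rule energy_cong)
    fix s i j assume s: "s \<in> S" and "i < dim (V s)" "j < dim (V s)"
    then have "B s i \<in> V0" "B s j \<in> V0" using onb_in[OF B[OF s]] V(2)[OF s] by auto
    then show "weighted_form h0 {..<?n} e \<kappa> (B s i) (B s j) = of_real c * h (B s i) (B s j)"
      by (rule wf)
  qed (intro wf onb_in[OF b])
  also have "\<dots> = energy S w V0 V b B h"
    using n gram_det_basis_pos[OF h] by (intro energy_rescale[OF c]) auto
  finally have "energy S w V0 V b B (weighted_form h0 {..<?n} e \<kappa>) = energy S w V0 V b B h" .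
  moreover have "\<kappa> 0 = 1" using pos[OF n] by (simp add: \<kappa>_def c_def)
  moreover have "\<kappa> i \<le> \<kappa> j" if "j < ?n" "i \<le> j" for i j
    using sorted[OF that(2,1)] c by (simp add: \<kappa>_def)
  ultimately show ?thesis using e by blast
qed

lemma tendsto_energy:
  assumes g: "hermitian_inner_product V0 g"
    and lim: "\<And>x y. x \<in> V0 \<Longrightarrow> y \<in> V0 \<Longrightarrow> (\<lambda>k. G k x y) \<longlonglongrightarrow> g x y"
  shows "(\<lambda>k. energy S w V0 V b B (G k)) \<longlonglongrightarrow> energy S w V0 V b B g"
proof -
  have BV: "B s i \<in> V0" if "s \<in> S" "i < dim (V s)" for s i
    using onb_in[OF B[OF that(1)] that(2)] V(2)[OF that(1)] by blast
  have s: "(\<lambda>k. ln (gram_det (G k) (dim (V s)) (B s))) \<longlonglongrightarrow> ln (gram_det g (dim (V s)) (B s))"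
    if "s \<in> S" for s
    using gram_det_basis_pos(1)[OF g that]
    by (intro tendsto_ln tendsto_gram_det lim BV[OF that]) auto
  have "(\<lambda>k. ln (gram_det (G k) (dim V0) b)) \<longlonglongrightarrow> ln (gram_det g (dim V0) b)"
    using gram_det_basis_pos(2)[OF g] by (intro tendsto_ln tendsto_gram_det lim onb_in[OF b]) auto
  with s show ?thesis
    unfolding energy_def by (intro tendsto_diff tendsto_sum tendsto_mult tendsto_const)
qed

text \<open>
  This is where stability enters. Here \<open>x j\<close> is the coefficient of the logarithm of the eigenvalue
  \<open>\<kappa> j\<close> in the lower bound for the energy; the partial sum of the \<open>x j\<close> over \<open>j < m\<close> equals
  \<open>(\<Sum>s\<in>S. w s dim (V s \<inter> F m)) - \<mu> m\<close>. It is negative for \<open>0 < m < dim V0\<close> by stability, applied to the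
  member \<open>F m\<close> of the limiting flag, and zero for \<open>m = dim V0\<close>.
\<close>

lemma eigenvalues_bounded:
  assumes stable: "slope_stable S w V0 V"
    and E: "\<And>k. onb h0 V0 (dim V0) (E k)" and e: "\<And>i. i < dim V0 \<Longrightarrow> e i \<in> V0"
    and lim: "\<And>i x. i < dim V0 \<Longrightarrow> x \<in> V0 \<Longrightarrow> (\<lambda>k. h0 x (E k i)) \<longlonglongrightarrow> h0 x (e i)"
    and sep: "\<And>x. x \<in> V0 \<Longrightarrow> (\<And>i. i < dim V0 \<Longrightarrow> h0 x (e i) = 0) \<Longrightarrow> x = 0"
    and one: "\<And>k. \<kappa> k 0 = 1" and sorted: "\<And>k i j. i \<le> j \<Longrightarrow> j < dim V0 \<Longrightarrow> \<kappa> k i \<le> \<kappa> k j"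
    and bound: "\<forall>\<^sub>F k in sequentially.
      energy S w V0 V b B (weighted_form h0 {..<dim V0} (E k) (\<kappa> k)) \<le> M"
  shows "\<exists>L. \<forall>\<^sub>F k in sequentially. \<forall>i<dim V0. \<kappa> k i \<le> L"
proof -
  define n where "n = dim V0"
  define \<mu> where "\<mu> = slope S w V0 V"
  define J where "J = (\<lambda>s. jumps h0 V0 n e (V s))"
  define F where "F = tail_annihilator h0 V0 n e"
  note V0' = fin_subspaceD[OF V0(1)] and hf0 = inner_product_form[OF h0]
  have n: "0 < n" using dim_pos[OF V0] by (simp add: n_def)
  have pos: "0 < \<kappa> k i" if "i < n" for k i
    using sorted[of 0 i k] one that by (simp add: n_def)
  have J: "J s \<subseteq> {..<n}" for s
    unfolding J_def n_def by (rule jumps_subset[OF V0(1) h0 e sep])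
  have cardJ: "card (J s \<inter> {..<j}) = dim (V s \<inter> F j)" if "s \<in> S" "j \<le> n" for s j
    unfolding J_def F_def n_def
    by (rule card_jumps[OF V0(1) h0 e sep V(1)[OF that(1)] V(2)[OF that(1)]]) (use that n_def in auto)
  have F: "subspace (F j)" "F j \<subseteq> V0" "F n = V0" for j
    unfolding F_def n_def
    using subspace_tail_annihilator[OF V0(1) h0 e sep] tail_annihilator_subset[OF V0(1) h0 e sep]
      tail_annihilator_top[OF V0(1) h0 e sep] by auto
  have dimF: "dim (F j) = j" if j: "j \<le> n" for j
  proof -
    let ?J = "jumps h0 V0 n e V0"
    have "card ?J = n" "?J \<subseteq> {..<n}"
      using card_jumps_total[OF V0(1) h0 e sep V0' subset_refl] jumps_subset[where W = V0, OF V0(1) h0 e sep]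
      by (auto simp: n_def)
    then have "?J = {..<n}" by (simp add: card_subset_eq)
    moreover have "card (?J \<inter> {..<j}) = dim (V0 \<inter> F j)"
      unfolding F_def n_def
      by (rule card_jumps[OF V0(1) h0 e sep V0' subset_refl]) (use j n_def in auto)
    moreover have "{..<n} \<inter> {..<j} = {..<j}" "V0 \<inter> F j = F j" using j F(2)[of j] by auto
    ultimately show ?thesis by simp
  qed
  define x where "x = (\<lambda>j. (\<Sum>s\<in>S. w s * of_bool (j \<in> J s)) - \<mu>)"
  have partial: "(\<Sum>j<m. x j) = total_weight S w (restrict_rep V (F m)) - \<mu> * real m" if m: "m \<le> n" for m
  proof -
    have "(\<Sum>j<m. x j) = (\<Sum>j<m. \<Sum>s\<in>S. w s * of_bool (j \<in> J s)) - \<mu> * real m"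
      by (simp add: x_def sum_subtractf mult.commute)
    also have "(\<Sum>j<m. \<Sum>s\<in>S. w s * of_bool (j \<in> J s)) = (\<Sum>s\<in>S. \<Sum>j<m. w s * of_bool (j \<in> J s))"
      by (rule sum.swap)
    also have "\<dots> = (\<Sum>s\<in>S. w s * real (dim (V s \<inter> F m)))"
    proof (intro sum.cong refl)
      fix s assume s: "s \<in> S"
      have "(\<Sum>j<m. w s * of_bool (j \<in> J s)) = w s * real (card ({..<m} \<inter> J s))"
        by (simp add: sum_distrib_left[symmetric] of_bool_def sum.If_cases)
      also have "{..<m} \<inter> J s = J s \<inter> {..<m}" by auto
      finally show "(\<Sum>j<m. w s * of_bool (j \<in> J s)) = w s * real (dim (V s \<inter> F m))"
        using cardJ[OF s m] by simp
    qed
    finally show ?thesis by (simp add: total_weight_def restrict_rep_def)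
  qed
  have neg: "(\<Sum>j<m. x j) < 0" if m: "0 < m" "m < n" for m
  proof -
    have d: "dim (F m) = m" using dimF m by simp
    have "F m \<noteq> {0}" using d m(1) dim_zero_subspace by (metis less_irrefl)
    moreover have "F m \<noteq> V0" using d m(2) n_def by (metis less_irrefl)
    ultimately have "subspace (F m) \<and> F m \<noteq> {0} \<and> F m \<subset> V0"
      using F(1,2)[of m] by (simp add: psubset_eq)
    then have "slope S w (F m) (restrict_rep V (F m)) < \<mu>"
      using stable[unfolded slope_stable_def] unfolding \<mu>_def by (elim allE impE)
    then have "total_weight S w (restrict_rep V (F m)) < \<mu> * real m"
      using m d by (simp add: slope_eq divide_less_eq)
    then show ?thesis using partial m by simp
  qed
  have total: "(\<Sum>j<n. x j) = 0"
  proof -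
    have "total_weight S w (restrict_rep V (F n)) = total_weight S w V"
      unfolding total_weight_def restrict_rep_def F(3) using V(2)
      by (intro sum.cong refl) (simp add: inf.absorb1)
    then show ?thesis unfolding partial[OF le_refl] using n by (simp add: \<mu>_def slope_eq n_def)
  qed
  \<comment> \<open>The inserted \<open>1\<close> covers the case \<open>n = 1\<close>, in which there is no intermediate index.\<close>
  define \<delta> where "\<delta> = Min (insert 1 ((\<lambda>m. - (\<Sum>j<m. x j)) ` {0<..<n}))"
  have \<delta>: "0 < \<delta>" unfolding \<delta>_def using neg by (subst Min_gr_iff) auto
  have partial_le: "(\<Sum>j<m. x j) \<le> - \<delta>" if "0 < m" "m < n" for m
  proof -
    have "\<delta> \<le> - (\<Sum>j<m. x j)" unfolding \<delta>_def using that by (intro Min_le) auto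
    then show ?thesis by simp
  qed
  have "\<forall>s\<in>S. \<exists>c>0. \<forall>\<^sub>F k in sequentially. \<forall>\<kappa>. (\<forall>i<n. 0 < \<kappa> i) \<longrightarrow>
      c * (\<Prod>j\<in>J s. \<kappa> j) \<le> gram_det (weighted_form h0 {..<n} (E k) \<kappa>) (dim (V s)) (B s)"
  proof
    fix s assume s: "s \<in> S"
    show "\<exists>c>0. \<forall>\<^sub>F k in sequentially. \<forall>\<kappa>. (\<forall>i<n. 0 < \<kappa> i) \<longrightarrow>
      c * (\<Prod>j\<in>J s. \<kappa> j) \<le> gram_det (weighted_form h0 {..<n} (E k) \<kappa>) (dim (V s)) (B s)"
      unfolding J_def n_def
      by (rule gram_det_weighted_lower_bound[OF V0(1) h0 e sep V(1)[OF s] V(2)[OF s] B[OF s] E lim])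
  qed
  from bchoice[OF this] obtain c where c: "\<And>s. s \<in> S \<Longrightarrow> 0 < c s"
    and low: "\<And>s. s \<in> S \<Longrightarrow> \<forall>\<^sub>F k in sequentially. \<forall>\<kappa>. (\<forall>i<n. 0 < \<kappa> i) \<longrightarrow>
      c s * (\<Prod>j\<in>J s. \<kappa> j) \<le> gram_det (weighted_form h0 {..<n} (E k) \<kappa>) (dim (V s)) (B s)"
    by auto
  define C where "C = (\<Sum>s\<in>S. w s * ln (c s))"
  have low': "\<forall>\<^sub>F k in sequentially. \<forall>s\<in>S.
      c s * (\<Prod>j\<in>J s. \<kappa> k j) \<le> gram_det (weighted_form h0 {..<n} (E k) (\<kappa> k)) (dim (V s)) (B s)"
    unfolding eventually_ball_finite_distrib[OF S]
  proof
    fix s assume "s \<in> S"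
    from low[OF this] show "\<forall>\<^sub>F k in sequentially.
      c s * (\<Prod>j\<in>J s. \<kappa> k j) \<le> gram_det (weighted_form h0 {..<n} (E k) (\<kappa> k)) (dim (V s)) (B s)"
      by (rule eventually_mono) (use pos in auto)
  qed
  have full: "gram_det (weighted_form h0 {..<n} (E k) (\<kappa> k)) n b = (\<Prod>j<n. \<kappa> k j)" for k
  proof -
    have Ek: "onb h0 V0 n (E k)" using E by (simp add: n_def)
    have wf: "hermitian_form V0 (weighted_form h0 {..<n} (E k) (\<kappa> k))"
      using onb_in[OF Ek] by (intro hermitian_form_weighted[OF hf0]) auto
    have entry: "weighted_form h0 {..<n} (E k) (\<kappa> k) (E k i) (E k j) = (if i = j then of_real (\<kappa> k i) else 0)"
      if "i < n" "j < n" for i j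
    proof -
      have "weighted_form h0 {..<n} (E k) (\<kappa> k) (E k i) (E k j)
          = (\<Sum>l<n. if l = i then (if i = j then of_real (\<kappa> k i) else 0) else 0)"
        unfolding weighted_form_def using onb_orth[OF Ek] that by (intro sum.cong) auto
      then show ?thesis using that by simp
    qed
    have "gram_det (weighted_form h0 {..<n} (E k) (\<kappa> k)) n b
        = gram_det h0 n b * (\<Prod>i<n. Re (weighted_form h0 {..<n} (E k) (\<kappa> k) (E k i) (E k i)))"
      by (rule gram_det_relative[OF Ek V0' hf0 wf]) (use entry onb_in[OF b] n_def in auto)
    also have "gram_det h0 n b = 1" using gram_det_onb[OF b hf0] by (simp add: n_def)
    finally show ?thesis using entry by simp
  qed
  have "\<forall>\<^sub>F k in sequentially. \<forall>i<n. \<kappa> k i \<le> exp ((M - C) / \<delta>)"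
    using low' bound
  proof eventually_elim
    case (elim k)
    define t where "t = (\<lambda>j. ln (\<kappa> k j))"
    have lnprod: "ln (\<Prod>j\<in>I. \<kappa> k j) = (\<Sum>j\<in>I. t j)" if "I \<subseteq> {..<n}" for I
    proof -
      have "\<kappa> k i \<noteq> 0" if "i \<in> I" for i
        using pos[of i k] \<open>I \<subseteq> {..<n}\<close> that by fastforce
      moreover have "finite I" using that finite_subset by blast
      ultimately show ?thesis unfolding t_def by (intro ln_prod) auto
    qed
    have summand: "ln (c s) + (\<Sum>j\<in>J s. t j) \<le> ln (gram_det (weighted_form h0 {..<n} (E k) (\<kappa> k)) (dim (V s)) (B s))"
      if s: "s \<in> S" for s
    proof -
      have p: "0 < (\<Prod>j\<in>J s. \<kappa> k j)" using J[of s] pos by (intro prod_pos) auto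
      have "ln (c s) + (\<Sum>j\<in>J s. t j) = ln (c s * (\<Prod>j\<in>J s. \<kappa> k j))"
        using c[OF s] p lnprod[OF J, of s] by (simp add: ln_mult)
      also have "\<dots> \<le> ln (gram_det (weighted_form h0 {..<n} (E k) (\<kappa> k)) (dim (V s)) (B s))"
        using elim(1) s mult_pos_pos[OF c[OF s] p] by (intro ln_mono) auto
      finally show ?thesis .
    qed
    have "\<delta> * t (n - 1) \<le> (\<Sum>j<n. x j * t j)"
    proof (rule abel_summation_lower_bound[OF n _ _ total partial_le])
      show "t i \<le> t j" if "i \<le> j" "j < n" for i j
        unfolding t_def using pos[of i k] pos[of j k] sorted[of i j k] that by (simp add: n_def)
      show "t 0 = 0" by (simp add: t_def one)
    qed
    also have "(\<Sum>j<n. x j * t j) = (\<Sum>s\<in>S. w s * (\<Sum>j\<in>J s. t j)) - \<mu> * (\<Sum>j<n. t j)"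
    proof -
      have "(\<Sum>j<n. x j * t j) = (\<Sum>j<n. \<Sum>s\<in>S. w s * of_bool (j \<in> J s) * t j) - \<mu> * (\<Sum>j<n. t j)"
        by (simp add: x_def left_diff_distrib sum_subtractf sum_distrib_right sum_distrib_left)
      also have "(\<Sum>j<n. \<Sum>s\<in>S. w s * of_bool (j \<in> J s) * t j)
          = (\<Sum>s\<in>S. \<Sum>j<n. w s * of_bool (j \<in> J s) * t j)" by (rule sum.swap)
      also have "\<dots> = (\<Sum>s\<in>S. w s * (\<Sum>j\<in>J s. t j))"
      proof (intro sum.cong refl)
        fix s
        have Jsum: "(\<Sum>j\<in>J s. t j) = (\<Sum>j<n. if j \<in> J s then t j else 0)"
          using J[of s] by (simp add: sum.If_cases inf.absorb2)
        show "(\<Sum>j<n. w s * of_bool (j \<in> J s) * t j) = w s * (\<Sum>j\<in>J s. t j)"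
          unfolding Jsum sum_distrib_left by (intro sum.cong) auto
      qed
      finally show ?thesis .
    qed
    also have "(\<Sum>s\<in>S. w s * (\<Sum>j\<in>J s. t j))
        = (\<Sum>s\<in>S. w s * (ln (c s) + (\<Sum>j\<in>J s. t j))) - C"
      by (simp add: C_def distrib_left sum.distrib)
    also have "\<dots> \<le> (\<Sum>s\<in>S. w s * ln (gram_det (weighted_form h0 {..<n} (E k) (\<kappa> k)) (dim (V s)) (B s))) - C"
      using summand w by (intro diff_right_mono sum_mono mult_left_mono) (auto simp: less_imp_le)
    finally have "\<delta> * t (n - 1) \<le> energy S w V0 V b B (weighted_form h0 {..<n} (E k) (\<kappa> k)) - C"
      unfolding energy_def n_def[symmetric] full lnprod[OF subset_refl] \<mu>_def[symmetric] by simp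
    then have "\<delta> * t (n - 1) \<le> M - C" using elim(2) by (simp add: n_def)
    then have "t (n - 1) \<le> (M - C) / \<delta>" using \<delta> by (simp add: field_simps)
    then have top: "\<kappa> k (n - 1) \<le> exp ((M - C) / \<delta>)"
      using pos[of "n - 1" k] n unfolding t_def by (metis diff_less exp_le_cancel_iff exp_ln less_one)
    show "\<forall>i<n. \<kappa> k i \<le> exp ((M - C) / \<delta>)"
    proof (intro allI impI)
      fix i assume "i < n"
      then have "\<kappa> k i \<le> \<kappa> k (n - 1)" using sorted[of i "n - 1" k] by (simp add: n_def)
      then show "\<kappa> k i \<le> exp ((M - C) / \<delta>)" using top by simp
    qed
  qed
  then show ?thesis unfolding n_def by blast
qed

text \<open>
  The limits \<open>e\<close> of the eigenbases and \<open>\<kappa>'\<close> of the eigenvalues define the minimizer \<open>g\<close>. It is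
  positive definite because all eigenvalues are at least \<open>1\<close>, which gives \<open>h0 \<le> g\<close>.
\<close>

lemma energy_minimizer_exists:
  assumes stable: "slope_stable S w V0 V"
  shows "\<exists>h. hermitian_inner_product V0 h \<and>
    (\<forall>h'. hermitian_inner_product V0 h' \<longrightarrow> energy S w V0 V b B h \<le> energy S w V0 V b B h')"
proof -
  define n where "n = dim V0"
  let ?\<E> = "energy S w V0 V b B" and ?A = "{h. hermitian_inner_product V0 h}"
  note V0' = fin_subspaceD[OF V0(1)] and hf0 = inner_product_form[OF h0]
  have n: "0 < n" using dim_pos[OF V0] by (simp add: n_def)
  have b': "onb h0 V0 n b" using b by (simp add: n_def)
  have "?A \<noteq> {}" using h0 by auto
  then obtain H where H: "\<And>k. H k \<in> ?A"
    and min: "\<And>a \<epsilon>. a \<in> ?A \<Longrightarrow> 0 < \<epsilon> \<Longrightarrow> \<forall>\<^sub>F k in sequentially. ?\<E> (H k) < ?\<E> a + \<epsilon>"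
    using minimizing_sequence[of ?A ?\<E>] by metis
  have "\<forall>k. \<exists>e \<kappa>. onb h0 V0 n e \<and> \<kappa> 0 = 1 \<and> (\<forall>j<n. \<forall>i\<le>j. \<kappa> i \<le> \<kappa> j) \<and>
      ?\<E> (weighted_form h0 {..<n} e \<kappa>) = ?\<E> (H k)"
    using normal_form_same_energy H unfolding n_def by blast
  then obtain E0 \<kappa>0 where E0: "\<And>k. onb h0 V0 n (E0 k)" and one0: "\<And>k. \<kappa>0 k 0 = 1"
    and sorted0: "\<And>k i j. j < n \<Longrightarrow> i \<le> j \<Longrightarrow> \<kappa>0 k i \<le> \<kappa>0 k j"
    and en0: "\<And>k. ?\<E> (weighted_form h0 {..<n} (E0 k) (\<kappa>0 k)) = ?\<E> (H k)"
    by metis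
  \<comment> \<open>Orthonormal frames form a compact set, so the eigenbases converge along a subsequence.\<close>
  have bounded0: "bounded (range (\<lambda>k. h0 (E0 k (fst p)) (b (snd p))))" if "p \<in> {..<n} \<times> {..<n}" for p
  proof -
    have "norm (h0 (E0 k (fst p)) (b (snd p))) \<le> 1" for k
      using fourier_coefficient_le_1[OF b' V0' hf0 onb_in[OF E0]] onb_orth[OF E0] that by auto
    then show ?thesis by (auto simp: bounded_iff)
  qed
  obtain r l where r: "strict_mono r"
    and l: "\<And>p. p \<in> {..<n} \<times> {..<n} \<Longrightarrow> (\<lambda>k. h0 (E0 (r k) (fst p)) (b (snd p))) \<longlonglongrightarrow> l p"
    using convergent_subsequence_finite_family[of "{..<n} \<times> {..<n}" "\<lambda>k p. h0 (E0 k (fst p)) (b (snd p))"]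
      bounded0 by auto
  define E where "E = (\<lambda>k. E0 (r k))"
  define \<kappa> where "\<kappa> = (\<lambda>k. \<kappa>0 (r k))"
  have E: "\<And>k. onb h0 V0 n (E k)" and one: "\<And>k. \<kappa> k 0 = 1"
    and sorted: "\<And>k i j. j < n \<Longrightarrow> i \<le> j \<Longrightarrow> \<kappa> k i \<le> \<kappa> k j"
    using E0 one0 sorted0 by (auto simp: E_def \<kappa>_def)
  define e where "e = (\<lambda>i. \<Sum>p<n. l (i, p) *s b p)"
  have e: "e i \<in> V0" for i
    unfolding e_def using onb_in[OF b'] V0' by (intro subspace_sum subspace_scale) auto
  have lim: "(\<lambda>k. h0 x (E k i)) \<longlonglongrightarrow> h0 x (e i)" if i: "i < n" and x: "x \<in> V0" for i x
  proof -
    have "h0 x (E k i) = (\<Sum>p<n. cnj (h0 (E k i) (b p)) * h0 x (b p))" for k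
      using hermitian_sum_right[OF V0' hf0, of "{..<n}" b x "\<lambda>p. h0 (E k i) (b p)"]
        onb_expand[OF b' onb_in[OF E i]] onb_in[OF b'] x by auto
    moreover have "h0 x (e i) = (\<Sum>p<n. cnj (l (i, p)) * h0 x (b p))"
      unfolding e_def using onb_in[OF b'] x by (intro hermitian_sum_right[OF V0' hf0]) auto
    moreover have "(\<lambda>k. h0 (E k i) (b p)) \<longlonglongrightarrow> l (i, p)" if "p < n" for p
      using l[of "(i, p)"] i that by (simp add: E_def)
    ultimately show ?thesis by (auto intro!: tendsto_intros)
  qed
  \<comment> \<open>Parseval's identity survives in the limit, so the limiting functionals separate points.\<close>
  have parseval_e: "Re (h0 x x) = (\<Sum>i<n. (cmod (h0 x (e i)))\<^sup>2)" if x: "x \<in> V0" for x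
  proof -
    have "(\<lambda>k. \<Sum>i<n. (cmod (h0 x (E k i)))\<^sup>2) \<longlonglongrightarrow> (\<Sum>i<n. (cmod (h0 x (e i)))\<^sup>2)"
      using x by (intro tendsto_sum tendsto_power tendsto_norm lim) auto
    then show ?thesis
      unfolding parseval_norm[OF E V0' hf0 x, symmetric] by (simp add: LIMSEQ_const_iff)
  qed
  have sep: "x = 0" if "x \<in> V0" "\<And>i. i < n \<Longrightarrow> h0 x (e i) = 0" for x
  proof -
    have "Re (h0 x x) = 0" using parseval_e[OF that(1)] that(2) by simp
    then have "h0 x x = 0" using hermitian_self_real[OF hf0 that(1)] by simp
    then show ?thesis by (rule inner_eq_0_imp[OF h0 that(1)])
  qed
  have en: "?\<E> (weighted_form h0 {..<n} (E k) (\<kappa> k)) = ?\<E> (H (r k))" for k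
    unfolding E_def \<kappa>_def by (rule en0)
  have "\<forall>\<^sub>F k in sequentially. ?\<E> (H k) < ?\<E> h0 + 1" using min[of h0 1] h0 by simp
  then have bound: "\<forall>\<^sub>F k in sequentially. ?\<E> (weighted_form h0 {..<n} (E k) (\<kappa> k)) \<le> ?\<E> h0 + 1"
    unfolding en by (rule eventually_mono[OF eventually_subseq[OF r]]) simp
  have "\<exists>L. \<forall>\<^sub>F k in sequentially. \<forall>i<n. \<kappa> k i \<le> L"
    unfolding n_def
    by (rule eigenvalues_bounded[where E = E and e = e and \<kappa> = \<kappa>,
          OF stable E[unfolded n_def] e lim[unfolded n_def] sep[unfolded n_def] one
            sorted[unfolded n_def] bound[unfolded n_def]])
  then obtain L where L: "\<forall>\<^sub>F k in sequentially. \<forall>i<n. \<kappa> k i \<le> L"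
    by auto
  \<comment> \<open>The bound holds only eventually; the sequence is shifted by \<open>N\<close> to make it hold throughout.\<close>
  then obtain N where N: "\<And>k i. N \<le> k \<Longrightarrow> i < n \<Longrightarrow> \<kappa> k i \<le> L"
    unfolding eventually_sequentially by blast
  have ge1: "1 \<le> \<kappa> k i" if "i < n" for k i using sorted[OF that, of 0 k] one by simp
  have "bounded (range (\<lambda>k. \<kappa> (k + N) i))" if "i \<in> {..<n}" for i
  proof -
    have "norm (\<kappa> (k + N) i) \<le> L" for k using N[of "k + N" i] ge1[of i "k + N"] that by simp
    then show ?thesis by (auto simp: bounded_iff)
  qed
  then obtain q \<kappa>' where q: "strict_mono q"
    and \<kappa>': "\<And>i. i < n \<Longrightarrow> (\<lambda>k. \<kappa> (q k + N) i) \<longlonglongrightarrow> \<kappa>' i"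
    using convergent_subsequence_finite_family[of "{..<n}" "\<lambda>k i. \<kappa> (k + N) i"] by auto
  define z where "z = (\<lambda>k. q k + N)"
  have z: "strict_mono z" using q by (simp add: z_def strict_mono_def)
  have \<kappa>'1: "1 \<le> \<kappa>' i" if "i < n" for i
    using LIMSEQ_le_const[OF \<kappa>'[OF that]] ge1[OF that] by blast
  define g where "g = weighted_form h0 {..<n} e \<kappa>'"
  have g: "hermitian_inner_product V0 g"
    unfolding inner_product_iff
  proof (intro conjI ballI impI)
    show "hermitian_form V0 g" unfolding g_def by (rule hermitian_form_weighted[OF hf0 e])
    fix x assume x: "x \<in> V0" "x \<noteq> 0"
    have "0 < Re (h0 x x)" using h0 x by (auto simp: inner_product_iff)
    also have "\<dots> \<le> (\<Sum>i<n. \<kappa>' i * (cmod (h0 x (e i)))\<^sup>2)"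
      unfolding parseval_e[OF x(1)] using \<kappa>'1 by (intro sum_mono) (simp add: mult_le_cancel_right1)
    also have "\<dots> = Re (g x x)"
      unfolding g_def by (rule weighted_form_self[OF hf0 e x(1), symmetric])
    finally show "0 < Re (g x x)" .
  qed
  have "(\<lambda>k. weighted_form h0 {..<n} (E (z k)) (\<kappa> (z k)) x y) \<longlonglongrightarrow> g x y" if xy: "x \<in> V0" "y \<in> V0" for x y
  proof -
    have lz: "(\<lambda>k. h0 x (E (z k) i)) \<longlonglongrightarrow> h0 x (e i)" if "i < n" "x \<in> V0" for i x
      using LIMSEQ_subseq_LIMSEQ[OF lim[OF that] z] by (simp add: o_def)
    have lz': "(\<lambda>k. h0 (E (z k) i) y) \<longlonglongrightarrow> h0 (e i) y" if "i < n" for i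
      using tendsto_cnj[OF lz[OF that xy(2)]] hermitian_sym[OF hf0 xy(2) onb_in[OF E that]]
        hermitian_sym[OF hf0 xy(2) e] by simp
    show ?thesis
      unfolding g_def weighted_form_def
      by (intro tendsto_sum tendsto_mult tendsto_of_real lz lz' xy) (use \<kappa>' in \<open>auto simp: z_def\<close>)
  qed
  then have conv: "(\<lambda>k. ?\<E> (H (r (z k)))) \<longlonglongrightarrow> ?\<E> g"
    unfolding en[symmetric] by (rule tendsto_energy[OF g])
  show ?thesis
  proof (intro exI[of _ g] conjI g allI impI)
    fix h' assume h': "hermitian_inner_product V0 h'"
    show "?\<E> g \<le> ?\<E> h'"
    proof (rule field_le_epsilon)
      fix \<epsilon> :: real assume "0 < \<epsilon>"
      then have "\<forall>\<^sub>F k in sequentially. ?\<E> (H k) < ?\<E> h' + \<epsilon>" using min h' by simp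
      then have "\<forall>\<^sub>F k in sequentially. ?\<E> (H (r (z k))) \<le> ?\<E> h' + \<epsilon>"
        by (rule eventually_mono[OF eventually_subseq[OF z, OF eventually_subseq[OF r]]]) simp
      then show "?\<E> g \<le> ?\<E> h' + \<epsilon>" using tendsto_upperbound[OF conv] by simp
    qed
  qed
qed

end

lemma inner_product_exists:
  assumes "fin_subspace V0"
  obtains h where "hermitian_inner_product V0 h"
proof -
  obtain C where C: "finite C" "independent C" "span C = V0"
    using fin_subspace_basis[OF assms fin_subspaceD[OF assms] subset_refl] by auto
  let ?r = "representation C"
  define h where "h = (\<lambda>x y. \<Sum>v\<in>C. ?r x v * cnj (?r y v))"
  have "hermitian_inner_product V0 h"
    unfolding hermitian_inner_product_def
  proof (intro conjI ballI allI impI)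
    fix x y z assume "x \<in> V0" "y \<in> V0" "z \<in> V0"
    then show "h (x + y) z = h x z + h y z"
      unfolding h_def using representation_add[OF C(2)] C(3)
      by (simp add: sum.distrib[symmetric] distrib_right)
  next
    fix c x y assume "x \<in> V0" "y \<in> V0"
    then show "h (c *s x) y = c * h x y"
      unfolding h_def using representation_scale[OF C(2)] C(3)
      by (simp add: sum_distrib_left mult.assoc)
  next
    fix x y show "h y x = cnj (h x y)" by (simp add: h_def mult.commute)
  next
    fix x assume x: "x \<in> V0" "x \<noteq> 0"
    have "Re (h x x) = (\<Sum>v\<in>C. (cmod (?r x v))\<^sup>2)"
      unfolding h_def complex_norm_square[symmetric] by (simp del: of_real_power)
    moreover have "(\<Sum>v\<in>C. (cmod (?r x v))\<^sup>2) \<noteq> 0"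
    proof
      assume "(\<Sum>v\<in>C. (cmod (?r x v))\<^sup>2) = 0"
      then have "?r x v = 0" if "v \<in> C" for v
        using sum_nonneg_eq_0_iff[OF C(1), of "\<lambda>v. (cmod (?r x v))\<^sup>2"] that by simp
      moreover have "(\<Sum>v\<in>C. ?r x v *s v) = x"
        using sum_representation_eq[OF C(2) _ C(1) subset_refl, of x] x C(3) by simp
      ultimately show False using x(2) by simp
    qed
    moreover have "0 \<le> (\<Sum>v\<in>C. (cmod (?r x v))\<^sup>2)" by (intro sum_nonneg) simp
    ultimately show "0 < Re (h x x)" by linarith
  qed
  then show ?thesis by (rule that)
qed

lemma stable_imp_balanced:
  assumes S: "finite S" and w: "\<And>s. s \<in> S \<Longrightarrow> 0 < w s"
    and V0: "fin_subspace V0" "V0 \<noteq> {0}"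
    and V: "\<And>s. s \<in> S \<Longrightarrow> subspace (V s)" "\<And>s. s \<in> S \<Longrightarrow> V s \<subseteq> V0"
    and stable: "slope_stable S w V0 V"
  shows "\<exists>h. balanced S w V0 V (of_real (slope S w V0 V)) h"
proof -
  obtain h0 where h0: "hermitian_inner_product V0 h0" using inner_product_exists[OF V0(1)] .
  obtain b where b: "onb h0 V0 (dim V0) b" using onb_exists[OF V0(1) h0] .
  have "\<exists>f. onb h0 (V s) (dim (V s)) f" if s: "s \<in> S" for s
    using subspace_onb_exists[OF V0(1) h0 V(1)[OF s] V(2)[OF s]] by metis
  then obtain B where B: "\<And>s. s \<in> S \<Longrightarrow> onb h0 (V s) (dim (V s)) (B s)" by metis
  have "\<exists>h. hermitian_inner_product V0 h \<and>
    (\<forall>h'. hermitian_inner_product V0 h' \<longrightarrow> energy S w V0 V b B h \<le> energy S w V0 V b B h')"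
    by (rule energy_minimizer_exists[OF S w V0 V h0 b B stable])
  then obtain h where h: "hermitian_inner_product V0 h"
    "\<And>h'. hermitian_inner_product V0 h' \<Longrightarrow> energy S w V0 V b B h \<le> energy S w V0 V b B h'"
    by auto
  have "balanced S w V0 V (of_real (slope S w V0 V)) h"
    by (rule energy_minimizer_balanced[OF S V0(1) V h0 b B h])
  then show ?thesis by blast
qed

lemma polystable_imp_balanced:
  assumes S: "finite S" and w: "\<And>s. s \<in> S \<Longrightarrow> 0 < w s"
    and V0: "fin_subspace V0" "V0 \<noteq> {0}"
    and V: "\<And>s. s \<in> S \<Longrightarrow> subspace (V s)" "\<And>s. s \<in> S \<Longrightarrow> V s \<subseteq> V0"
    and poly: "slope_polystable S w V0 V"
  shows "\<exists>h. balanced S w V0 V (of_real (slope S w V0 V)) h"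
proof -
  have semi: "slope_semistable S w V0 V"
    using poly by (simp add: slope_polystable_def)
  obtain n A where A':
      "\<forall>i<n. subspace (A i) \<and> A i \<noteq> {0} \<and> A i \<subseteq> V0 \<and> slope_stable S w (A i) (restrict_rep V (A i))"
    and sum: "internal_direct_sum V0 n A"
    and sum': "\<forall>s\<in>S. internal_direct_sum (V s) n (\<lambda>i. restrict_rep V (A i) s)"
    using poly unfolding slope_polystable_def by auto
  have A: "subspace (A i)" "A i \<noteq> {0}" "A i \<subseteq> V0" "slope_stable S w (A i) (restrict_rep V (A i))"
    if "i < n" for i
    using A' that by auto
  note sum = sum sum'[rule_format]
  have inter: "V s \<inter> V0 = V s" if "s \<in> S" for s using V(2)[OF that] by blast
  have summand: "\<exists>h. balanced S w (A i) (restrict_rep V (A i)) (of_real (slope S w V0 V)) h" if i: "i < n" for i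
  proof -
    have "slope S w (A i) (restrict_rep V (A i)) = slope S w V0 V"
      by (rule summand_slope[OF S V0 V semi A(1-3) sum i])
    moreover have "\<exists>h. balanced S w (A i) (restrict_rep V (A i))
        (of_real (slope S w (A i) (restrict_rep V (A i)))) h"
      using V(1) A(1)[OF i]
      by (intro stable_imp_balanced[OF S w fin_subspace_subset[OF V0(1) A(1)[OF i] A(3)[OF i]]
            A(2)[OF i] _ _ A(4)[OF i]]) (auto simp: restrict_rep_def subspace_inter)
    ultimately show ?thesis by simp
  qed
  have "\<exists>h. balanced S w V0 (restrict_rep V V0) (of_real (slope S w V0 V)) h"
    by (rule balanced_internal_direct_sum[OF V0(1) V(1) A(1,3) summand sum(1) subset_refl])
      (simp_all add: inter sum(2))
  moreover have "balanced S w V0 (restrict_rep V V0) c h \<longleftrightarrow> balanced S w V0 V c h" for c h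
    unfolding balanced_def restrict_rep_def using inter by simp
  ultimately show ?thesis by simp
qed

end

section \<open>Unitarizability and polystability\<close>

theorem corollary6p1:
  fixes scale :: "complex \<Rightarrow> 'v::ab_group_add \<Rightarrow> 'v"
    and S :: "'s set" and r :: "'s rel"
    and w :: "'s \<Rightarrow> real"
    and V0 :: "'v set" and V :: "'s \<Rightarrow> 'v set"
  assumes "complex_vector_space scale"
    and "finite S" and "partial_order_on S r"
    and "\<And>s. s \<in> S \<Longrightarrow> w s \<in> \<int> \<and> 0 < w s"
    and "complex_vector_space.subspace_representation scale S r V0 V"
  shows "complex_vector_space.unitarizable scale S w V0 V \<longleftrightarrow>
         complex_vector_space.slope_polystable scale S w V0 V"
proof -
  interpret complex_vector_space scale by (rule assms(1))
  note rep = assms(5)[unfolded subspace_representation_def]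
  have w: "\<And>s. s \<in> S \<Longrightarrow> 0 < w s" using assms(4) by blast
  have V0: "fin_subspace V0" "V0 \<noteq> {0}"
    and V: "\<And>s. s \<in> S \<Longrightarrow> subspace (V s)" "\<And>s. s \<in> S \<Longrightarrow> V s \<subseteq> V0"
    using rep by (auto simp: fin_subspace_def)
  show ?thesis
    unfolding unitarizable_iff_balanced
  proof
    assume "\<exists>h c. balanced S w V0 V c h"
    then obtain h c where bal: "balanced S w V0 V c h" by auto
    show "slope_polystable S w V0 V"
      by (rule balanced_imp_polystable[OF assms(2) w V0 V bal])
  next
    assume poly: "slope_polystable S w V0 V"
    have "\<exists>h. balanced S w V0 V (of_real (slope S w V0 V)) h"
      by (rule polystable_imp_balanced[OF assms(2) w V0 V poly])
    then show "\<exists>h c. balanced S w V0 V c h" by auto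
  qed
qed

end
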